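(* Let $\Omega=(0,1)^n\subseteq\mathbb{R}^n$. Let $g\in\pi(\mathrm{CPWL}(\Omega))\cap\mathcal{S}$. Then $g\in\mathcal{E}$ if and only if every $h\in\mathcal{B}$ with $\mathrm{supp}(|\mathrm{D}^2 h|)\subseteq\mathrm{supp}(|\mathrm{D}^2 g|)$ satisfies $h\in\mathrm{span}(g)$.
   Context: For a matrix $M\in\mathbb{R}^{n\times n}$ and $q\in[1,+\infty]$, $|M|_q$ denotes the Schatten $q$-norm, i.e. the $\ell^q$ norm of the vector of singular values of $M$. For $f\in L^1_{\mathrm{loc}}(\Omega)$ and $A\subseteq\Omega$ open, set $$|\mathrm{D}^2 f|(A)=|\mathrm{D}^2_1 f|(A):=\sup_F\int_A\sum_{i,j=1}^n f\,\partial_i\partial_jF_{i,j}\,d\mathcal{L}^n,$$ the supremum over all $F\in C_c^\infty(A)^{n\times n}$ with $\sup_x|F(x)|_\infty\le1$ (Schatten $\infty$-norm). If $|\mathrm{D}^2 f|(\Omega)<\infty$ this set function is the restriction to open sets of a finite Borel measure on $\Omega$, still denoted $|\mathrm{D}^2 f|$. $\mathrm{CPWL}(\Omega)$ is the set of $f\in C(\Omega)$ for which there is a decomposition $\{P_k\}_k$ of $\mathbb{R}^n$ into $n$-dimensional convex polytopes (closed convex hulls of finitely many points), intersecting only at their boundaries, such that $f|_{P_k\cap\Omega}$ is affine for every $k$ and every ball intersects only finitely many $P_k$. Let $\mathcal{A}\subseteq L^1(\Omega)$ be the closed subspace of affine functions and $\pi:L^1(\Omega)\to L^1(\Omega)/\mathcal{A}$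 the canonical projection onto the quotient Banach space. Since $|\mathrm{D}^2 f|$ is unchanged when an affine function is added to $f$, $|\mathrm{D}^2 g|$ is well defined for $g\in L^1(\Omega)/\mathcal{A}$. Define $$\mathcal{B}:=\{g\in L^1(\Omega)/\mathcal{A}:|\mathrm{D}^2 g|(\Omega)\le1\},\qquad \mathcal{S}:=\{g\in L^1(\Omega)/\mathcal{A}:|\mathrm{D}^2 g|(\Omega)=1\},$$ and $\mathcal{E}:=\pi(\mathrm{CPWL}(\Omega))\cap\mathrm{ext}(\mathcal{B})$, where $\mathrm{ext}(\mathcal{B})$ is the set of extreme points of the convex set $\mathcal{B}$. The linear span is taken in $L^1(\Omega)/\mathcal{A}$. *)

theory Defs
  imports "HOL-Analysis.Analysis"
begin

section \<open>Smooth functions and the Schatten \<open>\<infinity>\<close>-norm\<close>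

definition partial_deriv :: "'n::finite \<Rightarrow> (real^'n \<Rightarrow> real) \<Rightarrow> real^'n \<Rightarrow> real" where
  "partial_deriv i f x = frechet_derivative f (at x) (axis i 1)"

text \<open>Class \<open>C\<^sup>k\<close> on the whole space.\<close>

primrec Ck :: "nat \<Rightarrow> (real^'n::finite \<Rightarrow> real) \<Rightarrow> bool" where
  "Ck 0 f \<longleftrightarrow> continuous_on UNIV f"
| "Ck (Suc k) f \<longleftrightarrow> (\<forall>x. f differentiable (at x)) \<and> (\<forall>i. Ck k (partial_deriv i f))"

definition smooth :: "(real^'n::finite \<Rightarrow> real) \<Rightarrow> bool" where
  "smooth f \<longleftrightarrow> (\<forall>k. Ck k f)"

definition singular_values :: "real^'n^'n \<Rightarrow> real set" where
  "singular_values M =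
     {\<sigma>. \<sigma> \<ge> 0 \<and> (\<exists>v. v \<noteq> 0 \<and> (transpose M ** M) *v v = \<sigma>\<^sup>2 *\<^sub>R v)}"

text \<open>Multiplicities play no role in the \<open>\<ell>\<^sup>\<infinity>\<close> norm, so the set of singular values suffices.\<close>

definition schatten_infty :: "real^'n^'n \<Rightarrow> real" where
  "schatten_infty M = Sup (singular_values M)"

section \<open>The Hessian total variation\<close>

text \<open>The fields in \<open>C\<^sub>c\<^sup>\<infinity>(A)\<close> of norm at most one, extended by zero to the whole space.\<close>

definition test_fields :: "(real^'n::finite) set \<Rightarrow> (real^'n \<Rightarrow> real^'n^'n) set" where
  "test_fields A =
     {F. (\<forall>i j. smooth (\<lambda>x. F x $ i $ j)) \<and>
         compact (closure {x. F x \<noteq> 0}) \<and> closure {x. F x \<noteq> 0} \<subseteq> A \<and>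
         (\<forall>x. schatten_infty (F x) \<le> 1)}"

definition hessian_variation :: "(real^'n::finite \<Rightarrow> real) \<Rightarrow> (real^'n) set \<Rightarrow> ereal" where
  "hessian_variation f A =
     (SUP F\<in>test_fields A. ereal (LINT x:A|lebesgue.
        (\<Sum>i\<in>UNIV. \<Sum>j\<in>UNIV. f x * partial_deriv i (partial_deriv j (\<lambda>y. F y $ i $ j)) x)))"

section \<open>Continuous piecewise linear functions\<close>

definition cpwl :: "(real^'n::finite) set \<Rightarrow> (real^'n \<Rightarrow> real) set" where
  "cpwl \<Omega> =
     {f. continuous_on \<Omega> f \<and>
         (\<exists>\<P>. \<Union>\<P> = UNIV \<and>
              (\<forall>P\<in>\<P>. polytope P \<and> aff_dim P = int CARD('n)) \<and>
              (\<forall>P\<in>\<P>. \<forall>Q\<in>\<P>. P \<noteq> Q \<longrightarrow> P \<inter> Q \<subseteq> frontier P \<inter> frontier Q) \<and>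
              (\<forall>P\<in>\<P>. \<exists>a b. \<forall>x\<in>P \<inter> \<Omega>. f x = a \<bullet> x + b) \<and>
              (\<forall>x r. finite {P\<in>\<P>. P \<inter> ball x r \<noteq> {}}))}"

section \<open>Integrable functions on the unit cube modulo affine functions\<close>

definition unit_cube :: "(real^'n::finite) set" where
  "unit_cube = {x. \<forall>i. 0 < x $ i \<and> x $ i < 1}"

text \<open>The quotient of \<open>L\<^sup>1\<close> of the cube by the affine functions is formed in one step from
  integrable representatives; only its vector space structure is needed.\<close>

definition eq_mod_affine :: "(real^'n::finite \<Rightarrow> real) \<Rightarrow> (real^'n \<Rightarrow> real) \<Rightarrow> bool" where
  "eq_mod_affine f g \<longleftrightarrow>
     f absolutely_integrable_on unit_cube \<and> g absolutely_integrable_on unit_cube \<and>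
     (\<exists>a b. AE x in lebesgue. x \<in> unit_cube \<longrightarrow> f x - g x = a \<bullet> x + b)"

lemma eq_mod_affineI:
  assumes "f absolutely_integrable_on unit_cube" "g absolutely_integrable_on unit_cube"
    and "AE x in lebesgue. x \<in> unit_cube \<longrightarrow> f x - g x = a \<bullet> x + b"
  shows "eq_mod_affine f g"
  using assms unfolding eq_mod_affine_def by blast

lemma eq_mod_affineE:
  assumes "eq_mod_affine f g"
  obtains a b where "f absolutely_integrable_on unit_cube" "g absolutely_integrable_on unit_cube"
    "AE x in lebesgue. x \<in> unit_cube \<longrightarrow> f x - g x = a \<bullet> x + b"
  using assms unfolding eq_mod_affine_def by blast

lemma eq_mod_affine_refl: "f absolutely_integrable_on unit_cube \<Longrightarrow> eq_mod_affine f f"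
  by (rule eq_mod_affineI[where a = 0 and b = 0]) auto

lemma absolutely_integrable_on_cmult:
  fixes f :: "real^'n::finite \<Rightarrow> real"
  assumes "f absolutely_integrable_on S"
  shows "(\<lambda>x. c * f x) absolutely_integrable_on S"
  using assms by (rule set_integrable_mult_right)

lemma absolutely_integrable_on_plus:
  fixes f :: "real^'n::finite \<Rightarrow> real"
  assumes "f absolutely_integrable_on S" "g absolutely_integrable_on S"
  shows "(\<lambda>x. f x + g x) absolutely_integrable_on S"
  using assms by (rule set_integral_add(1))

lemma absolutely_integrable_on_zero:
  "(\<lambda>x. 0 :: real) absolutely_integrable_on (S :: (real^'n::finite) set)"
  by (simp add: set_integrable_def)

lemma part_equivp_eq_mod_affine: "part_equivp (eq_mod_affine :: (real^'n::finite \<Rightarrow> real) \<Rightarrow> _)"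
proof (rule part_equivpI)
  show "\<exists>x::real^'n \<Rightarrow> real. eq_mod_affine x x"
    using eq_mod_affine_refl absolutely_integrable_on_zero by blast
  show "symp (eq_mod_affine :: (real^'n \<Rightarrow> real) \<Rightarrow> _)"
  proof (rule sympI)
    fix f g :: "real^'n \<Rightarrow> real"
    assume "eq_mod_affine f g"
    then obtain a b where *: "f absolutely_integrable_on unit_cube" "g absolutely_integrable_on unit_cube"
      "AE x in lebesgue. x \<in> unit_cube \<longrightarrow> f x - g x = a \<bullet> x + b"
      by (rule eq_mod_affineE)
    show "eq_mod_affine g f"
    proof (rule eq_mod_affineI[where a = "-a" and b = "-b"])
      show "AE x in lebesgue. x \<in> unit_cube \<longrightarrow> g x - f x = (-a) \<bullet> x + (-b)"
        using *(3) by (rule AE_mp) (auto intro!: AE_I2)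
    qed (use * in auto)
  qed
  show "transp (eq_mod_affine :: (real^'n \<Rightarrow> real) \<Rightarrow> _)"
  proof (rule transpI)
    fix f g h :: "real^'n \<Rightarrow> real"
    assume fg: "eq_mod_affine f g" and gh: "eq_mod_affine g h"
    from fg obtain a b where 1: "f absolutely_integrable_on unit_cube"
      "AE x in lebesgue. x \<in> unit_cube \<longrightarrow> f x - g x = a \<bullet> x + b"
      by (rule eq_mod_affineE)
    from gh obtain a' b' where 2: "h absolutely_integrable_on unit_cube"
      "AE x in lebesgue. x \<in> unit_cube \<longrightarrow> g x - h x = a' \<bullet> x + b'"
      by (rule eq_mod_affineE)
    from 1 2 have AE: "AE x in lebesgue. (x \<in> unit_cube \<longrightarrow> f x - g x = a \<bullet> x + b) \<and>
        (x \<in> unit_cube \<longrightarrow> g x - h x = a' \<bullet> x + b')"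
      by (intro AE_conjI)
    show "eq_mod_affine f h"
    proof (rule eq_mod_affineI[where a = "a + a'" and b = "b + b'"])
      show "AE x in lebesgue. x \<in> unit_cube \<longrightarrow> f x - h x = (a + a') \<bullet> x + (b + b')"
        using AE by (rule AE_mp) (auto simp: inner_add_left intro!: AE_I2)
    qed (use 1 2 in auto)
  qed
qed

quotient_type (overloaded) 'n l1_mod_affine = "real^('n::finite) \<Rightarrow> real" / partial: eq_mod_affine
  morphisms rep_l1_mod_affine proj
  by (rule part_equivp_eq_mod_affine)

instantiation l1_mod_affine :: (finite) real_vector
begin

lift_definition zero_l1_mod_affine :: "'a l1_mod_affine" is "\<lambda>_. 0"
  by (rule eq_mod_affine_refl) (rule absolutely_integrable_on_zero)

lift_definition plus_l1_mod_affine :: "'a l1_mod_affine \<Rightarrow> 'a l1_mod_affine \<Rightarrow> 'a l1_mod_affine"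
  is "\<lambda>f g x. f x + g x"
proof -
  fix f f' g g' :: "real^'a \<Rightarrow> real"
  assume ff': "eq_mod_affine f f'" and gg': "eq_mod_affine g g'"
  from ff' obtain a b where 1:
    "f absolutely_integrable_on unit_cube" "f' absolutely_integrable_on unit_cube"
    "AE x in lebesgue. x \<in> unit_cube \<longrightarrow> f x - f' x = a \<bullet> x + b"
    by (rule eq_mod_affineE)
  from gg' obtain a' b' where 2:
    "g absolutely_integrable_on unit_cube" "g' absolutely_integrable_on unit_cube"
    "AE x in lebesgue. x \<in> unit_cube \<longrightarrow> g x - g' x = a' \<bullet> x + b'"
    by (rule eq_mod_affineE)
  from 1 2 have AE: "AE x in lebesgue. (x \<in> unit_cube \<longrightarrow> f x - f' x = a \<bullet> x + b) \<and>
      (x \<in> unit_cube \<longrightarrow> g x - g' x = a' \<bullet> x + b')"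
    by (intro AE_conjI)
  show "eq_mod_affine (\<lambda>x. f x + g x) (\<lambda>x. f' x + g' x)"
  proof (rule eq_mod_affineI[where a = "a + a'" and b = "b + b'"])
    show "AE x in lebesgue. x \<in> unit_cube \<longrightarrow>
        (f x + g x) - (f' x + g' x) = (a + a') \<bullet> x + (b + b')"
      using AE by (rule AE_mp) (auto simp: inner_add_left intro!: AE_I2)
  qed (use 1 2 in \<open>auto intro: absolutely_integrable_on_plus\<close>)
qed

lift_definition scaleR_l1_mod_affine :: "real \<Rightarrow> 'a l1_mod_affine \<Rightarrow> 'a l1_mod_affine"
  is "\<lambda>c f x. c * f x"
proof -
  fix c and f f' :: "real^'a \<Rightarrow> real"
  assume "eq_mod_affine f f'"
  then obtain a b where *:
    "f absolutely_integrable_on unit_cube" "f' absolutely_integrable_on unit_cube"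
    "AE x in lebesgue. x \<in> unit_cube \<longrightarrow> f x - f' x = a \<bullet> x + b"
    by (rule eq_mod_affineE)
  show "eq_mod_affine (\<lambda>x. c * f x) (\<lambda>x. c * f' x)"
  proof (rule eq_mod_affineI[where a = "c *\<^sub>R a" and b = "c * b"])
    show "AE x in lebesgue. x \<in> unit_cube \<longrightarrow> c * f x - c * f' x = (c *\<^sub>R a) \<bullet> x + c * b"
      using *(3)
      by (rule AE_mp) (auto intro!: AE_I2 simp: right_diff_distrib[symmetric] distrib_left[symmetric])
  qed (use * in \<open>auto intro: absolutely_integrable_on_cmult\<close>)
qed

definition uminus_l1_mod_affine :: "'a l1_mod_affine \<Rightarrow> 'a l1_mod_affine" where
  "uminus_l1_mod_affine g = (-1) *\<^sub>R g"

definition minus_l1_mod_affine :: "'a l1_mod_affine \<Rightarrow> 'a l1_mod_affine \<Rightarrow> 'a l1_mod_affine" where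
  "minus_l1_mod_affine g h = g + (-h)"

instance
proof
  fix f g h :: "'a l1_mod_affine" and c d :: real
  have eqI: "eq_mod_affine p q" if "p absolutely_integrable_on unit_cube" "p = q"
    for p q :: "real^'a \<Rightarrow> real"
    using that eq_mod_affine_refl by blast
  note [intro] = absolutely_integrable_on_plus absolutely_integrable_on_cmult
  have int: "p absolutely_integrable_on unit_cube" if "eq_mod_affine p p" for p :: "real^'a \<Rightarrow> real"
    using that by (rule eq_mod_affineE)
  show "f + g + h = f + (g + h)"
    by transfer (rule eqI, auto dest!: int simp: add.assoc)
  show "f + g = g + f"
    by transfer (rule eqI, auto dest!: int simp: add.commute)
  show "0 + f = f"
    by transfer (rule eqI, auto dest!: int)
  show "- f + f = 0"
    unfolding uminus_l1_mod_affine_def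
    by transfer (rule eqI, auto dest!: int)
  show "f - g = f + - g"
    by (rule minus_l1_mod_affine_def)
  show "c *\<^sub>R (f + g) = c *\<^sub>R f + c *\<^sub>R g"
    by transfer (rule eqI, auto dest!: int simp: distrib_left)
  show "(c + d) *\<^sub>R f = c *\<^sub>R f + d *\<^sub>R f"
    by transfer (rule eqI, auto dest!: int simp: distrib_right)
  show "c *\<^sub>R d *\<^sub>R f = (c * d) *\<^sub>R f"
    by transfer (rule eqI, auto dest!: int simp: mult.assoc)
  show "1 *\<^sub>R f = f"
    by transfer (rule eqI, auto dest!: int)
qed

end

section \<open>Affine functions have no Hessian\<close>

lemma Ck_imp_continuous: "Ck k f \<Longrightarrow> continuous_on UNIV f"
  by (cases k) (auto simp: continuous_on_eq_continuous_at intro: differentiable_imp_continuous_within)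

lemma partial_deriv_eqI:
  "(f has_derivative f') (at x) \<Longrightarrow> partial_deriv i f x = f' (axis i 1)"
  unfolding partial_deriv_def by (metis frechet_derivative_at)

lemma partial_deriv_zero_outside:
  assumes "closed K" "\<And>x. x \<notin> K \<Longrightarrow> f x = 0" "x \<notin> K"
  shows "partial_deriv i f x = 0"
proof -
  have "(f has_derivative (\<lambda>_. 0)) (at x)"
    by (rule has_derivative_transform_within_open[of "\<lambda>_. 0" _ _ _ "-K"]) (use assms in auto)
  then show ?thesis
    by (rule partial_deriv_eqI)
qed

lemma has_derivative_along_axis:
  fixes f :: "real^'n::finite \<Rightarrow> real"
  assumes "f differentiable (at (x + t *\<^sub>R axis i 1))"
  shows "((\<lambda>t. f (x + t *\<^sub>R axis i 1)) has_real_derivative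
           partial_deriv i f (x + t *\<^sub>R axis i 1)) (at t)"
proof -
  let ?f' = "frechet_derivative f (at (x + t *\<^sub>R axis i 1))"
  have "(f has_derivative ?f') (at (x + t *\<^sub>R axis i 1))"
    using assms by (simp add: frechet_derivative_works)
  then have "((\<lambda>t. f (x + t *\<^sub>R axis i 1)) has_derivative (\<lambda>s. ?f' (s *\<^sub>R axis i 1))) (at t)"
    by (rule has_derivative_compose[rotated]) (auto intro!: derivative_eq_intros)
  moreover have "?f' (s *\<^sub>R axis i 1) = s * partial_deriv i f (x + t *\<^sub>R axis i 1)" for s
    using linear_frechet_derivative[OF assms] by (simp add: partial_deriv_def linear_cmul)
  ultimately show ?thesis
    by (simp add: has_field_derivative_def mult_commute_abs)
qed

lemma integrable_compact_support:
  fixes f :: "real^'n::finite \<Rightarrow> real"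
  assumes "continuous_on UNIV f" "compact K" "\<And>x. x \<notin> K \<Longrightarrow> f x = 0"
  shows "integrable lborel f"
proof -
  have "integrable lborel (\<lambda>x. indicator K x *\<^sub>R f x)"
    using assms(1,2) continuous_on_subset by (intro borel_integrable_compact) blast+
  moreover have "(\<lambda>x. indicator K x *\<^sub>R f x) = f"
    using assms(3) by (force simp: indicator_def fun_eq_iff)
  ultimately show ?thesis by simp
qed

lemma bounded_compact_support:
  fixes f :: "real^'n::finite \<Rightarrow> real"
  assumes "continuous_on UNIV f" "compact K" "\<And>x. x \<notin> K \<Longrightarrow> f x = 0"
  obtains B where "B \<ge> 0" "\<And>x. \<bar>f x\<bar> \<le> B"
proof -
  have "compact (f ` K)"
    using assms continuous_on_subset by (intro compact_continuous_image) blast+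
  then obtain B where B: "\<And>y. y \<in> f ` K \<Longrightarrow> norm y \<le> B"
    using compact_imp_bounded bounded_iff by metis
  have "\<bar>f x\<bar> \<le> max 0 B" for x
    using B[of "f x"] assms(3)[of x] by (cases "x \<in> K") auto
  then show ?thesis using that[of "max 0 B"] by auto
qed

lemma integral_partial_deriv_eq_0:
  fixes f :: "real^'n::finite \<Rightarrow> real"
  assumes C1: "Ck 1 f" and K: "compact K" "\<And>x. x \<notin> K \<Longrightarrow> f x = 0"
  shows "(LINT x|lborel. partial_deriv i f x) = 0"
proof -
  let ?e = "axis i 1 :: real^'n"
  define s where "s k = 1 / real (Suc k)" for k
  define q where "q k x = (f (x + s k *\<^sub>R ?e) - f x) / s k" for k x
  have s: "0 < s k" "s k \<le> 1" for k
    by (auto simp: s_def)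
  have diff: "f differentiable (at x)" for x
    using C1 by simp
  have cont: "continuous_on UNIV f"
    using C1 by (rule Ck_imp_continuous)
  have cont': "continuous_on UNIV (partial_deriv i f)"
    using C1 by simp
  have out: "partial_deriv i f x = 0" if "x \<notin> K" for x
    using K that by (intro partial_deriv_zero_outside[of K]) (auto intro: compact_imp_closed)
  obtain B where B: "B \<ge> 0" "\<And>x. \<bar>partial_deriv i f x\<bar> \<le> B"
    using bounded_compact_support[OF cont' K(1) out] by metis
  obtain R where R: "\<And>x. x \<in> K \<Longrightarrow> norm x \<le> R"
    using compact_imp_bounded[OF K(1)] by (auto simp: bounded_iff)
  have bound: "\<bar>q k x\<bar> \<le> B * indicator (cball 0 (R + 1)) x" for k x
  proof (cases "x \<in> cball 0 (R + 1)")
    case True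
    have "\<exists>z. 0 < z \<and> z < s k \<and> f (x + s k *\<^sub>R ?e) - f (x + 0 *\<^sub>R ?e) =
        (s k - 0) * partial_deriv i f (x + z *\<^sub>R ?e)"
      by (rule MVT2) (use s has_derivative_along_axis[OF diff] in auto)
    then obtain z where "f (x + s k *\<^sub>R ?e) - f x = s k * partial_deriv i f (x + z *\<^sub>R ?e)"
      by auto
    then have "q k x = partial_deriv i f (x + z *\<^sub>R ?e)"
      using s(1)[of k] by (simp add: q_def)
    with B(2)[of "x + z *\<^sub>R ?e"] True show ?thesis by simp
  next
    case False
    have "norm (s k *\<^sub>R ?e) \<le> 1"
      using s[of k] by simp
    moreover have "norm x > R + 1"
      using False by simp
    moreover have "norm x - norm (s k *\<^sub>R ?e) \<le> norm (x + s k *\<^sub>R ?e)"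
      by (rule norm_diff_ineq)
    ultimately have "norm (x + s k *\<^sub>R ?e) > R" "norm x > R"
      by linarith+
    then have "x + s k *\<^sub>R ?e \<notin> K" "x \<notin> K"
      using R by fastforce+
    with K(2) False show ?thesis by (simp add: q_def)
  qed
  have lim: "(\<lambda>k. q k x) \<longlonglongrightarrow> partial_deriv i f x" for x
  proof -
    have "((\<lambda>t. f (x + t *\<^sub>R ?e)) has_real_derivative partial_deriv i f x) (at 0)"
      using has_derivative_along_axis[of f x 0 i] diff by simp
    then have "((\<lambda>h. (f (x + h *\<^sub>R ?e) - f x) / h) \<longlongrightarrow> partial_deriv i f x) (at 0)"
      by (simp add: DERIV_def)
    moreover have "filterlim s (at 0) sequentially"
      unfolding s_def using LIMSEQ_inverse_real_of_nat
      by (intro filterlim_atI) (auto simp: inverse_eq_divide)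
    ultimately show ?thesis
      unfolding q_def by (rule filterlim_compose)
  qed
  have meas: "f \<in> borel_measurable borel" "partial_deriv i f \<in> borel_measurable borel"
    using cont cont' by (auto intro: borel_measurable_continuous_onI)
  have "(\<lambda>k. LINT x|lborel. q k x) \<longlonglongrightarrow> (LINT x|lborel. partial_deriv i f x)"
  proof (rule integral_dominated_convergence[where w = "\<lambda>x. B * indicator (cball 0 (R + 1)) x"])
    show "integrable lborel (\<lambda>x::real^'n. B * indicator (cball 0 (R + 1)) x)"
      by (intro integrable_mult_right integrable_real_indicator)
        (use emeasure_bounded_finite[OF bounded_cball] in auto)
    show "q k \<in> borel_measurable lborel" for k
      unfolding q_def using meas by measurable
  qed (use meas lim bound in auto)
  moreover have "(LINT x|lborel. q k x) = 0" for k
  proof -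
    have int: "integrable lborel f"
      using cont K by (rule integrable_compact_support)
    have int': "integrable lborel (\<lambda>x. f (s k *\<^sub>R ?e + x))"
    proof (rule integrable_compact_support)
      show "continuous_on UNIV (\<lambda>x. f (s k *\<^sub>R ?e + x))"
        using continuous_on_compose2[OF cont, of UNIV "\<lambda>x. s k *\<^sub>R ?e + x"]
        by (simp add: continuous_on_add continuous_on_const continuous_on_id)
      show "compact ((+) (- (s k *\<^sub>R ?e)) ` K)"
        using K(1) by (rule compact_translation)
      show "f (s k *\<^sub>R ?e + x) = 0" if "x \<notin> (+) (- (s k *\<^sub>R ?e)) ` K" for x
        using that by (intro K(2)) (auto simp: image_iff algebra_simps)
    qed
    have "(LINT x|lborel. f x) = (LINT x|distr lborel borel ((+) (s k *\<^sub>R ?e)). f x)"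
      by (simp add: lborel_distr_plus)
    also have "\<dots> = (LINT x|lborel. f (s k *\<^sub>R ?e + x))"
      using meas(1) by (subst integral_distr) auto
    finally show ?thesis
      using int int' by (simp add: q_def add.commute)
  qed
  ultimately have "(\<lambda>k. 0) \<longlonglongrightarrow> (LINT x|lborel. partial_deriv i f x)"
    by simp
  then show ?thesis
    by (simp add: LIMSEQ_const_iff)
qed

lemma Ck_Suc_imp: "Ck (Suc k) f \<Longrightarrow> Ck k f"
proof (induction k arbitrary: f)
  case 0
  then show ?case using Ck_imp_continuous by fastforce
qed auto

lemma integral_affine_second_deriv_eq_0:
  fixes f :: "real^'n::finite \<Rightarrow> real"
  assumes f: "Ck 2 f" and K: "compact K" "\<And>x. x \<notin> K \<Longrightarrow> f x = 0"
  shows "(LINT x|lborel. (a \<bullet> x + b) * partial_deriv i (partial_deriv j f) x) = 0"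
proof -
  define g where "g = partial_deriv j f"
  have f1: "Ck 1 f" and g1: "Ck 1 g"
    using f Ck_Suc_imp[of 1 f] by (simp_all add: g_def numeral_2_eq_2 del: Ck.simps(2))
      (simp_all add: numeral_2_eq_2)
  have g0: "g x = 0" if "x \<notin> K" for x
    unfolding g_def using K that
    by (intro partial_deriv_zero_outside[of K]) (auto intro: compact_imp_closed)
  have gi0: "partial_deriv i g x = 0" if "x \<notin> K" for i x
    using K g0 that by (intro partial_deriv_zero_outside[of K]) (auto intro: compact_imp_closed)
  define h where "h x = (a \<bullet> x + b) * g x" for x
  have gd: "(g has_derivative frechet_derivative g (at x)) (at x)" for x
    using g1 by (simp add: frechet_derivative_works)
  have hd: "(h has_derivative
      (\<lambda>v. (a \<bullet> x + b) * frechet_derivative g (at x) v + (a \<bullet> v) * g x)) (at x)" for x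
    unfolding h_def by (auto intro!: derivative_eq_intros gd)
  have h': "partial_deriv i h x = (a \<bullet> x + b) * partial_deriv i g x + a $ i * g x" for i x
    using partial_deriv_eqI[OF hd, of i x] by (simp add: partial_deriv_def inner_axis)
  have gcont: "continuous_on UNIV g" "continuous_on UNIV (partial_deriv i g)" for i
    using Ck_imp_continuous[OF g1] g1 by auto
  have h1: "Ck 1 h"
    using hd gcont by (auto simp: differentiable_def h'[abs_def] intro!: continuous_intros)
  have "(LINT x|lborel. partial_deriv i h x) = 0"
    using h1 K(1) by (rule integral_partial_deriv_eq_0) (simp add: h_def g0)
  moreover have "(LINT x|lborel. g x) = 0"
    unfolding g_def using f1 K by (rule integral_partial_deriv_eq_0)
  moreover have "integrable lborel g"
    using gcont(1) K(1) g0 by (rule integrable_compact_support)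
  moreover have "integrable lborel (\<lambda>x. (a \<bullet> x + b) * partial_deriv i g x)"
    by (rule integrable_compact_support[OF _ K(1)])
      (use gcont gi0 in \<open>auto intro!: continuous_intros\<close>)
  ultimately show ?thesis
    by (simp add: h' g_def)
qed

lemma test_integral_cong_mod_affine:
  fixes f g :: "real^'n::finite \<Rightarrow> real"
  assumes "eq_mod_affine f g" "A \<subseteq> unit_cube" and F: "F \<in> test_fields A"
  shows "(LINT x:A|lebesgue. \<Sum>i\<in>UNIV. \<Sum>j\<in>UNIV.
        f x * partial_deriv i (partial_deriv j (\<lambda>y. F y $ i $ j)) x) =
      (LINT x:A|lebesgue. \<Sum>i\<in>UNIV. \<Sum>j\<in>UNIV.
        g x * partial_deriv i (partial_deriv j (\<lambda>y. F y $ i $ j)) x)"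
proof -
  obtain a b where fg: "f absolutely_integrable_on unit_cube" "g absolutely_integrable_on unit_cube"
    and AE: "AE x in lebesgue. x \<in> unit_cube \<longrightarrow> f x - g x = a \<bullet> x + b"
    using assms(1) by (rule eq_mod_affineE)
  define K where "K = closure {x. F x \<noteq> 0}"
  have K: "compact K" "K \<subseteq> A"
    using F by (auto simp: test_fields_def K_def)
  have F0: "F x $ i $ j = 0" if "x \<notin> K" for x i j
  proof -
    have "F x = 0"
      using that closure_subset[of "{x. F x \<noteq> 0}"] unfolding K_def by blast
    then show ?thesis by simp
  qed
  have C2: "Ck 2 (\<lambda>x. F x $ i $ j)" for i j
    using F by (auto simp: test_fields_def smooth_def)
  define d where "d i j = partial_deriv i (partial_deriv j (\<lambda>y. F y $ i $ j))" for i j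
  define D where "D x = (\<Sum>i\<in>UNIV. \<Sum>j\<in>UNIV. d i j x)" for x
  have d0: "d i j x = 0" if "x \<notin> K" for i j x
    unfolding d_def using compact_imp_closed[OF K(1)] F0 that
    by (intro partial_deriv_zero_outside[of K]) auto
  have dcont: "continuous_on UNIV (d i j)" for i j
    using C2[of i j] by (simp add: d_def numeral_2_eq_2)
  have D0: "D x = 0" if "x \<notin> K" for x
    using that by (simp add: D_def d0)
  have Dcont: "continuous_on UNIV D"
    unfolding D_def by (intro continuous_intros dcont)
  obtain B where B: "B \<ge> 0" "\<And>x. \<bar>D x\<bar> \<le> B"
    using bounded_compact_support[OF Dcont K(1) D0] by metis
  have Dmeas: "D \<in> borel_measurable lebesgue"
    using borel_measurable_continuous_onI[OF Dcont] by (simp add: measurable_completion)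
  have eq: "(LINT x:A|lebesgue. \<Sum>i\<in>UNIV. \<Sum>j\<in>UNIV. p x * d i j x) =
      (LINT x|lebesgue. (indicator unit_cube x *\<^sub>R p x) * D x)" for p :: "real^'n \<Rightarrow> real"
    unfolding set_lebesgue_integral_def
  proof (rule Bochner_Integration.integral_cong)
    fix x
    show "indicator A x *\<^sub>R (\<Sum>i\<in>UNIV. \<Sum>j\<in>UNIV. p x * d i j x) =
        (indicator unit_cube x *\<^sub>R p x) * D x"
    proof (cases "x \<in> K")
      case True
      with K(2) assms(2) have "x \<in> A" "x \<in> unit_cube" by auto
      then show ?thesis by (simp add: D_def sum_distrib_left)
    next
      case False
      then show ?thesis by (simp add: D_def d0)
    qed
  qed simp
  have int: "integrable lebesgue (\<lambda>x. (indicator unit_cube x *\<^sub>R p x) * D x)"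
    if p: "p absolutely_integrable_on unit_cube" for p :: "real^'n \<Rightarrow> real"
  proof (rule Bochner_Integration.integrable_bound)
    show "integrable lebesgue (\<lambda>x. B * (indicator unit_cube x *\<^sub>R p x))"
      using p unfolding set_integrable_def by (rule integrable_mult_right)
    show "(\<lambda>x. (indicator unit_cube x *\<^sub>R p x) * D x) \<in> borel_measurable lebesgue"
      using p Dmeas unfolding set_integrable_def by (intro borel_measurable_times) auto
    show "AE x in lebesgue. norm (indicator unit_cube x *\<^sub>R p x * D x)
        \<le> norm (B * (indicator unit_cube x *\<^sub>R p x))"
    proof (rule AE_I2)
      fix x
      have "\<bar>indicator unit_cube x * p x\<bar> * \<bar>D x\<bar> \<le> \<bar>indicator unit_cube x * p x\<bar> * \<bar>B\<bar>"
        using B(1) B(2)[of x] by (intro mult_left_mono) auto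
      then show "norm (indicator unit_cube x *\<^sub>R p x * D x)
          \<le> norm (B * (indicator unit_cube x *\<^sub>R p x))"
        by (simp only: real_norm_def real_scaleR_def abs_mult[of _ "D x"] abs_mult[of B] mult.commute[of "\<bar>B\<bar>"])
    qed
  qed
  have "(LINT x|lebesgue. (indicator unit_cube x *\<^sub>R f x) * D x)
      - (LINT x|lebesgue. (indicator unit_cube x *\<^sub>R g x) * D x)
      = (LINT x|lebesgue. (indicator unit_cube x *\<^sub>R f x) * D x - (indicator unit_cube x *\<^sub>R g x) * D x)"
    by (rule Bochner_Integration.integral_diff[symmetric]) (use int fg in auto)
  also have "\<dots> = (LINT x|lebesgue. (a \<bullet> x + b) * D x)"
  proof (rule integral_cong_AE)
    show "(\<lambda>x. (indicator unit_cube x *\<^sub>R f x) * D x - (indicator unit_cube x *\<^sub>R g x) * D x)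
        \<in> borel_measurable lebesgue"
      by (intro borel_measurable_diff borel_measurable_integrable int fg)
    show "(\<lambda>x. (a \<bullet> x + b) * D x) \<in> borel_measurable lebesgue"
      by (intro measurable_completion) (auto intro!: borel_measurable_continuous_onI continuous_intros Dcont)
    show "AE x in lebesgue. (indicator unit_cube x *\<^sub>R f x) * D x
        - (indicator unit_cube x *\<^sub>R g x) * D x = (a \<bullet> x + b) * D x"
      using AE
    proof (rule AE_mp, intro AE_I2 impI)
      fix x
      assume *: "x \<in> unit_cube \<longrightarrow> f x - g x = a \<bullet> x + b"
      show "(indicator unit_cube x *\<^sub>R f x) * D x - (indicator unit_cube x *\<^sub>R g x) * D x
          = (a \<bullet> x + b) * D x"
      proof (cases "x \<in> unit_cube")
        case True
        with * have "f x - g x = a \<bullet> x + b" by blast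
        then have "f x * D x - g x * D x = (a \<bullet> x + b) * D x"
          by (metis left_diff_distrib)
        with True show ?thesis by simp
      next
        case False
        with K(2) assms(2) have "x \<notin> K" by blast
        then have "D x = 0" by (rule D0)
        then show ?thesis by simp
      qed
    qed
  qed
  also have "\<dots> = (LINT x|lborel. (a \<bullet> x + b) * D x)"
    by (rule integral_completion)
      (auto intro!: borel_measurable_continuous_onI continuous_intros Dcont)
  also have "\<dots> = (LINT x|lborel. (\<Sum>i\<in>UNIV. \<Sum>j\<in>UNIV. (a \<bullet> x + b) * d i j x))"
    by (simp add: D_def sum_distrib_left)
  also have "\<dots> = (\<Sum>i\<in>UNIV. \<Sum>j\<in>UNIV. (LINT x|lborel. (a \<bullet> x + b) * d i j x))"
  proof -
    have "integrable lborel (\<lambda>x. (a \<bullet> x + b) * d i j x)" for i j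
      by (rule integrable_compact_support[OF _ K(1)])
        (use dcont d0 in \<open>auto intro!: continuous_intros\<close>)
    then show ?thesis
      by (subst Bochner_Integration.integral_sum)
        (auto intro!: Bochner_Integration.integrable_sum sum.cong Bochner_Integration.integral_sum)
  qed
  also have "\<dots> = 0"
    unfolding d_def
    by (intro sum.neutral ballI integral_affine_second_deriv_eq_0[OF C2 K(1) F0])
  finally have "(LINT x|lebesgue. (indicator unit_cube x *\<^sub>R f x) * D x) =
      (LINT x|lebesgue. (indicator unit_cube x *\<^sub>R g x) * D x)"
    by (rule eq_iff_diff_eq_0[THEN iffD2])
  then have "(LINT x:A|lebesgue. \<Sum>i\<in>UNIV. \<Sum>j\<in>UNIV. f x * d i j x) =
      (LINT x:A|lebesgue. \<Sum>i\<in>UNIV. \<Sum>j\<in>UNIV. g x * d i j x)"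
    by (rule eq[THEN trans, OF trans, OF _ eq[symmetric]])
  then show ?thesis
    unfolding d_def .
qed

lemma hessian_variation_cong_mod_affine:
  assumes "eq_mod_affine f g" "A \<subseteq> unit_cube"
  shows "hessian_variation f A = hessian_variation g A"
  unfolding hessian_variation_def using test_integral_cong_mod_affine[OF assms]
  by (intro SUP_cong) (simp_all only:)

section \<open>Unit ball, unit sphere and extreme points\<close>

text \<open>\<open>|D\<^sup>2 g|\<close> lives on the cube, and representatives of a class are arbitrary outside it;
  hence the intersection.\<close>

lift_definition hessian_var :: "'n::finite l1_mod_affine \<Rightarrow> (real^'n) set \<Rightarrow> ereal"
  is "\<lambda>f A. hessian_variation f (A \<inter> unit_cube)"
  by (intro ext hessian_variation_cong_mod_affine) auto

lemma hessian_var_proj: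
  assumes "f absolutely_integrable_on unit_cube"
  shows "hessian_var (proj f) A = hessian_variation f (A \<inter> unit_cube)"
  using hessian_var.abs_eq[OF eq_mod_affine_refl[OF assms]] by simp

text \<open>The support of the Borel measure extending the set function above. The support of a measure
  is determined by its values on open sets, so the extension need not be constructed.\<close>

definition hessian_support :: "'n::finite l1_mod_affine \<Rightarrow> (real^'n) set" where
  "hessian_support g =
     {x\<in>unit_cube. \<forall>U. open U \<and> U \<subseteq> unit_cube \<and> x \<in> U \<longrightarrow> hessian_var g U > 0}"

definition hessian_ball :: "'n::finite l1_mod_affine set" where
  "hessian_ball = {g. hessian_var g unit_cube \<le> 1}"

definition hessian_sphere :: "'n::finite l1_mod_affine set" where
  "hessian_sphere = {g. hessian_var g unit_cube = 1}"

text \<open>Functions in \<open>cpwl unit_cube\<close> are bounded on the cube; the intersection only makes explicit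
  that \<open>proj\<close> is applied to integrable functions.\<close>

definition cpwl_classes :: "'n::finite l1_mod_affine set" where
  "cpwl_classes = proj ` (cpwl unit_cube \<inter> {f. f absolutely_integrable_on unit_cube})"

definition cpwl_extreme_points :: "'n::finite l1_mod_affine set" where
  "cpwl_extreme_points = cpwl_classes \<inter> {g. g extreme_point_of hessian_ball}"

end

theory Submission
  imports Defs "HOL-Computational_Algebra.Polynomial"
begin

text \<open>If \<open>g\<close> is a proper convex combination of \<open>h\<^sub>1\<close> and \<open>h\<^sub>2\<close> in the ball, then the supports of their
  Hessians lie in that of \<open>g\<close>; so if only multiples of \<open>g\<close> have this property, \<open>g\<close> is extreme.
  Conversely, let \<open>g\<close> be extreme and piecewise linear, and let the Hessian of \<open>h\<close> be supported in that
  of \<open>g\<close>. Then \<open>h\<close> is affine on the cells of the hyperplane arrangement generated by the facets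
  of \<open>g\<close>, and it does not jump across facets because its Hessian is a measure. Near a facet point
  the Hessian of \<open>h\<close> is therefore a multiple of that of \<open>g\<close>, with factors from a finite set, and
  \<open>|D\<^sup>2(g + \<eta> h)| + |D\<^sup>2(g - \<eta> h)| \<le> 2\<close> for small \<open>\<eta> > 0\<close>. After normalisation this writes \<open>g\<close> as a
  convex combination of multiples of \<open>g \<plusminus> \<eta> h\<close>, whence \<open>h\<close> is a multiple of \<open>g\<close>.

  The last inequality is proved for mollifications: the mollified Hessian is of size \<open>1/d\<close> on
  the \<open>d\<close>-neighbourhood of the codimension-two skeleton, which has volume \<open>o(d)\<close>, and off this
  set the factor is unique, so no surface measures are needed.\<close>

section \<open>Smooth functions\<close>

text \<open>Proportionality comes from rank one. Across a hyperplane with unit normal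
  \<open>a\<close>, a continuous piecewise affine function changes its gradient only by a multiple
  of \<open>a\<close>, so near a facet the Hessians of \<open>g\<close> and \<open>h\<close> are
  multiples of one matrix, \<open>a a^T\<close>. A jump of \<open>h\<close> would add other terms;
  this is where finite variation of \<open>h\<close> enters. The factor may vary along a hyperplane,
  because the others cut it into facets, but it is determined by a hyperplane and a sign pattern;
  hence one \<eta> serves everywhere.

  The two variations in the inequality are suprema over independent fields \<open>F\<close> and
  \<open>F'\<close>. Where the mollified Hessian of \<open>h\<close> is \<open>l\<close> times that
  of \<open>g\<close>, the sum tests \<open>g\<close> with
  \<open>(1 + \<eta> l) F + (1 - \<eta> l) F'\<close>, and for \<open>\<eta> |l| \<le> 1\<close> the
  weights are nonnegative with sum 2. As \<open>g\<close> is the midpoint of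
  \<open>g \<plusminus> \<eta> h\<close>, the reverse inequality is automatic, so the normalised
  weights fit exactly.

  Functions are taken Borel and integrable on the whole space: fields supported in the cube see
  nothing outside it, and convolutions are defined everywhere.\<close>

lemma partial_deriv_const [simp]: "partial_deriv i (\<lambda>_. c) = (\<lambda>_. 0)"
  by (rule ext, rule partial_deriv_eqI) auto

lemma partial_deriv_coord: "partial_deriv i (\<lambda>x::real^'n::finite. x $ j) = (\<lambda>_. if i = j then 1 else 0)"
proof
  fix x :: "real^'n"
  have "((\<lambda>x::real^'n. x $ j) has_derivative (\<lambda>x. x $ j)) (at x)"
    by (rule bounded_linear_imp_has_derivative) (rule bounded_linear_vec_nth)
  from partial_deriv_eqI[OF this, of i]
  show "partial_deriv i (\<lambda>x. x $ j) x = (if i = j then 1 else 0)"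
    by (simp add: axis_def)
qed

lemma frechet_has_derivative:
  "f differentiable (at x) \<Longrightarrow> (f has_derivative frechet_derivative f (at x)) (at x)"
  by (simp add: frechet_derivative_works)

lemma frechet_derivative_eq_sum:
  fixes f :: "real^'n::finite \<Rightarrow> real"
  assumes "f differentiable (at x)"
  shows "frechet_derivative f (at x) v = (\<Sum>i\<in>UNIV. v $ i * partial_deriv i f x)"
proof -
  have lin: "linear (frechet_derivative f (at x))"
    by (rule linear_frechet_derivative[OF assms])
  have "frechet_derivative f (at x) v = frechet_derivative f (at x) (\<Sum>i\<in>UNIV. v $ i *\<^sub>R axis i 1)"
    by (subst basis_expansion[symmetric, of v]) (simp add: scalar_mult_eq_scaleR)
  also have "\<dots> = (\<Sum>i\<in>UNIV. v $ i * partial_deriv i f x)"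
    by (simp add: linear_sum[OF lin] linear_cmul[OF lin] partial_deriv_def)
  finally show ?thesis .
qed

lemma has_derivative_partial_deriv:
  fixes f :: "real^'n::finite \<Rightarrow> real"
  assumes "f differentiable (at x)"
  shows "(f has_derivative (\<lambda>v. \<Sum>i\<in>UNIV. v $ i * partial_deriv i f x)) (at x)"
  using frechet_has_derivative[OF assms] frechet_derivative_eq_sum[OF assms]
  by (metis (no_types, lifting) ext)

lemma partial_deriv_add:
  assumes "f differentiable (at x)" "g differentiable (at x)"
  shows "partial_deriv i (\<lambda>x. f x + g x) x = partial_deriv i f x + partial_deriv i g x"
  by (rule partial_deriv_eqI[OF has_derivative_add[OF assms[THEN frechet_has_derivative]], of i,
        folded partial_deriv_def])

lemma partial_deriv_mult:
  assumes "f differentiable (at x)" "g differentiable (at x)"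
  shows "partial_deriv i (\<lambda>x. f x * g x) x = f x * partial_deriv i g x + partial_deriv i f x * g x"
  by (rule partial_deriv_eqI[OF has_derivative_mult[OF assms[THEN frechet_has_derivative]], of i,
        folded partial_deriv_def])

lemma partial_deriv_affine_comp:
  fixes f :: "real^'n::finite \<Rightarrow> real"
  assumes "f differentiable (at (c *\<^sub>R x + v))"
  shows "partial_deriv i (\<lambda>x. f (c *\<^sub>R x + v)) x = c * partial_deriv i f (c *\<^sub>R x + v)"
proof -
  have "((\<lambda>x. c *\<^sub>R x + v) has_derivative (\<lambda>h. c *\<^sub>R h)) (at x)"
    by (auto intro!: derivative_eq_intros)
  from has_derivative_compose[OF this frechet_has_derivative[OF assms]]
  have "partial_deriv i (\<lambda>x. f (c *\<^sub>R x + v)) x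
      = frechet_derivative f (at (c *\<^sub>R x + v)) (c *\<^sub>R axis i 1)"
    by (rule partial_deriv_eqI)
  also have "\<dots> = c * partial_deriv i f (c *\<^sub>R x + v)"
    using linear_frechet_derivative[OF assms] by (simp add: partial_deriv_def linear_cmul)
  finally show ?thesis .
qed

lemma differentiable_affine_comp:
  fixes f :: "real^'n::finite \<Rightarrow> real"
  assumes "f differentiable (at (c *\<^sub>R x + v))"
  shows "(\<lambda>x. f (c *\<^sub>R x + v)) differentiable (at x)"
proof -
  have "((\<lambda>x. c *\<^sub>R x + v) has_derivative (\<lambda>h. c *\<^sub>R h)) (at x)"
    by (auto intro!: derivative_eq_intros)
  from has_derivative_compose[OF this frechet_has_derivative[OF assms]] show ?thesis
    by (rule differentiableI)
qed

lemma Ck_const: "Ck k (\<lambda>_. c)"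
  by (induction k arbitrary: c) auto

lemma Ck_coord: "Ck k (\<lambda>x::real^'n::finite. x $ j)"
proof (cases k)
  case (Suc m)
  have "(\<lambda>x. x $ j) differentiable (at x)" for x :: "real^'n"
    by (rule differentiableI, rule bounded_linear_imp_has_derivative, rule bounded_linear_vec_nth)
  then show ?thesis
    by (simp add: Suc partial_deriv_coord Ck_const)
qed (auto intro!: continuous_intros)

lemma Ck_add: "Ck k f \<Longrightarrow> Ck k g \<Longrightarrow> Ck k (\<lambda>x. f x + g x)"
proof (induction k arbitrary: f g)
  case (Suc k)
  then have "partial_deriv i (\<lambda>x. f x + g x) = (\<lambda>x. partial_deriv i f x + partial_deriv i g x)" for i
    by (auto simp: partial_deriv_add)
  with Suc show ?case by auto
qed (auto intro!: continuous_intros)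

lemma Ck_mult: "Ck k f \<Longrightarrow> Ck k g \<Longrightarrow> Ck k (\<lambda>x. f x * g x)"
proof (induction k arbitrary: f g)
  case (Suc k)
  then have "partial_deriv i (\<lambda>x. f x * g x)
      = (\<lambda>x. f x * partial_deriv i g x + partial_deriv i f x * g x)" for i
    by (auto simp: partial_deriv_mult)
  with Suc Suc.prems[THEN Ck_Suc_imp] show ?case by (auto intro!: Ck_add)
qed (auto intro!: continuous_intros)

lemma Ck_affine_comp: "Ck k f \<Longrightarrow> Ck k (\<lambda>x. f (c *\<^sub>R x + v))"
proof (induction k arbitrary: f)
  case 0
  then show ?case
    by (auto intro!: continuous_on_compose2[of UNIV f] continuous_intros)
next
  case (Suc k)
  then have "partial_deriv i (\<lambda>x. f (c *\<^sub>R x + v)) = (\<lambda>x. c * partial_deriv i f (c *\<^sub>R x + v))" for i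
    by (intro ext partial_deriv_affine_comp) auto
  with Suc show ?case
    by (auto intro!: Ck_mult Ck_const differentiable_affine_comp)
qed

lemma smooth_const: "smooth (\<lambda>_. c)"
  by (simp add: smooth_def Ck_const)

lemma smooth_coord: "smooth (\<lambda>x. x $ j)"
  by (simp add: smooth_def Ck_coord)

lemma smooth_add: "smooth f \<Longrightarrow> smooth g \<Longrightarrow> smooth (\<lambda>x. f x + g x)"
  by (simp add: smooth_def Ck_add)

lemma smooth_mult: "smooth f \<Longrightarrow> smooth g \<Longrightarrow> smooth (\<lambda>x. f x * g x)"
  by (simp add: smooth_def Ck_mult)

lemma smooth_cmult: "smooth f \<Longrightarrow> smooth (\<lambda>x. c * f x)"
  by (intro smooth_mult smooth_const)

lemma smooth_diff: "smooth f \<Longrightarrow> smooth g \<Longrightarrow> smooth (\<lambda>x. f x - g x)"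
  using smooth_add[of f "\<lambda>x. (-1) * g x"] smooth_cmult[of g "-1"] by simp

lemma smooth_sum: "(\<And>i. i \<in> I \<Longrightarrow> smooth (f i)) \<Longrightarrow> smooth (\<lambda>x. \<Sum>i\<in>I. f i x)"
  by (induction I rule: infinite_finite_induct) (auto simp: smooth_const smooth_add)

lemma smooth_affine_comp: "smooth f \<Longrightarrow> smooth (\<lambda>x. f (c *\<^sub>R x + v))"
  by (simp add: smooth_def Ck_affine_comp)

lemma smooth_translate: "smooth f \<Longrightarrow> smooth (\<lambda>x. f (x + v))"
  using smooth_affine_comp[of f 1 v] by simp

lemma smooth_differentiable: "smooth f \<Longrightarrow> f differentiable (at x)"
  using smooth_def[of f] Ck.simps(2)[of 0 f] by blast

lemma smooth_partial_deriv: "smooth f \<Longrightarrow> smooth (partial_deriv i f)"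
  unfolding smooth_def by (metis Ck.simps(2))

lemma smooth_continuous: "smooth f \<Longrightarrow> continuous_on UNIV f"
  unfolding smooth_def by (metis Ck.simps(1))

text \<open>Induction on the order, with the function left arbitrary. It serves for convolutions:
  those of a fixed function with all test functions are closed under partial derivatives.\<close>

lemma smooth_coinduct:
  assumes "X f" "\<And>f. X f \<Longrightarrow> (\<forall>x. f differentiable (at x)) \<and> (\<forall>i. X (partial_deriv i f))"
  shows "smooth f"
proof -
  have "X f \<Longrightarrow> Ck k f" for k f
  proof (induction k arbitrary: f)
    case 0
    then show ?case using assms(2)
      by (auto simp: continuous_on_eq_continuous_at intro: differentiable_imp_continuous_within)
  qed (use assms(2) in auto)
  with assms(1) show ?thesis by (simp add: smooth_def)
qed

section \<open>A smooth bump function\<close>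

text \<open>Products of a polynomial in \<open>1 / t\<close> with \<open>exp (- (1 / t))\<close>,
  cut off at 0, are closed under differentiation; carrying the polynomial along lets one induction
  prove all orders at once.\<close>

definition exp_tail :: "real poly \<Rightarrow> real \<Rightarrow> real" where
  "exp_tail p t = (if t > 0 then poly p (1 / t) * exp (- (1 / t)) else 0)"

text \<open>For \<open>t > 0\<close> the derivative of \<open>p (1 / t) * exp (- (1 / t))\<close> is
  \<open>(p - p') (1 / t) / t^2 * exp (- (1 / t))\<close>; the polynomial \<open>[:0, 0, 1:]\<close>
  is the factor \<open>1 / t^2\<close>.\<close>

definition exp_tail_pderiv :: "real poly \<Rightarrow> real poly" where
  "exp_tail_pderiv p = [:0, 0, 1:] * (p - pderiv p)"

lemma poly_times_exp_minus_tendsto: "((\<lambda>x. poly p x * exp (- x)) \<longlongrightarrow> 0) at_top" for p :: "real poly"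
proof -
  have "((\<lambda>x. \<Sum>i\<le>degree p. coeff p i * (x ^ i / exp x)) \<longlongrightarrow> (\<Sum>i\<le>degree p. coeff p i * 0)) at_top"
    by (intro tendsto_sum tendsto_mult tendsto_const tendsto_power_div_exp_0)
  moreover have "(\<Sum>i\<le>degree p. coeff p i * (x ^ i / exp x)) = poly p x * exp (- x)" for x
    unfolding poly_altdef sum_distrib_right by (intro sum.cong refl) (simp add: exp_minus field_simps)
  ultimately show ?thesis by simp
qed

text \<open>This limit is the derivative at the gluing point 0. With \<open>x = 1 / h\<close> the
  quotient for \<open>h > 0\<close> becomes \<open>x * p x * exp (- x)\<close>, whence the factor
  \<open>[:0, 1:]\<close> in the proof.\<close>

lemma exp_tail_div_tendsto: "((\<lambda>h. exp_tail p h / h) \<longlongrightarrow> 0) (at 0)"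
proof (rule filterlim_split_at_real)
  show "((\<lambda>h. exp_tail p h / h) \<longlongrightarrow> 0) (at_left 0)"
    by (rule tendsto_eventually) (auto simp: eventually_at_filter exp_tail_def)
  have "((\<lambda>h. poly ([:0, 1:] * p) (inverse h) * exp (- inverse h)) \<longlongrightarrow> 0) (at_right (0::real))"
    by (rule filterlim_compose[OF poly_times_exp_minus_tendsto filterlim_inverse_at_top_right])
  then show "((\<lambda>h. exp_tail p h / h) \<longlongrightarrow> 0) (at_right 0)"
    by (rule Lim_transform_eventually) (auto simp: eventually_at_filter exp_tail_def field_simps)
qed

lemma exp_tail_has_derivative: "(exp_tail p has_real_derivative exp_tail (exp_tail_pderiv p) t) (at t)"
proof (cases t "0::real" rule: linorder_cases)
  case less
  have "((\<lambda>_. 0) has_real_derivative 0) (at t)" by simp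
  then have "(exp_tail p has_real_derivative 0) (at t)"
    by (rule DERIV_cong_ev[THEN iffD1, rotated -1])
      (use less in \<open>auto simp: exp_tail_def eventually_nhds intro!: exI[of _ "{..<0}"]\<close>)
  with less show ?thesis by (simp add: exp_tail_def)
next
  case equal
  then show ?thesis
    using exp_tail_div_tendsto[of p] by (simp add: DERIV_def exp_tail_def)
next
  case greater
  have "((\<lambda>t. poly p (1 / t) * exp (- (1 / t))) has_real_derivative
      (poly (pderiv p) (1 / t) * (- 1 / t\<^sup>2) * exp (- (1 / t)) + poly p (1 / t) * (exp (- (1 / t)) * (1 / t\<^sup>2)))) (at t)"
    using greater
    by (auto intro!: derivative_eq_intros DERIV_chain'[of "\<lambda>t. 1 / t" _ t UNIV "poly p"] poly_DERIV
        simp: power2_eq_square)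
  also have "(poly (pderiv p) (1 / t) * (- 1 / t\<^sup>2) * exp (- (1 / t)) + poly p (1 / t) * (exp (- (1 / t)) * (1 / t\<^sup>2)))
      = exp_tail (exp_tail_pderiv p) t"
    using greater by (simp add: exp_tail_def exp_tail_pderiv_def power2_eq_square field_simps)
  finally show ?thesis
    by (rule DERIV_cong_ev[THEN iffD1, rotated -1])
      (use greater in \<open>auto simp: exp_tail_def eventually_nhds intro!: exI[of _ "{0<..}"]\<close>)
qed

lemma smooth_exp_tail_comp:
  assumes q: "smooth q"
  shows "smooth (\<lambda>x. exp_tail p (q x))"
proof -
  have der: "((\<lambda>x. exp_tail p (q x)) has_derivative
     (\<lambda>v. frechet_derivative q (at x) v * exp_tail (exp_tail_pderiv p) (q x))) (at x)" for p x
    using has_derivative_compose[OF frechet_has_derivative[OF smooth_differentiable[OF q]]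
        exp_tail_has_derivative[unfolded has_field_derivative_def]]
    by (simp add: mult.commute)
  have pd: "partial_deriv i (\<lambda>x. exp_tail p (q x))
      = (\<lambda>x. partial_deriv i q x * exp_tail (exp_tail_pderiv p) (q x))" for p i
    using partial_deriv_eqI[OF der] by (auto simp: partial_deriv_def)
  have dif: "(\<lambda>x. exp_tail p (q x)) differentiable (at x)" for p x
    using der by (rule differentiableI)
  have "Ck k (\<lambda>x. exp_tail p (q x))" for k
  proof (induction k arbitrary: p)
    case 0
    then show ?case using dif
      by (auto simp: continuous_on_eq_continuous_at intro: differentiable_imp_continuous_within)
  next
    case (Suc k)
    then show ?case
      using smooth_partial_deriv[OF q] by (auto simp: dif pd smooth_def intro!: Ck_mult)
  qed
  then show ?thesis by (simp add: smooth_def)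
qed

lemma smooth_one_minus_norm_squared: "smooth (\<lambda>x::real^'n::finite. 1 - (norm x)\<^sup>2)"
proof -
  have "smooth (\<lambda>x::real^'n. 1 - (\<Sum>i\<in>UNIV. x $ i * x $ i))"
    by (intro smooth_diff smooth_const smooth_sum smooth_mult smooth_coord)
  moreover have "(\<Sum>i\<in>UNIV. x $ i * x $ i) = (norm x)\<^sup>2" for x :: "real^'n"
    by (simp add: power2_norm_eq_inner inner_vec_def)
  ultimately show ?thesis by simp
qed

lemma integral_eq_0_continuous_nonneg:
  fixes f :: "real^'n::finite \<Rightarrow> real"
  assumes "continuous_on UNIV f" "\<And>x. f x \<ge> 0" "integrable lborel f" "(LINT x|lborel. f x) = 0"
  shows "f x = 0"
proof (rule ccontr)
  assume "f x \<noteq> 0"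
  with assms(2)[of x] have pos: "f x > 0" by simp
  have "open {y. f y > 0}"
    using assms(1) by (intro open_Collect_less continuous_intros) auto
  have "AE y in lborel. f y = 0"
    using assms by (subst (asm) integral_nonneg_eq_0_iff_AE) auto
  then have "AE y in lborel. y \<notin> {y. f y > 0}" by auto
  with \<open>open {y. f y > 0}\<close> have "{y. f y > 0} = {}"
    by (metis AE_iff_null_sets borel_open lborelD_Collect open_not_negligible negligible_iff_null_sets null_sets_completionI sets_lborel)
  with pos show False by blast
qed

text \<open>Evenness is included because it makes convolution self-adjoint and lets mollification
  reproduce affine functions.\<close>

lemma ex_bump:
  "\<exists>\<phi>::real^'n::finite \<Rightarrow> real. smooth \<phi> \<and> (\<forall>x. \<phi> x \<ge> 0) \<and> (\<forall>x. \<phi> (- x) = \<phi> x)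
     \<and> (\<forall>x. norm x \<ge> 1 \<longrightarrow> \<phi> x = 0) \<and> (LINT x|lborel. \<phi> x) = 1"
proof -
  \<comment> \<open>The classical \<open>exp (- 1 / (1 - |x|^2))\<close> on the unit ball; the first
    argument \<open>1\<close> is the constant polynomial.\<close>
  define \<psi> :: "real^'n \<Rightarrow> real" where "\<psi> x = exp_tail 1 (1 - (norm x)\<^sup>2)" for x
  have sm: "smooth \<psi>"
    unfolding \<psi>_def by (intro smooth_exp_tail_comp smooth_one_minus_norm_squared)
  have nn: "\<psi> x \<ge> 0" for x by (simp add: \<psi>_def exp_tail_def)
  have out: "\<psi> x = 0" if "norm x \<ge> 1" for x
    using that abs_square_less_1[of "norm x"] by (simp add: \<psi>_def exp_tail_def)
  have int: "integrable lborel \<psi>"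
    by (rule integrable_compact_support[OF smooth_continuous[OF sm] compact_cball[of 0 1]])
      (auto intro: out)
  have "\<psi> 0 \<noteq> 0" by (simp add: \<psi>_def exp_tail_def)
  then have "(LINT x|lborel. \<psi> x) \<noteq> 0"
    using integral_eq_0_continuous_nonneg[OF smooth_continuous[OF sm] nn int] by blast
  moreover have "(LINT x|lborel. \<psi> x) \<ge> 0" using nn by simp
  ultimately have pos: "(LINT x|lborel. \<psi> x) > 0" by simp
  let ?c = "1 / (LINT x|lborel. \<psi> x)"
  show ?thesis
  proof (intro exI[of _ "\<lambda>x. ?c * \<psi> x"] conjI)
    show "smooth (\<lambda>x. ?c * \<psi> x)" using sm by (rule smooth_cmult)
  qed (use nn out pos int in \<open>auto simp: \<psi>_def\<close>)
qed

section \<open>Mollifiers and their scaling\<close>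

definition bump :: "real^'n::finite \<Rightarrow> real" where
  "bump = (SOME \<phi>. smooth \<phi> \<and> (\<forall>x. \<phi> x \<ge> 0) \<and> (\<forall>x. \<phi> (- x) = \<phi> x)
     \<and> (\<forall>x. norm x \<ge> 1 \<longrightarrow> \<phi> x = 0) \<and> (LINT x|lborel. \<phi> x) = 1)"

lemma
  shows smooth_bump: "smooth bump"
    and bump_nonneg: "bump x \<ge> 0"
    and bump_even: "bump (- x) = bump x"
    and bump_eq_0: "norm x \<ge> 1 \<Longrightarrow> bump x = 0"
    and integral_bump: "(LINT x|lborel. bump (x::real^'n::finite)) = 1"
  using someI_ex[OF ex_bump, folded bump_def] by auto

definition mollifier :: "real \<Rightarrow> real^'n::finite \<Rightarrow> real" where
  "mollifier d x = bump (x /\<^sub>R d) / d ^ CARD('n)"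

lemma integral_scale:
  fixes f :: "real^'n::finite \<Rightarrow> real"
  assumes "d > 0" "f \<in> borel_measurable borel"
  shows "(LINT x|lborel. f (x /\<^sub>R d)) = d ^ CARD('n) * (LINT x|lborel. f x)"
proof -
  let ?T = "\<lambda>x::real^'n. 0 + (\<Sum>j\<in>Basis. (d * (x \<bullet> j)) *\<^sub>R j)"
  have T: "?T x = d *\<^sub>R x" for x
    using euclidean_representation[of "d *\<^sub>R x"] by simp
  have D: "DIM(real^'n) = CARD('n)" by simp
  have eq: "lborel = density (distr lborel borel ?T) (\<lambda>_. ennreal (\<Prod>j\<in>(Basis::(real^'n) set). \<bar>d\<bar>))"
    by (rule lborel_affine_euclidean[of "\<lambda>_. d" 0]) (use assms in auto)
  have "(LINT x|lborel. f (x /\<^sub>R d))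
      = (LINT x|density (distr lborel borel ?T) (\<lambda>_. ennreal (\<Prod>j\<in>(Basis::(real^'n) set). \<bar>d\<bar>)). f (x /\<^sub>R d))"
    by (subst eq) simp
  also have "\<dots> = (LINT x|distr lborel borel ?T. d ^ CARD('n) * f (x /\<^sub>R d))"
    using assms by (subst integral_real_density) (auto simp: prod_constant)
  also have "\<dots> = (LINT x|lborel. d ^ CARD('n) * f x)"
    using assms by (subst integral_distr) (auto simp: T[simplified])
  finally show ?thesis by simp
qed

lemma smooth_mollifier: "smooth (mollifier d :: real^'n::finite \<Rightarrow> real)"
proof -
  have "smooth (\<lambda>x::real^'n. (1 / d ^ CARD('n)) * bump ((1 / d) *\<^sub>R x + 0))"
    by (intro smooth_cmult smooth_affine_comp smooth_bump)
  then show ?thesis by (simp add: mollifier_def[abs_def] inverse_eq_divide)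
qed

lemma mollifier_nonneg: "d > 0 \<Longrightarrow> mollifier d x \<ge> 0"
  by (simp add: mollifier_def bump_nonneg)

lemma mollifier_even: "mollifier d (- x) = mollifier d x"
  by (simp add: mollifier_def bump_even)

lemma mollifier_eq_0: "d > 0 \<Longrightarrow> norm x \<ge> d \<Longrightarrow> mollifier d x = 0"
  by (simp add: mollifier_def bump_eq_0 field_simps)

lemma integral_mollifier: "d > 0 \<Longrightarrow> (LINT x|lborel. mollifier d (x::real^'n::finite)) = 1"
  using integral_scale[OF _ borel_measurable_continuous_onI[OF smooth_continuous[OF smooth_bump]], of d, where 'n='n]
  by (simp add: mollifier_def integral_bump)

lemma partial_deriv_mollifier2:
  fixes x :: "real^'n::finite"
  assumes "d > 0"
  shows "partial_deriv i (partial_deriv j (mollifier d)) x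
    = partial_deriv i (partial_deriv j bump) (x /\<^sub>R d) / d ^ (CARD('n) + 2)"
proof -
  have m: "mollifier d = (\<lambda>x::real^'n. (1 / d ^ CARD('n)) * bump ((1 / d) *\<^sub>R x + 0))"
    by (simp add: mollifier_def[abs_def] inverse_eq_divide)
  have pc: "partial_deriv i (\<lambda>x. c * f x) = (\<lambda>x. c * partial_deriv i f x)" if "smooth f"
    for c i and f :: "real^'n \<Rightarrow> real"
    using smooth_differentiable[OF that]
    by (intro ext) (subst partial_deriv_mult, auto)
  have pa: "partial_deriv i (\<lambda>x. f ((1 / d) *\<^sub>R x + 0)) = (\<lambda>x. (1 / d) * partial_deriv i f ((1 / d) *\<^sub>R x + 0))"
    if "smooth f" for i and f :: "real^'n \<Rightarrow> real"
    using smooth_differentiable[OF that]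
    by (intro ext partial_deriv_affine_comp) auto
  note sm = smooth_affine_comp smooth_cmult smooth_partial_deriv smooth_bump
  show ?thesis
    unfolding m by (simp only: pc pa sm) (simp add: inverse_eq_divide power_add power2_eq_square)
qed

text \<open>The two derivatives contribute \<open>d^(-2)\<close>, while the normalisation cancels
  the change of variables. Against a function that varies by O(d) on balls of radius
  \<open>d\<close> this kernel yields O(1/d), the size of the mollified Hessian.\<close>

lemma mollifier_second_deriv_L1:
  obtains C where "C \<ge> 0"
    "\<And>d i j. d > 0 \<Longrightarrow> (LINT x|lborel. \<bar>partial_deriv i (partial_deriv j (mollifier d)) (x::real^'n::finite)\<bar>) \<le> C / d\<^sup>2"
proof -
  define I where "I i j = (LINT x|lborel. \<bar>partial_deriv i (partial_deriv j bump) (x::real^'n)\<bar>)" for i j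
  define C where "C = (\<Sum>i\<in>UNIV. \<Sum>j\<in>UNIV. I i j)"
  have I0: "I i j \<ge> 0" for i j by (simp add: I_def)
  have IC: "I i j \<le> C" for i j
  proof -
    have "I i j \<le> (\<Sum>j\<in>UNIV. I i j)" by (rule member_le_sum) (auto simp: I0)
    also have "\<dots> \<le> C" unfolding C_def
      by (rule member_le_sum[where f="\<lambda>i. \<Sum>j\<in>UNIV. I i j"]) (auto simp: I0 sum_nonneg)
    finally show ?thesis .
  qed
  have eq: "(LINT x|lborel. \<bar>partial_deriv i (partial_deriv j (mollifier d)) (x::real^'n)\<bar>) = I i j / d\<^sup>2"
    if d: "d > 0" for d i j
  proof -
    have meas: "(\<lambda>x. \<bar>partial_deriv i (partial_deriv j bump) (x::real^'n)\<bar>) \<in> borel_measurable borel"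
      by (intro borel_measurable_continuous_onI continuous_intros smooth_continuous smooth_partial_deriv smooth_bump)
    show ?thesis
      using d integral_scale[OF d meas]
      by (simp add: partial_deriv_mollifier2 I_def power_add power2_eq_square)
  qed
  show ?thesis
  proof (rule that[of C])
    show "C \<ge> 0" using IC[of undefined undefined] I0[of undefined undefined] by linarith
    show "(LINT x|lborel. \<bar>partial_deriv i (partial_deriv j (mollifier d)) (x::real^'n)\<bar>) \<le> C / d\<^sup>2"
      if "d > 0" for d i j
      unfolding eq[OF that] using IC that by (intro divide_right_mono) auto
  qed
qed

section \<open>The Schatten \<open>\<infinity>\<close>-norm as an operator norm\<close>

lemma inner_matrix_vector_transpose:
  fixes M :: "real^'n::finite^'n"
  shows "v \<bullet> ((transpose M ** M) *v w) = (M *v v) \<bullet> (M *v w)"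
  by (metis dot_lmul_matrix matrix_vector_mul_assoc transpose_matrix_vector vector_transpose_matrix)

text \<open>By compactness some unit vector maximises the length of its image; the first variation
  at this maximum shows that it is an eigenvector of \<open>transpose M ** M\<close>.\<close>

lemma ex_maximal_singular_value:
  fixes M :: "real^'n::finite^'n"
  obtains s where "s \<in> singular_values M" "\<And>v. norm (M *v v) \<le> s * norm v"
proof -
  have "compact (sphere (0::real^'n) 1)" by simp
  moreover have "axis undefined 1 \<in> sphere (0::real^'n) 1" by simp
  moreover have "continuous_on (sphere 0 1) (\<lambda>v. norm (M *v v))"
    by (intro continuous_on_norm matrix_vector_mult_linear_continuous_on)
  ultimately obtain v0 where v0: "norm v0 = 1"
    and max: "\<And>v. norm v = 1 \<Longrightarrow> norm (M *v v) \<le> norm (M *v v0)"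
    using continuous_attains_sup[of "sphere (0::real^'n) 1" "\<lambda>v. norm (M *v v)"] by (metis empty_iff mem_sphere_0)
  define s where "s = norm (M *v v0)"
  have bound: "norm (M *v v) \<le> s * norm v" for v
  proof (cases "v = 0")
    case False
    then have "norm (M *v ((1 / norm v) *\<^sub>R v)) \<le> s"
      unfolding s_def by (intro max) simp
    with False show ?thesis
      by (simp add: matrix_vector_mult_scaleR field_simps)
  qed simp
  \<comment> \<open>\<open>z\<close> is half the gradient of \<open>|M v|^2 - s^2 |v|^2\<close> at
    \<open>v0\<close>, where this nonpositive function attains 0; a small step in direction
    \<open>z\<close> would make it positive unless \<open>z = 0\<close>.\<close>
  define z where "z = (transpose M ** M) *v v0 - s\<^sup>2 *\<^sub>R v0"
  have quad: "2 * e * (norm z)\<^sup>2 + e\<^sup>2 * ((norm (M *v z))\<^sup>2 - s\<^sup>2 * (norm z)\<^sup>2) \<le> 0" for e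
  proof -
    have zz: "(norm z)\<^sup>2 = (M *v v0) \<bullet> (M *v z) - s\<^sup>2 * (v0 \<bullet> z)"
      unfolding power2_norm_eq_inner by (subst (2) z_def) (simp add: inner_diff_right inner_matrix_vector_transpose inner_commute)
    have "(norm (M *v (v0 + e *\<^sub>R z)))\<^sup>2 \<le> (s * norm (v0 + e *\<^sub>R z))\<^sup>2"
      using bound by (intro power_mono) auto
    then have "(norm (M *v v0 + e *\<^sub>R (M *v z)))\<^sup>2 \<le> s\<^sup>2 * (norm (v0 + e *\<^sub>R z))\<^sup>2"
      by (simp add: matrix_vector_right_distrib matrix_vector_mult_scaleR power_mult_distrib)
    moreover have "(norm (a + e *\<^sub>R b))\<^sup>2 = (norm a)\<^sup>2 + 2 * e * (a \<bullet> b) + e\<^sup>2 * (norm b)\<^sup>2" for a b :: "real^'n"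
      unfolding power2_norm_eq_inner
      by (simp add: inner_add_left inner_add_right inner_commute power2_eq_square algebra_simps)
    ultimately have "s\<^sup>2 + 2 * e * ((M *v v0) \<bullet> (M *v z)) + e\<^sup>2 * (norm (M *v z))\<^sup>2
        \<le> s\<^sup>2 * (1 + 2 * e * (v0 \<bullet> z) + e\<^sup>2 * (norm z)\<^sup>2)"
      using v0 by (simp add: s_def)
    then show ?thesis unfolding zz by (simp add: algebra_simps)
  qed
  have "z = 0"
  proof (rule ccontr)
    assume "z \<noteq> 0"
    then have n: "(norm z)\<^sup>2 > 0" by simp
    define q where "q = (norm (M *v z))\<^sup>2 - s\<^sup>2 * (norm z)\<^sup>2"
    \<comment> \<open>Small enough that the linear term in \<open>quad\<close> dominates:
      \<open>e * |q| < |z|^2\<close>. The summand 1 covers \<open>q = 0\<close>.\<close>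
    define e where "e = (norm z)\<^sup>2 / (1 + \<bar>q\<bar>)"
    have e: "e > 0" using n by (simp add: e_def)
    have "e * (- q) \<le> e * \<bar>q\<bar>" using e by (intro mult_left_mono) auto
    also have "\<dots> < (norm z)\<^sup>2 * 1" unfolding e_def using n by (simp add: field_simps)
    finally have "- (e * q) < (norm z)\<^sup>2" by simp
    then have "2 * (norm z)\<^sup>2 + e * q > 0" using n by linarith
    then have "e * (2 * (norm z)\<^sup>2 + e * q) > 0" using e by simp
    with quad[of e] show False by (simp add: q_def algebra_simps power2_eq_square)
  qed
  then have "s \<in> singular_values M"
    using v0 by (auto simp: singular_values_def z_def s_def intro!: exI[of _ v0])
  with bound that show ?thesis by blast
qed

text \<open>Each singular value is the stretching factor of an eigenvector, so the largest one is
  the operator norm. A bound on vectors, unlike one on eigenvalues, passes directly to sums and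
  averages of matrices.\<close>

lemma schatten_infty_le_1_iff: "schatten_infty M \<le> 1 \<longleftrightarrow> (\<forall>v. norm (M *v v) \<le> norm v)"
proof -
  obtain s where s: "s \<in> singular_values M" "\<And>v. norm (M *v v) \<le> s * norm v"
    using ex_maximal_singular_value by blast
  have sing: "\<exists>v. v \<noteq> 0 \<and> norm (M *v v) = t * norm v \<and> t \<ge> 0" if t: "t \<in> singular_values M" for t
  proof -
    from t obtain v where v: "t \<ge> 0" "v \<noteq> 0" "(transpose M ** M) *v v = t\<^sup>2 *\<^sub>R v"
      by (auto simp: singular_values_def)
    then have "(norm (M *v v))\<^sup>2 = (t * norm v)\<^sup>2"
      using inner_matrix_vector_transpose[of v M v] by (simp add: power2_norm_eq_inner power_mult_distrib)
    then show ?thesis using v(1,2) by (auto intro!: exI[of _ v] simp: power2_eq_iff_nonneg)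
  qed
  have le: "t \<le> s" if t: "t \<in> singular_values M" for t
  proof -
    obtain v where "v \<noteq> 0" "norm (M *v v) = t * norm v" using sing[OF t] by blast
    with s(2)[of v] show ?thesis by simp
  qed
  have "schatten_infty M = s"
    unfolding schatten_infty_def using s(1) le by (intro cSup_eq_maximum)
  moreover obtain v where v: "v \<noteq> 0" "norm (M *v v) = s * norm v" "s \<ge> 0" using sing[OF s(1)] by blast
  moreover have "norm (M *v w) \<le> norm w" if "s \<le> 1" for w
    using s(2)[of w] mult_right_mono[OF that, of "norm w"] by simp
  moreover have "s \<le> 1" if "\<forall>v. norm (M *v v) \<le> norm v"
    using that v by (metis mult_cancel_right1 mult_le_cancel_right2 norm_eq_zero zero_less_norm_iff not_less)
  ultimately show ?thesis by blast
qed

section \<open>Convolution with smooth functions of compact support\<close>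

definition test_fun :: "(real^'n::finite \<Rightarrow> real) \<Rightarrow> bool" where
  "test_fun \<phi> \<longleftrightarrow> smooth \<phi> \<and> (\<exists>R. \<forall>x. norm x \<ge> R \<longrightarrow> \<phi> x = 0)"

lemma test_funI: "smooth \<phi> \<Longrightarrow> (\<And>x. norm x \<ge> R \<Longrightarrow> \<phi> x = 0) \<Longrightarrow> test_fun \<phi>"
  by (auto simp: test_fun_def)

lemma test_fun_smooth: "test_fun \<phi> \<Longrightarrow> smooth \<phi>"
  by (simp add: test_fun_def)

lemma test_fun_continuous: "test_fun \<phi> \<Longrightarrow> continuous_on UNIV \<phi>"
  by (simp add: test_fun_def smooth_continuous)

lemma test_fun_differentiable: "test_fun \<phi> \<Longrightarrow> \<phi> differentiable (at x)"
  by (simp add: test_fun_def smooth_differentiable)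

lemma test_fun_measurable [measurable_dest]: "test_fun \<phi> \<Longrightarrow> \<phi> \<in> borel_measurable borel"
  by (intro borel_measurable_continuous_onI test_fun_continuous)

lemma test_fun_reflect_measurable:
  assumes "test_fun \<phi>"
  shows "(\<lambda>y. \<phi> (x - y)) \<in> borel_measurable borel"
  by (intro borel_measurable_continuous_onI continuous_on_compose2[OF test_fun_continuous[OF assms]] continuous_intros) auto

lemma test_fun_mollifier: "d > 0 \<Longrightarrow> test_fun (mollifier d)"
  by (rule test_funI[of _ d]) (auto simp: smooth_mollifier mollifier_eq_0)

lemma test_fun_support:
  assumes "test_fun \<phi>"
  shows "\<exists>R. \<forall>x. x \<notin> cball 0 R \<longrightarrow> \<phi> x = 0"
proof -
  obtain R where "\<And>x. norm x \<ge> R \<Longrightarrow> \<phi> x = 0" using assms by (auto simp: test_fun_def)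
  then show ?thesis by (intro exI[of _ R]) auto
qed

lemma test_fun_partial_deriv:
  assumes "test_fun \<phi>"
  shows "test_fun (partial_deriv i \<phi>)"
proof -
  obtain R where R: "\<And>x. x \<notin> cball 0 R \<Longrightarrow> \<phi> x = 0"
    using test_fun_support[OF assms] by blast
  show ?thesis
  proof (rule test_funI[of _ "R + 1"])
    show "partial_deriv i \<phi> x = 0" if "norm x \<ge> R + 1" for x
      by (rule partial_deriv_zero_outside[of "cball 0 R"]) (use that R in auto)
  qed (intro smooth_partial_deriv test_fun_smooth assms)
qed

lemma test_fun_bounded:
  assumes "test_fun \<phi>"
  shows "\<exists>B\<ge>0. \<forall>x. \<bar>\<phi> x\<bar> \<le> B"
proof -
  obtain R where R: "\<And>x. x \<notin> cball 0 R \<Longrightarrow> \<phi> x = 0"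
    using test_fun_support[OF assms] by blast
  obtain B where "B \<ge> 0" "\<And>x. \<bar>\<phi> x\<bar> \<le> B"
    using bounded_compact_support[OF test_fun_continuous[OF assms] compact_cball[of 0 R] R] by metis
  then show ?thesis by blast
qed

lemma test_fun_integrable:
  assumes "test_fun \<phi>"
  shows "integrable lborel \<phi>"
proof -
  obtain R where R: "\<And>x. x \<notin> cball 0 R \<Longrightarrow> \<phi> x = 0"
    using test_fun_support[OF assms] by blast
  show ?thesis
    by (rule integrable_compact_support[OF test_fun_continuous[OF assms] compact_cball[of 0 R] R])
qed

lemma test_fun_translate:
  assumes "test_fun \<phi>"
  shows "test_fun (\<lambda>x. \<phi> (x + v))"
proof -
  obtain R where R: "\<And>x. x \<notin> cball 0 R \<Longrightarrow> \<phi> x = 0"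
    using test_fun_support[OF assms] by blast
  have "\<phi> (x + v) = 0" if "norm x \<ge> R + norm v + 1" for x
    using that norm_triangle_ineq4[of "x + v" v] by (intro R) auto
  then show ?thesis
    using test_funI[OF smooth_translate[OF test_fun_smooth[OF assms]]] by blast
qed

lemma onorm_sum_coord_le: "onorm (\<lambda>v::real^'n::finite. \<Sum>i\<in>UNIV. v $ i * c i) \<le> (\<Sum>i\<in>UNIV. \<bar>c i\<bar>)"
proof (rule onorm_bound)
  show "norm (\<Sum>i\<in>UNIV. v $ i * c i) \<le> (\<Sum>i\<in>UNIV. \<bar>c i\<bar>) * norm v" for v :: "real^'n"
  proof -
    have "norm (\<Sum>i\<in>UNIV. v $ i * c i) \<le> (\<Sum>i\<in>UNIV. \<bar>c i\<bar> * norm v)"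
      by (rule sum_norm_le) (auto simp: abs_mult mult.commute[of "\<bar>c _\<bar>"] intro!: mult_right_mono component_le_norm_cart)
    then show ?thesis by (simp add: sum_distrib_right)
  qed
qed (simp add: sum_nonneg)

lemma test_fun_lipschitz:
  fixes \<phi> :: "real^'n::finite \<Rightarrow> real"
  assumes "test_fun \<phi>"
  shows "\<exists>C\<ge>0. \<forall>x y. \<bar>\<phi> y - \<phi> x\<bar> \<le> C * norm (y - x)"
proof -
  have "\<exists>B\<ge>0. \<forall>x. \<bar>partial_deriv i \<phi> x\<bar> \<le> B" for i
    using test_fun_bounded[OF test_fun_partial_deriv[OF assms]] by blast
  then obtain B where B: "\<And>i. B i \<ge> 0" "\<And>i x. \<bar>partial_deriv i \<phi> x\<bar> \<le> B i" by metis
  have "norm (\<phi> y - \<phi> x) \<le> (\<Sum>i\<in>UNIV. B i) * norm (y - x)" for x y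
  proof (rule differentiable_bound[of UNIV])
    show "(\<phi> has_derivative (\<lambda>v. \<Sum>i\<in>UNIV. v $ i * partial_deriv i \<phi> x)) (at x within UNIV)" for x
      using has_derivative_partial_deriv[OF test_fun_differentiable[OF assms]] by simp
    show "onorm (\<lambda>v. \<Sum>i\<in>UNIV. v $ i * partial_deriv i \<phi> x) \<le> (\<Sum>i\<in>UNIV. B i)" for x
      by (rule order_trans[OF onorm_sum_coord_le]) (intro sum_mono B)
  qed auto
  then show ?thesis
    by (intro exI[of _ "\<Sum>i\<in>UNIV. B i"]) (auto simp: B sum_nonneg)
qed

text \<open>The partial derivatives are Lipschitz, so the remainder is quadratic with one constant
  for all \<open>x\<close>; this uniformity permits differentiation under the convolution
  integral.\<close>

lemma test_fun_taylor:
  fixes \<phi> :: "real^'n::finite \<Rightarrow> real"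
  assumes "test_fun \<phi>"
  obtains C where "C \<ge> 0"
    "\<And>x h. \<bar>\<phi> (x + h) - \<phi> x - (\<Sum>i\<in>UNIV. h $ i * partial_deriv i \<phi> x)\<bar> \<le> C * (norm h)\<^sup>2"
proof -
  have "\<exists>C\<ge>0. \<forall>x y. \<bar>partial_deriv i \<phi> y - partial_deriv i \<phi> x\<bar> \<le> C * norm (y - x)" for i
    using test_fun_lipschitz[OF test_fun_partial_deriv[OF assms]] by blast
  then obtain C where C: "\<And>i. C i \<ge> 0"
    "\<And>i x y. \<bar>partial_deriv i \<phi> y - partial_deriv i \<phi> x\<bar> \<le> C i * norm (y - x)" by metis
  let ?S = "\<Sum>i\<in>UNIV. C i"
  have "norm (\<phi> (x + h) - \<phi> x - (\<Sum>i\<in>UNIV. (x + h - x) $ i * partial_deriv i \<phi> x))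
      \<le> norm (x + h - x) * (?S * norm h)" for x h
  proof (rule differentiable_bound_linearization[where S = "cball x (norm h)" and f' = "\<lambda>x v. \<Sum>i\<in>UNIV. v $ i * partial_deriv i \<phi> x"])
    show "(\<phi> has_derivative (\<lambda>v. \<Sum>i\<in>UNIV. v $ i * partial_deriv i \<phi> z)) (at z within cball x (norm h))" for z
      using has_derivative_partial_deriv[OF test_fun_differentiable[OF assms]] by (rule has_derivative_at_withinI)
    show "onorm ((\<lambda>v. \<Sum>i\<in>UNIV. v $ i * partial_deriv i \<phi> z) - (\<lambda>v. \<Sum>i\<in>UNIV. v $ i * partial_deriv i \<phi> x))
        \<le> ?S * norm h" if "z \<in> cball x (norm h)" for z
    proof -
      have "\<bar>partial_deriv i \<phi> z - partial_deriv i \<phi> x\<bar> \<le> C i * norm h" for i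
      proof -
        have "\<bar>partial_deriv i \<phi> z - partial_deriv i \<phi> x\<bar> \<le> C i * norm (z - x)"
          by (rule C(2))
        also have "\<dots> \<le> C i * norm h"
          using that C(1)[of i] by (intro mult_left_mono) (auto simp: dist_norm norm_minus_commute)
        finally show ?thesis .
      qed
      then have "(\<Sum>i\<in>UNIV. \<bar>partial_deriv i \<phi> z - partial_deriv i \<phi> x\<bar>) \<le> ?S * norm h"
        unfolding sum_distrib_right by (intro sum_mono)
      moreover have "((\<lambda>v. \<Sum>i\<in>UNIV. v $ i * partial_deriv i \<phi> z) - (\<lambda>v. \<Sum>i\<in>UNIV. v $ i * partial_deriv i \<phi> x))
          = (\<lambda>v. \<Sum>i\<in>UNIV. v $ i * (partial_deriv i \<phi> z - partial_deriv i \<phi> x))"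
        by (auto simp: sum_subtractf right_diff_distrib)
      ultimately show ?thesis
        using onorm_sum_coord_le[of "\<lambda>i. partial_deriv i \<phi> z - partial_deriv i \<phi> x"] by simp
    qed
    show "x + t *\<^sub>R (x + h - x) \<in> cball x (norm h)" if "t \<in> {0..1}" for t
      using that by (auto simp: dist_norm mult_left_le_one_le)
  qed auto
  then show ?thesis
    by (intro that[of ?S]) (auto simp: C sum_nonneg power2_eq_square algebra_simps)
qed

section \<open>Convolution: derivatives, locality and adjointness\<close>

definition conv :: "(real^'n::finite \<Rightarrow> real) \<Rightarrow> (real^'n \<Rightarrow> real) \<Rightarrow> real^'n \<Rightarrow> real" where
  "conv u \<phi> x = (LINT y|lborel. u y * \<phi> (x - y))"

lemma integrable_mult_bounded:
  fixes u v :: "real^'n::finite \<Rightarrow> real"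
  assumes "integrable lborel u" "v \<in> borel_measurable borel" "\<And>x. \<bar>v x\<bar> \<le> B"
  shows "integrable lborel (\<lambda>x. u x * v x)"
proof (rule Bochner_Integration.integrable_bound)
  show "integrable lborel (\<lambda>x. B * u x)" using assms(1) by simp
  show "(\<lambda>x. u x * v x) \<in> borel_measurable lborel"
    using assms(1,2) by (auto intro!: borel_measurable_times simp: borel_measurable_integrable)
  have "\<bar>u x\<bar> * \<bar>v x\<bar> \<le> \<bar>B\<bar> * \<bar>u x\<bar>" for x
    using assms(3)[of x] by (subst mult.commute) (intro mult_right_mono, auto)
  then show "AE x in lborel. norm (u x * v x) \<le> norm (B * u x)" by (auto simp: abs_mult)
qed

lemma integrable_mult_test_fun:
  assumes "integrable lborel u" "test_fun \<phi>"
  shows "integrable lborel (\<lambda>x. u x * \<phi> x)"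
proof -
  obtain B where "\<And>x. \<bar>\<phi> x\<bar> \<le> B" using test_fun_bounded[OF assms(2)] by blast
  with assms show ?thesis by (intro integrable_mult_bounded) auto
qed

lemma integrable_conv_integrand:
  assumes "integrable lborel u" "test_fun \<phi>"
  shows "integrable lborel (\<lambda>y. u y * \<phi> (x - y))"
proof -
  obtain B where "\<And>x. \<bar>\<phi> x\<bar> \<le> B" using test_fun_bounded[OF assms(2)] by blast
  with assms show ?thesis by (intro integrable_mult_bounded test_fun_reflect_measurable) auto
qed

text \<open>All derivatives fall on \<open>\<phi>\<close>, since \<open>u\<close> is only
  integrable; integrating the Taylor remainder against \<open>|u|\<close> keeps it quadratic in
  \<open>h\<close>.\<close>

lemma conv_has_derivative:
  fixes u :: "real^'n::finite \<Rightarrow> real"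
  assumes u: "integrable lborel u" and \<phi>: "test_fun \<phi>"
  shows "(conv u \<phi> has_derivative (\<lambda>h. \<Sum>i\<in>UNIV. h $ i * conv u (partial_deriv i \<phi>) x)) (at x)"
proof -
  obtain C where C: "C \<ge> 0"
    "\<And>x h. \<bar>\<phi> (x + h) - \<phi> x - (\<Sum>i\<in>UNIV. h $ i * partial_deriv i \<phi> x)\<bar> \<le> C * (norm h)\<^sup>2"
    using test_fun_taylor[OF \<phi>] by blast
  let ?D = "\<lambda>h. \<Sum>i\<in>UNIV. h $ i * conv u (partial_deriv i \<phi>) x"
  let ?I = "LINT y|lborel. \<bar>u y\<bar>"
  note int = integrable_conv_integrand[OF u \<phi>] integrable_conv_integrand[OF u test_fun_partial_deriv[OF \<phi>]]
  have rem: "\<bar>conv u \<phi> (x + h) - conv u \<phi> x - ?D h\<bar> \<le> (?I * C * norm h) * norm h" for h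
  proof -
    let ?r = "\<lambda>y. \<phi> (x - y + h) - \<phi> (x - y) - (\<Sum>i\<in>UNIV. h $ i * partial_deriv i \<phi> (x - y))"
    have split: "u y * ?r y = u y * \<phi> (x + h - y) - u y * \<phi> (x - y) - (\<Sum>i\<in>UNIV. h $ i * (u y * partial_deriv i \<phi> (x - y)))" for y
      by (simp add: algebra_simps sum_distrib_left)
    have inth: "integrable lborel (\<lambda>y. \<Sum>i\<in>UNIV. h $ i * (u y * partial_deriv i \<phi> (x - y)))"
      by (intro Bochner_Integration.integrable_sum integrable_mult_right int)
    have "(LINT y|lborel. u y * ?r y) = conv u \<phi> (x + h) - conv u \<phi> x
        - (LINT y|lborel. (\<Sum>i\<in>UNIV. h $ i * (u y * partial_deriv i \<phi> (x - y))))"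
      unfolding split conv_def
      by (rule trans[OF Bochner_Integration.integral_diff[OF Bochner_Integration.integrable_diff[OF int(1) int(1)] inth]
          arg_cong2[where f = "(-)", OF Bochner_Integration.integral_diff[OF int(1) int(1)] refl]])
    also have "(LINT y|lborel. (\<Sum>i\<in>UNIV. h $ i * (u y * partial_deriv i \<phi> (x - y)))) = ?D h"
      unfolding conv_def
      by (subst Bochner_Integration.integral_sum) (intro integrable_mult_right int, simp)
    finally have eq: "conv u \<phi> (x + h) - conv u \<phi> x - ?D h = (LINT y|lborel. u y * ?r y)" by (rule sym)
    have "\<bar>conv u \<phi> (x + h) - conv u \<phi> x - ?D h\<bar> \<le> (LINT y|lborel. \<bar>u y * ?r y\<bar>)"
      unfolding eq by (rule integral_abs_bound)
    also have "\<dots> \<le> (LINT y|lborel. \<bar>u y\<bar> * (C * (norm h)\<^sup>2))"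
    proof (rule integral_mono)
      have "integrable lborel (\<lambda>y. u y * ?r y)"
        unfolding split
        by (rule Bochner_Integration.integrable_diff[OF Bochner_Integration.integrable_diff[OF int(1) int(1)] inth])
      then show "integrable lborel (\<lambda>y. \<bar>u y * ?r y\<bar>)" by (rule integrable_abs)
      show "integrable lborel (\<lambda>y. \<bar>u y\<bar> * (C * (norm h)\<^sup>2))" using u by simp
      show "\<bar>u y * ?r y\<bar> \<le> \<bar>u y\<bar> * (C * (norm h)\<^sup>2)" for y
        unfolding abs_mult using C(2)[of "x - y" h] by (rule mult_left_mono) (rule abs_ge_zero)
    qed
    also have "\<dots> = ?I * (C * (norm h)\<^sup>2)"
      by (rule integral_mult_left_zero)
    finally show ?thesis by (simp only: power2_eq_square mult.assoc)
  qed
  show ?thesis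
  proof (rule has_derivativeI_sandwich[of 1])
    show "bounded_linear ?D"
      by (intro bounded_linear_sum bounded_linear_mult_const[OF bounded_linear_vec_nth])
    show "norm (conv u \<phi> y - conv u \<phi> x - ?D (y - x)) / norm (y - x) \<le> ?I * C * norm (y - x)"
      if "y \<noteq> x" for y
      using rem[of "y - x"] that by (simp add: divide_le_eq)
    have "((\<lambda>y. ?I * C * norm (y - x)) \<longlongrightarrow> ?I * C * norm (x - x)) (at x)"
      by (intro tendsto_intros)
    then show "((\<lambda>y. ?I * C * norm (y - x)) \<longlongrightarrow> 0) (at x)" by simp
  qed simp
qed

lemma partial_deriv_conv:
  assumes "integrable lborel u" "test_fun \<phi>"
  shows "partial_deriv i (conv u \<phi>) = conv u (partial_deriv i \<phi>)"
proof
  fix x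
  have "partial_deriv i (conv u \<phi>) x = (\<Sum>j\<in>UNIV. axis i 1 $ j * conv u (partial_deriv j \<phi>) x)"
    by (rule partial_deriv_eqI[OF conv_has_derivative[OF assms]])
  also have "\<dots> = (\<Sum>j\<in>UNIV. if j = i then conv u (partial_deriv j \<phi>) x else 0)"
    by (intro sum.cong refl) (auto simp: axis_def)
  finally show "partial_deriv i (conv u \<phi>) x = conv u (partial_deriv i \<phi>) x" by simp
qed

lemma smooth_conv:
  assumes "integrable lborel u" "test_fun \<phi>"
  shows "smooth (conv u \<phi>)"
proof (rule smooth_coinduct[where X = "\<lambda>f. \<exists>\<phi>. test_fun \<phi> \<and> f = conv u \<phi>"])
  show "\<exists>\<psi>. test_fun \<psi> \<and> conv u \<phi> = conv u \<psi>" using assms by blast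
  fix f assume "\<exists>\<phi>. test_fun \<phi> \<and> f = conv u \<phi>"
  then obtain \<psi> where \<psi>: "test_fun \<psi>" "f = conv u \<psi>" by blast
  show "(\<forall>x. f differentiable (at x)) \<and> (\<forall>i. \<exists>\<phi>. test_fun \<phi> \<and> partial_deriv i f = conv u \<phi>)"
    unfolding \<psi>(2) partial_deriv_conv[OF assms(1) \<psi>(1)]
    using differentiableI[OF conv_has_derivative[OF assms(1) \<psi>(1)]] test_fun_partial_deriv[OF \<psi>(1)]
    by blast
qed

lemma conv_eq_0:
  assumes "\<And>z. norm z \<ge> d \<Longrightarrow> \<phi> z = 0" "\<And>y. dist x y < d \<Longrightarrow> u y = 0"
  shows "conv u \<phi> x = 0"
proof -
  have "u y * \<phi> (x - y) = 0" for y
    using assms(1)[of "x - y"] assms(2)[of y] by (cases "dist x y < d") (auto simp: dist_norm)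
  then have "(\<lambda>y. u y * \<phi> (x - y)) = (\<lambda>_. 0)" by blast
  then show ?thesis unfolding conv_def by (simp only: Bochner_Integration.integral_zero)
qed

lemma conv_cong_ball:
  assumes "\<And>z. norm z \<ge> d \<Longrightarrow> \<phi> z = 0" "AE y in lborel. y \<in> ball x d \<longrightarrow> u y = v y"
    and "u \<in> borel_measurable borel" "v \<in> borel_measurable borel" "\<phi> \<in> borel_measurable borel"
  shows "conv u \<phi> x = conv v \<phi> x"
  unfolding conv_def
proof (rule integral_cong_AE)
  show "AE y in lborel. u y * \<phi> (x - y) = v y * \<phi> (x - y)"
    using assms(2)
  proof (rule AE_mp, intro AE_I2 impI)
    fix y assume "y \<in> ball x d \<longrightarrow> u y = v y"
    then show "u y * \<phi> (x - y) = v y * \<phi> (x - y)"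
      using assms(1)[of "x - y"] by (cases "dist x y < d") (auto simp: dist_norm)
  qed
qed (use assms in auto)

text \<open>Fubini; evenness of \<open>\<phi>\<close> restores the kernel after the exchange of
  \<open>x\<close> and \<open>y\<close>. This transfers mollification from test fields to
  functions.\<close>

lemma conv_adjoint:
  fixes u v :: "real^'n::finite \<Rightarrow> real"
  assumes u: "integrable lborel u" and v: "integrable lborel v" and \<phi>: "test_fun \<phi>" "\<And>x. \<phi> (- x) = \<phi> x"
  shows "(LINT x|lborel. u x * conv v \<phi> x) = (LINT y|lborel. v y * conv u \<phi> y)"
proof -
  have int: "integrable (lborel \<Otimes>\<^sub>M lborel) (\<lambda>(x, y). u x * v y * \<phi> (x - y))"
  proof -
    obtain B where B: "B \<ge> 0" "\<And>x. \<bar>\<phi> x\<bar> \<le> B" using test_fun_bounded[OF \<phi>(1)] by blast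
    have "integrable (lborel \<Otimes>\<^sub>M lborel) (\<lambda>(x, y). u x * v y)"
    proof (rule lborel_pair.Fubini_integrable)
      have [measurable]: "u \<in> borel_measurable borel" "v \<in> borel_measurable borel"
        using u v by auto
      show "(\<lambda>(x, y). u x * v y) \<in> borel_measurable (lborel \<Otimes>\<^sub>M lborel)" by measurable
    qed (use u v in \<open>auto simp: abs_mult\<close>)
    then have "integrable (lborel \<Otimes>\<^sub>M lborel) (\<lambda>p. B * (case p of (x, y) \<Rightarrow> u x * v y))" by simp
    then show ?thesis
    proof (rule Bochner_Integration.integrable_bound)
      have [measurable]: "u \<in> borel_measurable borel" "v \<in> borel_measurable borel" "\<phi> \<in> borel_measurable borel"
        using u v \<phi> by auto
      show "(\<lambda>(x, y). u x * v y * \<phi> (x - y)) \<in> borel_measurable (lborel \<Otimes>\<^sub>M lborel)"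
        by measurable
      show "AE p in lborel \<Otimes>\<^sub>M lborel. norm (case p of (x, y) \<Rightarrow> u x * v y * \<phi> (x - y))
          \<le> norm (B * (case p of (x, y) \<Rightarrow> u x * v y))"
      proof (intro AE_I2, clarsimp simp: abs_mult)
        fix x y
        show "\<bar>u x\<bar> * \<bar>v y\<bar> * \<bar>\<phi> (x - y)\<bar> \<le> \<bar>B\<bar> * (\<bar>u x\<bar> * \<bar>v y\<bar>)"
          using B by (subst mult.commute) (intro mult_right_mono, auto)
      qed
    qed
  qed
  have "(LINT x|lborel. u x * conv v \<phi> x) = (LINT x|lborel. LINT y|lborel. u x * v y * \<phi> (x - y))"
    by (simp add: conv_def mult.assoc)
  also have "\<dots> = (LINT y|lborel. LINT x|lborel. u x * v y * \<phi> (x - y))"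
    using lborel_pair.Fubini_integral[OF int] by simp
  also have "\<dots> = (LINT y|lborel. v y * conv u \<phi> y)"
  proof (rule Bochner_Integration.integral_cong[OF refl])
    fix y
    have "(LINT x|lborel. u x * v y * \<phi> (x - y)) = (LINT x|lborel. v y * (u x * \<phi> (y - x)))"
      by (intro Bochner_Integration.integral_cong refl) (metis \<phi>(2) minus_diff_eq mult.assoc mult.commute)
    then show "(LINT x|lborel. u x * v y * \<phi> (x - y)) = v y * conv u \<phi> y"
      by (simp add: conv_def)
  qed
  finally show ?thesis .
qed

lemma lborel_integral_reflect:
  fixes f :: "real^'n::finite \<Rightarrow> real"
  assumes [measurable]: "f \<in> borel_measurable borel"
  shows "(LINT y|lborel. f (x - y)) = (LINT y|lborel. f y)"
proof -
  have "(LINT y|lborel. f y) = (LINT y|distr lborel borel ((+) x). f y)"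
    by (simp add: lborel_distr_plus)
  also have "\<dots> = (LINT y|lborel. f (x + y))" by (subst integral_distr) auto
  also have "\<dots> = (LINT y|lborel. f (x + - y))"
  proof -
    have "(lborel :: (real^'n) measure) = distr lborel borel uminus"
      using lborel_affine[of "-1" "0 :: real^'n"] by (simp add: density_1)
    then have "(LINT y|lborel. f (x + y)) = (LINT y|distr lborel borel uminus. f (x + y))"
      by simp
    then show ?thesis by (subst (asm) integral_distr) auto
  qed
  finally show ?thesis by simp
qed

lemma integral_mollifier_diff:
  "d > 0 \<Longrightarrow> (LINT y|lborel. mollifier d (x - y)) = 1"
  by (subst lborel_integral_reflect) (auto simp: integral_mollifier test_fun_measurable test_fun_mollifier)

lemma integrable_mollifier_diff:
  assumes "d > 0"
  shows "integrable lborel (\<lambda>y. mollifier d (x - y))"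
proof -
  have "test_fun (\<lambda>y. mollifier d (y + (- x)))"
    by (intro test_fun_translate test_fun_mollifier assms)
  then have "integrable lborel (\<lambda>y. mollifier d (y + (- x)))" by (rule test_fun_integrable)
  moreover have "mollifier d (y + (- x)) = mollifier d (x - y)" for y
    using mollifier_even[of d "x - y"] by (simp add: algebra_simps)
  ultimately show ?thesis by simp
qed

text \<open>The mollifier is a probability density supported in the ball of radius \<open>d\<close>,
  so convolving with it takes a weighted mean over that ball.\<close>

lemma conv_mollifier_close:
  fixes u :: "real^'n::finite \<Rightarrow> real"
  assumes d: "d > 0" and u: "integrable lborel u" and c: "\<And>y. dist x y < d \<Longrightarrow> \<bar>u y - c\<bar> \<le> e"
  shows "\<bar>conv u (mollifier d) x - c\<bar> \<le> e"
proof -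
  have int1: "integrable lborel (\<lambda>y. u y * mollifier d (x - y))"
    and int2: "integrable lborel (\<lambda>y. a * mollifier d (x - y))" for a
    by (intro integrable_conv_integrand[OF u test_fun_mollifier[OF d]] integrable_mult_right integrable_mollifier_diff[OF d])+
  have pt: "\<bar>(u y - c) * mollifier d (x - y)\<bar> \<le> e * mollifier d (x - y)" for y
  proof (cases "dist x y < d")
    case True
    then show ?thesis unfolding abs_mult
      using mollifier_nonneg[OF d, of "x - y"] mult_right_mono[OF c[OF True], of "mollifier d (x - y)"] by simp
  next
    case False
    then have "mollifier d (x - y) = 0" using mollifier_eq_0[OF d, of "x - y"] by (simp add: dist_norm)
    then show ?thesis by simp
  qed
  have eq: "(u y - c) * mollifier d (x - y) = u y * mollifier d (x - y) - c * mollifier d (x - y)" for y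
    by (simp add: algebra_simps)
  have cd: "conv u (mollifier d) x - c = (LINT y|lborel. (u y - c) * mollifier d (x - y))"
    unfolding eq conv_def Bochner_Integration.integral_diff[OF int1 int2]
    by (simp add: integral_mollifier_diff[OF d])
  have "\<bar>conv u (mollifier d) x - c\<bar> \<le> (LINT y|lborel. \<bar>(u y - c) * mollifier d (x - y)\<bar>)"
    unfolding cd by (rule integral_abs_bound)
  also have "\<dots> \<le> (LINT y|lborel. e * mollifier d (x - y))"
  proof (rule integral_mono)
    have "integrable lborel (\<lambda>y. (u y - c) * mollifier d (x - y))"
      unfolding eq by (rule Bochner_Integration.integrable_diff[OF int1 int2])
    then show "integrable lborel (\<lambda>y. \<bar>(u y - c) * mollifier d (x - y)\<bar>)" by (rule integrable_abs)
  qed (rule int2 pt)+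
  also have "\<dots> = e" by (simp add: integral_mollifier_diff[OF d])
  finally show ?thesis .
qed

lemma conv_mollifier_tendsto_uniform:
  assumes \<phi>: "test_fun \<phi>" and e: "e > 0"
  obtains d0 where "d0 > 0" "\<And>d x. 0 < d \<Longrightarrow> d < d0 \<Longrightarrow> \<bar>conv \<phi> (mollifier d) x - \<phi> x\<bar> \<le> e"
proof -
  obtain C where C: "C \<ge> 0" "\<And>x y. \<bar>\<phi> y - \<phi> x\<bar> \<le> C * norm (y - x)"
    using test_fun_lipschitz[OF \<phi>] by blast
  show ?thesis
  proof (rule that[of "e / (C + 1)"])
    show "e / (C + 1) > 0" using e C(1) by simp
    fix d x assume d: "0 < d" "d < e / (C + 1)"
    show "\<bar>conv \<phi> (mollifier d) x - \<phi> x\<bar> \<le> e"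
    proof (rule conv_mollifier_close[OF d(1) test_fun_integrable[OF \<phi>]])
      fix y assume y: "dist x y < d"
      have "\<bar>\<phi> y - \<phi> x\<bar> \<le> C * norm (y - x)" by (rule C(2))
      also have "\<dots> \<le> (C + 1) * d" using y C(1) d(1)
        by (intro mult_mono) (auto simp: dist_norm norm_minus_commute)
      also have "\<dots> \<le> e" using d C(1) by (simp add: field_simps)
      finally show "\<bar>\<phi> y - \<phi> x\<bar> \<le> e" .
    qed
  qed
qed

text \<open>The constant part is reproduced because the mollifier has integral one, the linear part
  because the first moments of an even function vanish.\<close>

lemma conv_mollifier_affine:
  fixes x a :: "real^'n::finite"
  assumes d: "d > 0" and u: "u \<in> borel_measurable borel"
    and aff: "AE y in lborel. y \<in> ball x d \<longrightarrow> u y = a \<bullet> y + b"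
  shows "conv u (mollifier d) x = a \<bullet> x + b"
proof -
  have meas: "mollifier d \<in> borel_measurable (borel :: (real^'n) measure)"
    by (intro test_fun_measurable test_fun_mollifier d)
  have affm: "(\<lambda>y. a \<bullet> y + b) \<in> borel_measurable (borel :: (real^'n) measure)"
    by (intro borel_measurable_continuous_onI continuous_intros)
  have "conv u (mollifier d) x = conv (\<lambda>y. a \<bullet> y + b) (mollifier d) x"
    by (rule conv_cong_ball[OF mollifier_eq_0[OF d] aff u affm meas])
  also have "\<dots> = (LINT y|lborel. (a \<bullet> (x - y) + b) * mollifier d y)"
    unfolding conv_def using affm meas
    by (subst lborel_integral_reflect[of _ x, symmetric]) auto
  also have "\<dots> = (LINT y|lborel. (a \<bullet> x + b) * mollifier d y - (a \<bullet> y) * mollifier d y)"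
    by (simp add: inner_diff_right algebra_simps)
  also have "\<dots> = (a \<bullet> x + b) * (LINT y|lborel. mollifier d (y::real^'n)) - (LINT y|lborel. (a \<bullet> y) * mollifier d y)"
  proof (subst Bochner_Integration.integral_diff)
    show "integrable lborel (\<lambda>y::real^'n. (a \<bullet> y) * mollifier d y)"
      by (rule integrable_compact_support[OF _ compact_cball[of 0 d]])
        (auto intro!: continuous_intros smooth_continuous[OF smooth_mollifier] mollifier_eq_0[OF d])
  qed (auto intro!: test_fun_integrable test_fun_mollifier d)
  also have "(LINT y|lborel. (a \<bullet> y) * mollifier d y) = 0"
  proof -
    have "(LINT y|lborel. (a \<bullet> y) * mollifier d y) = (LINT y|lborel. (a \<bullet> (0 - y)) * mollifier d (0 - y))"
      by (rule lborel_integral_reflect[symmetric])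
        (intro borel_measurable_times borel_measurable_continuous_onI continuous_intros smooth_continuous[OF smooth_mollifier])
    also have "\<dots> = - (LINT y|lborel. (a \<bullet> y) * mollifier d y)"
      by (simp add: mollifier_even)
    finally show ?thesis by simp
  qed
  finally show ?thesis by (simp add: integral_mollifier[OF d])
qed

text \<open>Adjointness moves \<open>\<phi>\<close> onto the translate of \<open>\<psi>\<close>, and
  the point reflection taking \<open>y\<close> to \<open>x + z - y\<close> exchanges the two
  kernels. With it, mollifications at different scales can be compared.\<close>

lemma conv_conv_commute:
  fixes u :: "real^'n::finite \<Rightarrow> real"
  assumes u: "integrable lborel u" and \<phi>: "test_fun \<phi>" "\<And>x. \<phi> (- x) = \<phi> x"
    and \<psi>: "test_fun \<psi>" "\<And>x. \<psi> (- x) = \<psi> x"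
  shows "(LINT y|lborel. conv u \<phi> y * \<psi> (x - y)) = (LINT y|lborel. conv u \<psi> y * \<phi> (x - y))"
proof -
  have int: "integrable lborel (\<lambda>y. \<eta> (x - y))" if "test_fun \<eta>" "\<And>z. \<eta> (- z) = \<eta> z" for \<eta>
  proof -
    have "integrable lborel (\<lambda>y. \<eta> (y + (- x)))"
      by (intro test_fun_integrable test_fun_translate that)
    moreover have "\<eta> (y + (- x)) = \<eta> (x - y)" for y
      using that(2)[of "x - y"] by (simp add: algebra_simps)
    ultimately show ?thesis by simp
  qed
  have eq: "(LINT y|lborel. conv u \<phi> y * \<psi> (x - y)) = (LINT y|lborel. u y * conv (\<lambda>y. \<psi> (x - y)) \<phi> y)"
    if "test_fun \<phi>" "\<And>x. \<phi> (- x) = \<phi> x" "test_fun \<psi>" "\<And>x. \<psi> (- x) = \<psi> x" for \<phi> \<psi>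
    using conv_adjoint[OF int[OF that(3,4)] u that(1,2)] by (simp add: mult.commute)
  have "conv (\<lambda>y. \<psi> (x - y)) \<phi> z = conv (\<lambda>y. \<phi> (x - y)) \<psi> z" for z
  proof -
    have "conv (\<lambda>y. \<psi> (x - y)) \<phi> z = (LINT y|lborel. \<psi> (x - (x + z - y)) * \<phi> (z - (x + z - y)))"
      unfolding conv_def
      by (rule lborel_integral_reflect[symmetric])
        (intro borel_measurable_times test_fun_reflect_measurable \<phi> \<psi>)
    also have "\<dots> = conv (\<lambda>y. \<phi> (x - y)) \<psi> z"
      unfolding conv_def
    proof (rule Bochner_Integration.integral_cong[OF refl])
      fix y
      show "\<psi> (x - (x + z - y)) * \<phi> (z - (x + z - y)) = \<phi> (x - y) * \<psi> (z - y)"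
        using \<psi>(2)[of "z - y"] \<phi>(2)[of "x - y"] by (simp add: algebra_simps)
    qed
    finally show ?thesis .
  qed
  then show ?thesis by (simp add: eq \<phi> \<psi>)
qed

lemma partial_deriv_reflect:
  fixes f :: "real^'n::finite \<Rightarrow> real"
  assumes "f differentiable (at (- x))"
  shows "partial_deriv i (\<lambda>x. f (- x)) x = - partial_deriv i f (- x)"
  using partial_deriv_affine_comp[of f "-1" x 0 i] assms by simp

lemma partial_deriv2_even:
  assumes \<phi>: "smooth \<phi>" "\<And>x. \<phi> (- x) = \<phi> x"
  shows "partial_deriv i (partial_deriv j \<phi>) (- x) = partial_deriv i (partial_deriv j \<phi>) x"
proof -
  have 1: "partial_deriv j \<phi> (- x) = - partial_deriv j \<phi> x" for x j
    using partial_deriv_reflect[OF smooth_differentiable[OF \<phi>(1)], of j x] \<phi>(2) by simp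
  have sm: "smooth (partial_deriv j \<phi>)" by (intro smooth_partial_deriv \<phi>)
  have "- partial_deriv i (partial_deriv j \<phi>) (- x) = partial_deriv i (\<lambda>x. partial_deriv j \<phi> (- x)) x"
    using partial_deriv_reflect[OF smooth_differentiable[OF sm], of i x] by simp
  also have "\<dots> = partial_deriv i (\<lambda>x. (-1) * partial_deriv j \<phi> x) x"
    by (simp add: 1)
  also have "\<dots> = - partial_deriv i (partial_deriv j \<phi>) x"
    by (subst partial_deriv_mult) (auto intro!: smooth_differentiable sm)
  finally show ?thesis by simp
qed

text \<open>Outside the closed ball the function is locally zero; on the sphere the value follows by
  continuity along the outward ray. Including the sphere keeps the convention
  \<open>norm z \<ge> d\<close> of the mollifier.\<close>

lemma partial_deriv_zero_outside_ball:
  fixes f :: "real^'n::finite \<Rightarrow> real"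
  assumes f: "\<And>z. norm z \<ge> d \<Longrightarrow> f z = 0" and cont: "continuous_on UNIV (partial_deriv j f)" and z: "norm z \<ge> d"
  shows "partial_deriv j f z = 0"
proof -
  have out: "partial_deriv j f y = 0" if "norm y > d" for y
    using f that
    by (intro partial_deriv_zero_outside[of "cball 0 d"]) auto
  show ?thesis
  proof (cases "norm z > d")
    case False
    then have nz: "norm z = d" using z by simp
    show ?thesis
    proof (cases "z = 0")
      case True
      \<comment> \<open>There is no outward ray, but here \<open>d = 0\<close>, so \<open>f\<close>
        vanishes identically.\<close>
      then have "f = (\<lambda>_. 0)" using f nz by auto
      then show ?thesis by simp
    next
      case False
      have "((\<lambda>t. partial_deriv j f ((1 + t) *\<^sub>R z)) \<longlongrightarrow> partial_deriv j f ((1 + 0) *\<^sub>R z)) (at_right 0)"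
        using cont
        by (intro isCont_tendsto_compose[where g="partial_deriv j f"] tendsto_intros)
          (auto simp: continuous_on_eq_continuous_at)
      moreover have "((\<lambda>t. partial_deriv j f ((1 + t) *\<^sub>R z)) \<longlongrightarrow> 0) (at_right 0)"
      proof (rule tendsto_eventually, unfold eventually_at_right_field, intro exI[of _ 1] conjI allI impI)
        fix t :: real assume "0 < t" "t < 1"
        moreover have "d > 0" using nz False by (metis zero_less_norm_iff)
        ultimately have "norm ((1 + t) *\<^sub>R z) > d" using nz False by (simp add: algebra_simps del: scaleR_left.add scaleR_left_distrib)
        then show "partial_deriv j f ((1 + t) *\<^sub>R z) = 0" by (rule out)
      qed auto
      ultimately show ?thesis
        using tendsto_unique[of "at_right (0::real)"] by (metis add_0_right scaleR_one trivial_limit_at_right_real)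
    qed
  qed (rule out)
qed
text \<open>Integrating by parts twice removes an affine function, and the kernel does not reach
  beyond the ball of radius \<open>d\<close>. Mollified Hessians therefore vanish where
  \<open>u\<close> is affine at scale \<open>d\<close>.\<close>

lemma conv_second_deriv_affine:
  fixes x a :: "real^'n::finite"
  assumes \<phi>: "test_fun \<phi>" "\<And>z. norm z \<ge> d \<Longrightarrow> \<phi> z = 0" and u: "u \<in> borel_measurable borel"
    and aff: "AE y in lborel. y \<in> ball x d \<longrightarrow> u y = a \<bullet> y + b"
  shows "conv u (partial_deriv i (partial_deriv j \<phi>)) x = 0"
proof -
  let ?D = "partial_deriv i (partial_deriv j \<phi>)"
  have D: "test_fun ?D" by (intro test_fun_partial_deriv \<phi>)
  have supp: "?D z = 0" if "norm z \<ge> d" for z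
    using that \<phi>(2)
    by (intro partial_deriv_zero_outside_ball[where d = d] test_fun_continuous test_fun_partial_deriv \<phi>(1)) auto
  have affm: "(\<lambda>y. a \<bullet> y + b) \<in> borel_measurable (borel :: (real^'n) measure)"
    by (intro borel_measurable_continuous_onI continuous_intros)
  have "conv u ?D x = conv (\<lambda>y. a \<bullet> y + b) ?D x"
    by (rule conv_cong_ball[OF supp aff u affm test_fun_measurable[OF D]])
  also have "\<dots> = (LINT y|lborel. (a \<bullet> (x - y) + b) * ?D y)"
    unfolding conv_def using affm test_fun_measurable[OF D]
    by (subst lborel_integral_reflect[of _ x, symmetric]) auto
  also have "\<dots> = (LINT y|lborel. ((- a) \<bullet> y + (a \<bullet> x + b)) * ?D y)"
    by (simp add: inner_diff_right algebra_simps)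
  also have "\<dots> = 0"
  proof (rule integral_affine_second_deriv_eq_0[of _ "cball 0 d"])
    show "Ck 2 \<phi>" using test_fun_smooth[OF \<phi>(1)] by (simp add: smooth_def)
  qed (auto intro: \<phi>(2))
  finally show ?thesis .
qed

section \<open>The Hessian as a functional on test fields\<close>

lemma conv_commute:
  fixes u \<phi> :: "real^'n::finite \<Rightarrow> real"
  assumes [measurable]: "u \<in> borel_measurable borel" "\<phi> \<in> borel_measurable borel"
  shows "conv u \<phi> x = conv \<phi> u x"
proof -
  have "conv u \<phi> x = (LINT y|lborel. u (x - y) * \<phi> (x - (x - y)))"
    unfolding conv_def by (rule lborel_integral_reflect[symmetric]) measurable
  then show ?thesis by (simp add: conv_def mult.commute)
qed

text \<open>By commutativity either factor may be differentiated. With the derivative on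
  \<open>u\<close>, uniform convergence of mollifications applies to the derivatives of smooth
  fields.\<close>

lemma conv_partial_deriv_shift:
  assumes "test_fun u" "test_fun \<phi>"
  shows "conv u (partial_deriv i \<phi>) = conv (partial_deriv i u) \<phi>"
proof -
  note [measurable] = test_fun_measurable[OF assms(1)] test_fun_measurable[OF assms(2)]
    test_fun_measurable[OF test_fun_partial_deriv[OF assms(1)]]
  have "conv u (partial_deriv i \<phi>) = partial_deriv i (conv u \<phi>)"
    by (rule partial_deriv_conv[symmetric, OF test_fun_integrable assms(2)]) (rule assms)
  also have "conv u \<phi> = conv \<phi> u"
    by (intro ext conv_commute) measurable
  also have "partial_deriv i (conv \<phi> u) = conv \<phi> (partial_deriv i u)"
    by (rule partial_deriv_conv[OF test_fun_integrable assms(1)]) (rule assms)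
  also have "\<dots> = conv (partial_deriv i u) \<phi>"
    by (intro ext conv_commute) measurable
  finally show ?thesis .
qed

section \<open>Matrices of operator norm at most one\<close>

definition contraction :: "real^'n::finite^'n \<Rightarrow> bool" where
  "contraction M \<longleftrightarrow> (\<forall>v. norm (M *v v) \<le> norm v)"

lemma inner_matrix_vector:
  fixes M :: "real^'n::finite^'n"
  shows "w \<bullet> (M *v v) = (\<Sum>i\<in>UNIV. \<Sum>j\<in>UNIV. w $ i * M $ i $ j * v $ j)"
  by (simp add: inner_vec_def matrix_vector_mult_def sum_distrib_left mult.assoc)

text \<open>The bilinear form is linear in the matrix, so this version passes under integrals. For
  the converse, test with \<open>w = M *v v\<close>.\<close>

lemma contraction_iff_inner:
  "contraction M \<longleftrightarrow> (\<forall>v w. w \<bullet> (M *v v) \<le> norm w * norm v)"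
proof
  assume "contraction M"
  then show "\<forall>v w. w \<bullet> (M *v v) \<le> norm w * norm v"
    unfolding contraction_def
    by (meson mult_left_mono norm_cauchy_schwarz norm_ge_zero order_trans)
next
  assume *: "\<forall>v w. w \<bullet> (M *v v) \<le> norm w * norm v"
  show "contraction M"
    unfolding contraction_def
  proof
    fix v
    have "norm (M *v v) * norm (M *v v) \<le> norm (M *v v) * norm v"
      using *[rule_format, of "M *v v" v] by (simp add: power2_norm_eq_inner[symmetric] power2_eq_square)
    then show "norm (M *v v) \<le> norm v"
      by (cases "norm (M *v v) = 0") (auto simp: mult_le_cancel_left)
  qed
qed

lemma contraction_0 [simp]: "contraction 0"
  by (simp add: contraction_def)

lemma contraction_scaleR:
  fixes M :: "real^'n::finite^'n"
  assumes "contraction M" "\<bar>c\<bar> \<le> 1"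
  shows "contraction (c *\<^sub>R M)"
  unfolding contraction_def
proof
  fix v
  have "norm ((c *\<^sub>R M) *v v) = \<bar>c\<bar> * norm (M *v v)"
    by (simp add: scaleR_matrix_vector_assoc[symmetric])
  also have "\<dots> \<le> 1 * norm v"
    using assms unfolding contraction_def by (intro mult_mono) auto
  finally show "norm ((c *\<^sub>R M) *v v) \<le> norm v" by simp
qed

lemma contraction_convex_combination:
  fixes M N :: "real^'n::finite^'n"
  assumes "contraction M" "contraction N" "\<bar>a\<bar> + \<bar>b\<bar> \<le> 1"
  shows "contraction (a *\<^sub>R M + b *\<^sub>R N)"
  unfolding contraction_def
proof
  fix v
  have "norm ((a *\<^sub>R M + b *\<^sub>R N) *v v) = norm (a *\<^sub>R (M *v v) + b *\<^sub>R (N *v v))"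
    by (simp add: matrix_vector_mult_add_rdistrib scaleR_matrix_vector_assoc[symmetric])
  also have "\<dots> \<le> \<bar>a\<bar> * norm (M *v v) + \<bar>b\<bar> * norm (N *v v)"
    by (metis norm_scaleR norm_triangle_ineq)
  also have "\<dots> \<le> \<bar>a\<bar> * norm v + \<bar>b\<bar> * norm v"
    using assms unfolding contraction_def by (intro add_mono mult_left_mono) auto
  also have "\<dots> = (\<bar>a\<bar> + \<bar>b\<bar>) * norm v" by (simp add: algebra_simps)
  also have "\<dots> \<le> 1 * norm v" by (intro mult_right_mono assms) simp
  finally show "norm ((a *\<^sub>R M + b *\<^sub>R N) *v v) \<le> norm v" by simp
qed

lemma contraction_component_le:
  fixes M :: "real^'n::finite^'n"
  assumes "contraction M"
  shows "\<bar>M $ i $ j\<bar> \<le> 1"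
proof -
  have "\<bar>M $ i $ j\<bar> = \<bar>(M *v axis j 1) $ i\<bar>"
    by (simp add: matrix_vector_mult_basis column_def)
  also have "\<dots> \<le> norm (M *v axis j 1)" by (rule component_le_norm_cart)
  also have "\<dots> \<le> 1" using assms by (auto simp: contraction_def dest: spec[of _ "axis j 1"])
  finally show ?thesis .
qed

lemma contraction_outer:
  fixes a :: "real^'n::finite"
  assumes "norm a = 1"
  shows "contraction (\<chi> i j. a $ i * a $ j)"
proof -
  have "(\<chi> i j. a $ i * a $ j) *v v = (a \<bullet> v) *\<^sub>R a" for v
    by (simp add: vec_eq_iff matrix_vector_mult_def inner_vec_def sum_distrib_left sum_distrib_right algebra_simps)
  then show ?thesis
    using assms Cauchy_Schwarz_ineq2[of a] by (simp add: contraction_def)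
qed

lemma norm_axis': "norm (axis k a :: real^'n::finite) = \<bar>a\<bar>"
proof -
  have "axis k a = a *\<^sub>R (axis k 1 :: real^'n)" by (simp add: vec_eq_iff axis_def)
  then show ?thesis by simp
qed

lemma contraction_single_entry: "contraction ((\<chi> i j. if i = k \<and> j = l then 1 else 0) :: real^'n::finite^'n)"
proof -
  have "((\<chi> i j. if i = k \<and> j = l then 1 else 0) :: real^'n^'n) *v v = axis k (v $ l)" for v
    by (auto simp: vec_eq_iff matrix_vector_mult_def axis_def if_distrib[of "\<lambda>x. x * _"] cong: if_cong)
  then show ?thesis
    by (simp add: contraction_def component_le_norm_cart norm_axis')
qed

text \<open>Any compact subset of \<open>A\<close> off which the field vanishes does the work of the
  closed support; for sums and convolutions such a set is easy to name.\<close>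

lemma test_fields_iff:
  "F \<in> test_fields A \<longleftrightarrow> (\<forall>i j. smooth (\<lambda>x. F x $ i $ j)) \<and>
     (\<exists>K. compact K \<and> K \<subseteq> A \<and> (\<forall>x. x \<notin> K \<longrightarrow> F x = 0)) \<and> (\<forall>x. contraction (F x))"
proof -
  have "(\<exists>K. compact K \<and> K \<subseteq> A \<and> (\<forall>x. x \<notin> K \<longrightarrow> F x = 0))
     \<longleftrightarrow> compact (closure {x. F x \<noteq> 0}) \<and> closure {x. F x \<noteq> 0} \<subseteq> A"
  proof
    assume "\<exists>K. compact K \<and> K \<subseteq> A \<and> (\<forall>x. x \<notin> K \<longrightarrow> F x = 0)"
    then obtain K where K: "compact K" "K \<subseteq> A" "\<And>x. x \<notin> K \<Longrightarrow> F x = 0" by blast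
    have sub: "closure {x. F x \<noteq> 0} \<subseteq> K"
      using K by (intro closure_minimal compact_imp_closed) auto
    then have "closure {x. F x \<noteq> 0} = K \<inter> closure {x. F x \<noteq> 0}" by blast
    then have "compact (closure {x. F x \<noteq> 0})"
      using compact_Int_closed[OF K(1) closed_closure] by metis
    with sub K(2) show "compact (closure {x. F x \<noteq> 0}) \<and> closure {x. F x \<noteq> 0} \<subseteq> A" by blast
  next
    assume "compact (closure {x. F x \<noteq> 0}) \<and> closure {x. F x \<noteq> 0} \<subseteq> A"
    then show "\<exists>K. compact K \<and> K \<subseteq> A \<and> (\<forall>x. x \<notin> K \<longrightarrow> F x = 0)"
      using subsetD[OF closure_subset[of "{x. F x \<noteq> 0}"]] by (intro exI[of _ "closure {x. F x \<noteq> 0}"]) auto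
  qed
  then show ?thesis
    by (auto simp: test_fields_def schatten_infty_le_1_iff contraction_def)
qed

lemma test_fieldsI:
  assumes "\<And>i j. smooth (\<lambda>x. F x $ i $ j)" "compact K" "K \<subseteq> A" "\<And>x. x \<notin> K \<Longrightarrow> F x = 0"
    "\<And>x. contraction (F x)"
  shows "F \<in> test_fields A"
  using assms unfolding test_fields_iff by blast

lemma test_fieldsE:
  assumes "F \<in> test_fields A"
  obtains K where "compact K" "K \<subseteq> A" "\<forall>x. x \<notin> K \<longrightarrow> F x = 0"
  using assms unfolding test_fields_iff by blast

lemma test_fields_contraction: "F \<in> test_fields A \<Longrightarrow> contraction (F x)"
  unfolding test_fields_iff by blast

lemma test_fun_compact:
  assumes "smooth f" "compact K" "\<And>x. x \<notin> K \<Longrightarrow> f x = 0"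
  shows "test_fun f"
proof -
  obtain R where R: "\<And>x. x \<in> K \<Longrightarrow> norm x \<le> R"
    using compact_imp_bounded[OF assms(2)] by (auto simp: bounded_iff)
  have "f x = 0" if "norm x \<ge> R + 1" for x
    using assms(3)[of x] R[of x] that by force
  with assms(1) show ?thesis by (rule test_funI)
qed

lemma test_fields_test_fun:
  assumes "F \<in> test_fields A"
  shows "test_fun (\<lambda>x. F x $ i $ j)"
proof -
  obtain K where "compact K" "\<forall>x. x \<notin> K \<longrightarrow> F x = 0"
    using assms by (rule test_fieldsE)
  then show ?thesis
    using assms by (intro test_fun_compact[of _ K]) (auto simp: test_fields_iff)
qed

lemma test_fields_uminus:
  assumes F: "F \<in> test_fields A"
  shows "(\<lambda>x. - F x) \<in> test_fields A"
proof -
  obtain K where "compact K" "K \<subseteq> A" "\<forall>x. x \<notin> K \<longrightarrow> F x = 0"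
    using F by (rule test_fieldsE)
  moreover have "smooth (\<lambda>x. (- F x) $ i $ j)" for i j
    using smooth_cmult[OF test_fun_smooth[OF test_fields_test_fun[OF F]], of "-1" i j] by simp
  moreover have "contraction (- F x)" for x
    using contraction_scaleR[OF test_fields_contraction[OF F], of "-1"] by simp
  ultimately show ?thesis by (intro test_fieldsI[of _ K]) auto
qed

section \<open>The pairing of a function with a matrix field\<close>

definition hess_div :: "(real^'n::finite \<Rightarrow> real^'n^'n) \<Rightarrow> real^'n \<Rightarrow> real" where
  "hess_div F x = (\<Sum>i\<in>UNIV. \<Sum>j\<in>UNIV. partial_deriv i (partial_deriv j (\<lambda>y. F y $ i $ j)) x)"

definition hess_pairing :: "(real^'n::finite \<Rightarrow> real) \<Rightarrow> (real^'n \<Rightarrow> real^'n^'n) \<Rightarrow> real" where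
  "hess_pairing u F = (LINT x|lborel. u x * hess_div F x)"

lemma test_fun_add: "test_fun f \<Longrightarrow> test_fun g \<Longrightarrow> test_fun (\<lambda>x. f x + g x)"
proof -
  assume *: "test_fun f" "test_fun g"
  then obtain R S where R: "\<And>x. norm x \<ge> R \<Longrightarrow> f x = 0" and S: "\<And>x. norm x \<ge> S \<Longrightarrow> g x = 0"
    by (metis test_fun_def)
  show ?thesis
    by (rule test_funI[of _ "max R S"]) (use * R S in \<open>auto intro: smooth_add test_fun_smooth\<close>)
qed

lemma test_fun_0: "test_fun (\<lambda>_. 0)"
  by (rule test_funI[of _ 0]) (auto simp: smooth_const)

lemma test_fun_sum: "(\<And>i. i \<in> I \<Longrightarrow> test_fun (f i)) \<Longrightarrow> test_fun (\<lambda>x. \<Sum>i\<in>I. f i x)"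
  by (induction I rule: infinite_finite_induct) (auto simp: test_fun_add test_fun_0)

definition test_matrix :: "(real^'n::finite \<Rightarrow> real^'n^'n) \<Rightarrow> bool" where
  "test_matrix F \<longleftrightarrow> (\<forall>i j. test_fun (\<lambda>x. F x $ i $ j))"

lemma test_matrixD: "test_matrix F \<Longrightarrow> test_fun (\<lambda>x. F x $ i $ j)"
  by (simp add: test_matrix_def)

lemma test_fields_test_matrix: "F \<in> test_fields A \<Longrightarrow> test_matrix F"
  by (simp add: test_matrix_def test_fields_test_fun)

lemma test_fun_hess_div: "test_matrix F \<Longrightarrow> test_fun (hess_div F)"
  unfolding hess_div_def[abs_def] test_matrix_def by (intro test_fun_sum test_fun_partial_deriv) blast

lemma integrable_hess_pairing:
  "integrable lborel u \<Longrightarrow> test_matrix F \<Longrightarrow> integrable lborel (\<lambda>x. u x * hess_div F x)"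
  by (intro integrable_mult_test_fun test_fun_hess_div)

lemma hess_div_add:
  assumes "test_matrix F" "test_matrix G"
  shows "hess_div (\<lambda>x. F x + G x) x = hess_div F x + hess_div G x"
proof -
  have "partial_deriv j (\<lambda>x. F x $ k $ l + G x $ k $ l) = (\<lambda>x. partial_deriv j (\<lambda>x. F x $ k $ l) x + partial_deriv j (\<lambda>x. G x $ k $ l) x)" for j k l
    by (intro ext partial_deriv_add test_fun_differentiable test_matrixD assms)
  moreover have "partial_deriv i (\<lambda>x. partial_deriv j (\<lambda>x. F x $ k $ l) x + partial_deriv j (\<lambda>x. G x $ k $ l) x) x
      = partial_deriv i (partial_deriv j (\<lambda>x. F x $ k $ l)) x + partial_deriv i (partial_deriv j (\<lambda>x. G x $ k $ l)) x" for i j k l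
    by (intro partial_deriv_add test_fun_differentiable test_fun_partial_deriv test_matrixD assms)
  ultimately show ?thesis by (simp add: hess_div_def sum.distrib)
qed

lemma partial_deriv_cmult:
  fixes f :: "real^'n::finite \<Rightarrow> real"
  assumes "f differentiable (at x)"
  shows "partial_deriv i (\<lambda>x. c * f x) x = c * partial_deriv i f x"
  using partial_deriv_mult[of "\<lambda>_. c" x f i] assms by simp

lemma hess_div_scaleR:
  assumes "test_matrix F"
  shows "hess_div (\<lambda>x. c *\<^sub>R F x) x = c * hess_div F x"
proof -
  have "partial_deriv j (\<lambda>x. c * F x $ k $ l) = (\<lambda>x. c * partial_deriv j (\<lambda>x. F x $ k $ l) x)" for j k l
    by (intro ext partial_deriv_cmult test_fun_differentiable test_matrixD assms)
  moreover have "partial_deriv i (\<lambda>x. c * partial_deriv j (\<lambda>x. F x $ k $ l) x) x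
      = c * partial_deriv i (partial_deriv j (\<lambda>x. F x $ k $ l)) x" for i j k l
    by (intro partial_deriv_cmult test_fun_differentiable test_fun_partial_deriv test_matrixD assms)
  ultimately show ?thesis by (simp add: hess_div_def sum_distrib_left)
qed

lemma hess_pairing_add_field:
  "integrable lborel u \<Longrightarrow> test_matrix F \<Longrightarrow> test_matrix G
    \<Longrightarrow> hess_pairing u (\<lambda>x. F x + G x) = hess_pairing u F + hess_pairing u G"
  by (simp add: hess_pairing_def hess_div_add distrib_left integrable_hess_pairing)

lemma hess_pairing_scaleR_field:
  "test_matrix F \<Longrightarrow> hess_pairing u (\<lambda>x. c *\<^sub>R F x) = c * hess_pairing u F"
  by (simp add: hess_pairing_def hess_div_scaleR mult.left_commute)

lemma hess_pairing_uminus_field: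
  "test_matrix F \<Longrightarrow> hess_pairing u (\<lambda>x. - F x) = - hess_pairing u F"
  using hess_pairing_scaleR_field[of F u "-1"] by simp

lemma hess_pairing_add_left:
  "integrable lborel u \<Longrightarrow> integrable lborel v \<Longrightarrow> test_matrix F
    \<Longrightarrow> hess_pairing (\<lambda>x. u x + v x) F = hess_pairing u F + hess_pairing v F"
  by (simp add: hess_pairing_def distrib_right integrable_hess_pairing)

lemma hess_pairing_cmult_left:
  "hess_pairing (\<lambda>x. c * u x) F = c * hess_pairing u F"
  by (simp add: hess_pairing_def mult.assoc)

text \<open>The second derivatives of a field vanish off its support, so the integral over
  \<open>A\<close> extends to the whole space; for a Borel function the completed measure gives the
  same integral as \<open>lborel\<close>.\<close>

lemma hessian_variation_eq:
  assumes u: "u \<in> borel_measurable borel"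
  shows "hessian_variation u A = (SUP F\<in>test_fields A. ereal (hess_pairing u F))"
  unfolding hessian_variation_def
proof (intro SUP_cong refl arg_cong[where f = ereal])
  fix F assume F: "F \<in> test_fields A"
  obtain K where K: "compact K" "K \<subseteq> A" "\<forall>x. x \<notin> K \<longrightarrow> F x = 0"
    using F by (rule test_fieldsE)
  have out: "partial_deriv i (partial_deriv j (\<lambda>y. F y $ i $ j)) x = 0" if "x \<notin> A" for x i j
  proof -
    have "closed K" using K by (simp add: compact_imp_closed)
    then show ?thesis using K that
      by (intro partial_deriv_zero_outside[of K]) auto
  qed
  have "(LINT x:A|lebesgue. \<Sum>i\<in>UNIV. \<Sum>j\<in>UNIV. u x * partial_deriv i (partial_deriv j (\<lambda>y. F y $ i $ j)) x)
      = (LINT x|lebesgue. u x * hess_div F x)"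
    unfolding set_lebesgue_integral_def
  proof (rule Bochner_Integration.integral_cong[OF refl])
    fix x
    show "indicator A x *\<^sub>R (\<Sum>i\<in>UNIV. \<Sum>j\<in>UNIV. u x * partial_deriv i (partial_deriv j (\<lambda>y. F y $ i $ j)) x)
        = u x * hess_div F x"
      by (cases "x \<in> A") (auto simp: hess_div_def sum_distrib_left out)
  qed
  also have "\<dots> = hess_pairing u F"
    unfolding hess_pairing_def
    using u test_fun_measurable[OF test_fun_hess_div[OF test_fields_test_matrix[OF F]]]
    by (intro integral_completion) auto
  finally show "(LINT x:A|lebesgue. \<Sum>i\<in>UNIV. \<Sum>j\<in>UNIV. u x * partial_deriv i (partial_deriv j (\<lambda>y. F y $ i $ j)) x)
      = hess_pairing u F" .
qed

lemma hess_pairing_le_variation: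
  assumes "u \<in> borel_measurable borel" "hessian_variation u A \<le> ereal V" "F \<in> test_fields A"
  shows "hess_pairing u F \<le> V"
proof -
  have "ereal (hess_pairing u F) \<le> hessian_variation u A"
    unfolding hessian_variation_eq[OF assms(1)] by (rule SUP_upper[OF assms(3)])
  with assms(2) show ?thesis by (metis ereal_less_eq(3) order_trans)
qed

section \<open>Mollified fields\<close>

definition conv_field :: "(real^'n::finite \<Rightarrow> real^'n^'n) \<Rightarrow> (real^'n \<Rightarrow> real) \<Rightarrow> real^'n \<Rightarrow> real^'n^'n" where
  "conv_field M \<phi> x = (\<chi> i j. conv (\<lambda>y. M y $ i $ j) \<phi> x)"

text \<open>The Hessian of \<open>conv u (mollifier d)\<close>, with both derivatives put on the
  kernel so that the formula makes sense for merely integrable \<open>u\<close>.\<close>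

definition moll_hess :: "real \<Rightarrow> (real^'n::finite \<Rightarrow> real) \<Rightarrow> real^'n \<Rightarrow> real^'n^'n" where
  "moll_hess d u y = (\<chi> i j. conv u (partial_deriv i (partial_deriv j (mollifier d))) y)"

lemma matrix_component_measurable:
  fixes M :: "real^'n::finite \<Rightarrow> real^'n^'n"
  assumes "M \<in> borel_measurable borel"
  shows "(\<lambda>x. M x $ i $ j) \<in> borel_measurable borel"
proof -
  have "(\<lambda>N::real^'n^'n. N $ i $ j) \<in> borel_measurable borel"
    by (intro borel_measurable_continuous_onI continuous_intros)
  from measurable_compose[OF assms this] show ?thesis .
qed

lemma matrix_measurableI:
  fixes M :: "real^'n::finite \<Rightarrow> real^'n^'n"
  assumes "\<And>i j. (\<lambda>x. M x $ i $ j) \<in> borel_measurable borel"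
  shows "M \<in> borel_measurable borel"
proof -
  have swap: "(\<Sum>l\<in>UNIV. if k then g l else 0) = (if k then \<Sum>l\<in>UNIV. g l else (0::real))" for k and g :: "'n \<Rightarrow> real"
    by simp
  have "M x = (\<Sum>i\<in>UNIV. \<Sum>j\<in>UNIV. M x $ i $ j *\<^sub>R axis i (axis j 1))" for x
    by (simp add: vec_eq_iff axis_def if_distrib[of "\<lambda>x. _ * x"] if_distrib[of "\<lambda>v. v $ _"] swap cong: if_cong)
  then have "M = (\<lambda>x. \<Sum>i\<in>UNIV. \<Sum>j\<in>UNIV. M x $ i $ j *\<^sub>R axis i (axis j 1))" by blast
  also have "\<dots> \<in> borel_measurable borel"
    by (intro borel_measurable_sum borel_measurable_scaleR assms) auto
  finally show ?thesis .
qed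

lemma integrable_bounded_compact_support:
  fixes f :: "real^'n::finite \<Rightarrow> real"
  assumes "f \<in> borel_measurable borel" "\<And>x. \<bar>f x\<bar> \<le> B" "compact K" "\<And>x. x \<notin> K \<Longrightarrow> f x = 0"
  shows "integrable lborel f"
proof (rule Bochner_Integration.integrable_bound)
  show "integrable lborel (\<lambda>x. B * indicator K x)"
    by (intro integrable_mult_right integrable_real_indicator)
      (use emeasure_bounded_finite[OF compact_imp_bounded[OF assms(3)]] compact_imp_closed[OF assms(3)] in auto)
  have "norm (f x) \<le> norm (B * indicator K x)" for x
    using assms(2)[of x] assms(4)[of x] by (cases "x \<in> K") auto
  then show "AE x in lborel. norm (f x) \<le> norm (B * indicator K x)" by simp
qed (use assms in auto)

lemma integral_sum2:
  fixes f :: "'i::finite \<Rightarrow> 'j::finite \<Rightarrow> 'a \<Rightarrow> real"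
  assumes "\<And>i j. integrable M (f i j)"
  shows "(LINT x|M. (\<Sum>i\<in>UNIV. \<Sum>j\<in>UNIV. f i j x)) = (\<Sum>i\<in>UNIV. \<Sum>j\<in>UNIV. (LINT x|M. f i j x))"
proof -
  have "(LINT x|M. (\<Sum>i\<in>UNIV. \<Sum>j\<in>UNIV. f i j x)) = (\<Sum>i\<in>UNIV. (LINT x|M. (\<Sum>j\<in>UNIV. f i j x)))"
    by (rule Bochner_Integration.integral_sum) (intro Bochner_Integration.integrable_sum assms)
  also have "\<dots> = (\<Sum>i\<in>UNIV. \<Sum>j\<in>UNIV. (LINT x|M. f i j x))"
    by (intro sum.cong refl Bochner_Integration.integral_sum assms)
  finally show ?thesis .
qed

text \<open>A field assembled from a pointwise proportionality factor is only Borel. Together with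
  the norm bound and compact support this suffices for its mollification to be an admissible test
  field.\<close>

locale bounded_field =
  fixes M :: "real^'n::finite \<Rightarrow> real^'n^'n" and K :: "(real^'n) set"
  assumes measurable: "M \<in> borel_measurable borel"
    and contraction: "contraction (M x)"
    and compact: "compact K"
    and support: "x \<notin> K \<Longrightarrow> M x = 0"
begin

lemma component_integrable: "integrable lborel (\<lambda>x. M x $ i $ j)"
  by (rule integrable_bounded_compact_support[OF matrix_component_measurable[OF measurable]
        contraction_component_le[OF contraction] compact]) (simp add: support)

text \<open>Matrices of norm at most one form a convex set and a mollification is an average; the
  bilinear form reduces this to a scalar integral estimate.\<close>

lemma contraction_conv_field:
  assumes d: "d > 0"
  shows "contraction (conv_field M (mollifier d) x)"
  unfolding contraction_iff_inner
proof (intro allI)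
  fix v w :: "real^'n"
  let ?m = "\<lambda>y. mollifier d (x - y)"
  have int: "integrable lborel (\<lambda>y. M y $ i $ j * ?m y)" for i j
    by (rule integrable_conv_integrand[OF component_integrable test_fun_mollifier[OF d]])
  have int2: "integrable lborel (\<lambda>y. w $ i * (M y $ i $ j * ?m y) * v $ j)" for i j
    by (intro integrable_mult_left integrable_mult_right int)
  have eq: "(w \<bullet> (M y *v v)) * ?m y = (\<Sum>i\<in>UNIV. \<Sum>j\<in>UNIV. w $ i * (M y $ i $ j * ?m y) * v $ j)" for y
    unfolding inner_matrix_vector sum_distrib_right by (intro sum.cong refl) (simp add: mult_ac)
  have "w \<bullet> (conv_field M (mollifier d) x *v v)
      = (\<Sum>i\<in>UNIV. \<Sum>j\<in>UNIV. (LINT y|lborel. w $ i * (M y $ i $ j * ?m y) * v $ j))"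
    unfolding inner_matrix_vector conv_field_def conv_def by simp
  also have "\<dots> = (LINT y|lborel. (w \<bullet> (M y *v v)) * ?m y)"
    unfolding eq by (rule integral_sum2[OF int2, symmetric])
  also have "\<dots> \<le> (LINT y|lborel. norm w * norm v * ?m y)"
  proof (rule integral_mono)
    show "integrable lborel (\<lambda>y. (w \<bullet> (M y *v v)) * ?m y)"
      unfolding eq by (intro Bochner_Integration.integrable_sum int2)
    show "integrable lborel (\<lambda>y. norm w * norm v * ?m y)"
      by (intro integrable_mult_right integrable_mollifier_diff d)
    show "(w \<bullet> (M y *v v)) * ?m y \<le> norm w * norm v * ?m y" for y
      using contraction[of y] mollifier_nonneg[OF d] unfolding contraction_iff_inner
      by (intro mult_right_mono) auto
  qed
  also have "\<dots> = norm w * norm v"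
    by (simp add: integral_mollifier_diff[OF d])
  finally show "w \<bullet> (conv_field M (mollifier d) x *v v) \<le> norm w * norm v" .
qed

lemma conv_field_test_fields:
  assumes d: "d > 0" and A: "\<And>x. x \<in> K \<Longrightarrow> cball x d \<subseteq> A"
  shows "conv_field M (mollifier d) \<in> test_fields A"
proof (rule test_fieldsI)
  let ?K = "{x + y |x y. x \<in> K \<and> y \<in> cball 0 d}"
  show "smooth (\<lambda>x. conv_field M (mollifier d) x $ i $ j)" for i j
    using smooth_conv[OF component_integrable test_fun_mollifier[OF d], of i j]
    by (simp add: conv_field_def)
  show "compact ?K" by (intro compact_sums compact compact_cball)
  show "?K \<subseteq> A"
  proof
    fix z assume "z \<in> ?K"
    then obtain x y where "z = x + y" "x \<in> K" "y \<in> cball 0 d" by blast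
    then have "z \<in> cball x d" by (simp add: dist_norm)
    with A[OF \<open>x \<in> K\<close>] show "z \<in> A" by blast
  qed
  show "conv_field M (mollifier d) x = 0" if x: "x \<notin> ?K" for x
  proof -
    have "M y = 0" if "dist x y < d" for y
    proof (rule support, rule notI)
      assume "y \<in> K"
      moreover have "x = y + (x - y)" "x - y \<in> cball 0 d" using that by (auto simp: dist_norm norm_minus_commute)
      ultimately show False using x by blast
    qed
    then have "conv (\<lambda>y. M y $ i $ j) (mollifier d) x = 0" for i j
      by (intro conv_eq_0[of d]) (auto simp: mollifier_eq_0[OF d])
    then show ?thesis by (simp add: conv_field_def vec_eq_iff)
  qed
qed (rule contraction_conv_field[OF d])

text \<open>Both derivatives fall on the kernel, whose second derivatives are again even, so
  adjointness moves the convolution to \<open>u\<close>. No derivative of \<open>M\<close> remains,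
  which is why rough fields may be tested against \<open>moll_hess\<close>.\<close>

lemma hess_pairing_conv_field:
  assumes u: "integrable lborel u" and d: "d > 0"
  shows "integrable lborel (\<lambda>y. M y \<bullet> moll_hess d u y)"
    and "hess_pairing u (conv_field M (mollifier d)) = (LINT y|lborel. M y \<bullet> moll_hess d u y)"
proof -
  let ?D = "\<lambda>i j. partial_deriv i (partial_deriv j (mollifier d :: real^'n \<Rightarrow> real))"
  have D: "test_fun (?D i j)" for i j
    by (intro test_fun_partial_deriv test_fun_mollifier d)
  have Deven: "?D i j (- x) = ?D i j x" for i j x
    by (rule partial_deriv2_even[OF smooth_mollifier mollifier_even])
  have dm: "partial_deriv i (partial_deriv j (\<lambda>x. conv_field M (mollifier d) x $ i $ j))
      = conv (\<lambda>y. M y $ i $ j) (?D i j)" for i j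
    by (simp add: conv_field_def partial_deriv_conv component_integrable test_fun_mollifier d
        test_fun_partial_deriv)
  obtain B where B: "\<And>i j x. \<bar>?D i j x\<bar> \<le> B i j"
    using test_fun_bounded[OF D] by metis
  have cb: "\<bar>conv v (?D i j) x\<bar> \<le> (LINT y|lborel. \<bar>v y\<bar>) * B i j" if v: "integrable lborel v" for v i j x
  proof -
    have "\<bar>conv v (?D i j) x\<bar> \<le> (LINT y|lborel. \<bar>v y * ?D i j (x - y)\<bar>)"
      unfolding conv_def by (rule integral_abs_bound)
    also have "\<dots> \<le> (LINT y|lborel. \<bar>v y\<bar> * B i j)"
    proof (rule integral_mono)
      show "integrable lborel (\<lambda>y. \<bar>v y * ?D i j (x - y)\<bar>)"
        by (rule integrable_abs[OF integrable_conv_integrand[OF v D]])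
      show "\<bar>v y * ?D i j (x - y)\<bar> \<le> \<bar>v y\<bar> * B i j" for y
        unfolding abs_mult by (rule mult_left_mono[OF B]) simp
    qed (use v in simp)
    finally show ?thesis by simp
  qed
  have sm: "conv v (?D i j) \<in> borel_measurable borel" if "integrable lborel v" for v i j
    by (rule borel_measurable_continuous_onI[OF smooth_continuous[OF smooth_conv[OF that D]]])
  have int1: "integrable lborel (\<lambda>x. u x * conv (\<lambda>y. M y $ i $ j) (?D i j) x)" for i j
    by (rule integrable_mult_bounded[OF u sm[OF component_integrable] cb[OF component_integrable]])
  have int2: "integrable lborel (\<lambda>x. M x $ i $ j * conv u (?D i j) x)" for i j
    by (rule integrable_mult_bounded[OF component_integrable sm[OF u] cb[OF u]])
  have eq: "M y \<bullet> moll_hess d u y = (\<Sum>i\<in>UNIV. \<Sum>j\<in>UNIV. M y $ i $ j * conv u (?D i j) y)" for y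
    by (simp add: inner_vec_def moll_hess_def)
  show "integrable lborel (\<lambda>y. M y \<bullet> moll_hess d u y)"
    unfolding eq by (intro Bochner_Integration.integrable_sum int2)
  have "hess_pairing u (conv_field M (mollifier d))
      = (LINT x|lborel. (\<Sum>i\<in>UNIV. \<Sum>j\<in>UNIV. u x * conv (\<lambda>y. M y $ i $ j) (?D i j) x))"
    by (simp add: hess_pairing_def hess_div_def dm sum_distrib_left)
  also have "\<dots> = (\<Sum>i\<in>UNIV. \<Sum>j\<in>UNIV. (LINT x|lborel. u x * conv (\<lambda>y. M y $ i $ j) (?D i j) x))"
    by (rule integral_sum2[OF int1])
  also have "\<dots> = (\<Sum>i\<in>UNIV. \<Sum>j\<in>UNIV. (LINT x|lborel. M x $ i $ j * conv u (?D i j) x))"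
    by (intro sum.cong refl conv_adjoint u component_integrable D Deven)
  also have "\<dots> = (LINT y|lborel. M y \<bullet> moll_hess d u y)"
    unfolding eq by (rule integral_sum2[OF int2, symmetric])
  finally show "hess_pairing u (conv_field M (mollifier d)) = (LINT y|lborel. M y \<bullet> moll_hess d u y)" .
qed

lemma integral_moll_hess_le:
  assumes u: "integrable lborel u" and d: "d > 0" and A: "\<And>x. x \<in> K \<Longrightarrow> cball x d \<subseteq> A"
    and V: "hessian_variation u A \<le> ereal V"
  shows "(LINT y|lborel. M y \<bullet> moll_hess d u y) \<le> V"
  unfolding hess_pairing_conv_field(2)[OF u d, symmetric]
  using u by (intro hess_pairing_le_variation[OF _ V conv_field_test_fields[OF d A]]) auto

end

lemma test_fields_bounded_field:
  assumes F: "F \<in> test_fields A" and K: "compact K" "\<And>x. x \<notin> K \<Longrightarrow> F x = 0"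
  shows "bounded_field F K"
proof
  show "F \<in> borel_measurable borel"
    by (intro matrix_measurableI test_fun_measurable test_fields_test_fun[OF F])
qed (use K test_fields_contraction[OF F] in auto)

text \<open>Mollifications of a smooth field converge uniformly together with their second
  derivatives, and \<open>u\<close> is integrable. Estimates for mollified Hessians thus yield
  estimates for the pairing itself.\<close>

lemma hess_pairing_eq_limit:
  assumes u: "integrable lborel u" and F: "F \<in> test_fields A" and e: "e > 0"
  obtains d0 where "d0 > 0"
    "\<And>d. 0 < d \<Longrightarrow> d < d0 \<Longrightarrow> \<bar>(LINT y|lborel. F y \<bullet> moll_hess d u y) - hess_pairing u F\<bar> \<le> e"
proof -
  obtain K where K: "compact K" "\<forall>x. x \<notin> K \<longrightarrow> F x = 0"
    using F by (rule test_fieldsE)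
  interpret bounded_field F K using K by (intro test_fields_bounded_field[OF F]) auto
  let ?D = "\<lambda>i j. partial_deriv i (partial_deriv j (\<lambda>x. F x $ i $ j))"
  let ?I = "LINT x|lborel. \<bar>u x\<bar>"
  let ?n = "real CARD('a)"
  \<comment> \<open>One share for each of the \<open>n^2\<close> matrix entries, divided by the L1
    norm of \<open>u\<close>; the added 1 covers a vanishing \<open>u\<close>.\<close>
  define e' where "e' = e / ((?I + 1) * ?n\<^sup>2)"
  have I: "?I \<ge> 0" by simp
  have n: "?n > 0" by simp
  have e': "e' > 0" using e I n by (simp add: e'_def add_nonneg_pos)
  have D: "test_fun (?D i j)" for i j
    by (intro test_fun_partial_deriv test_fields_test_fun[OF F])
  have "\<exists>d0>0. \<forall>d x. 0 < d \<and> d < d0 \<longrightarrow> \<bar>conv (?D i j) (mollifier d) x - ?D i j x\<bar> \<le> e'" for i j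
    using conv_mollifier_tendsto_uniform[OF D e'] by metis
  then obtain d1 where d1: "\<And>i j. d1 i j > 0"
    "\<And>i j d x. 0 < d \<Longrightarrow> d < d1 i j \<Longrightarrow> \<bar>conv (?D i j) (mollifier d) x - ?D i j x\<bar> \<le> e'" by metis
  define d0 where "d0 = Min (range (\<lambda>(i, j). d1 i j))"
  have d0: "d0 > 0" "\<And>i j. d0 \<le> d1 i j"
    unfolding d0_def using d1(1) by (auto intro!: Min_le)
  show ?thesis
  proof (rule that[OF d0(1)])
    fix d assume d: "0 < d" "d < d0"
    have dd: "partial_deriv i (partial_deriv j (\<lambda>x. conv_field F (mollifier d) x $ i $ j)) x
        = conv (?D i j) (mollifier d) x" for i j x
      using conv_partial_deriv_shift[OF test_fields_test_fun[OF F] test_fun_mollifier[OF d(1)]]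
        conv_partial_deriv_shift[OF test_fun_partial_deriv[OF test_fields_test_fun[OF F]] test_fun_mollifier[OF d(1)]]
      by (simp add: conv_field_def partial_deriv_conv component_integrable test_fun_mollifier d
          test_fun_partial_deriv test_fun_integrable test_fields_test_fun[OF F])
    have "conv_field F (mollifier d) \<in> test_fields UNIV"
      by (rule conv_field_test_fields[OF d(1)]) auto
    then have tm: "test_matrix (conv_field F (mollifier d))" by (rule test_fields_test_matrix)
    have close: "\<bar>hess_div (conv_field F (mollifier d)) x - hess_div F x\<bar> \<le> ?n\<^sup>2 * e'" for x
    proof -
      have "hess_div (conv_field F (mollifier d)) x - hess_div F x
          = (\<Sum>i\<in>UNIV. \<Sum>j\<in>UNIV. conv (?D i j) (mollifier d) x - ?D i j x)"
        by (simp add: hess_div_def dd sum_subtractf)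
      also have "norm \<dots> \<le> (\<Sum>i\<in>(UNIV::'a set). \<Sum>j\<in>(UNIV::'a set). e')"
        using d d0(2) by (intro sum_norm_le) (auto intro!: d1(2) intro: less_le_trans)
      finally show ?thesis by (simp add: power2_eq_square mult.assoc)
    qed
    have "(LINT y|lborel. F y \<bullet> moll_hess d u y) - hess_pairing u F
        = hess_pairing u (conv_field F (mollifier d)) - hess_pairing u F"
      by (simp add: hess_pairing_conv_field(2)[OF u d(1)])
    also have "\<dots> = (LINT x|lborel. u x * (hess_div (conv_field F (mollifier d)) x - hess_div F x))"
      unfolding hess_pairing_def right_diff_distrib
      by (rule Bochner_Integration.integral_diff[symmetric])
        (intro integrable_hess_pairing u tm test_fields_test_matrix[OF F])+
    finally have eq: "(LINT y|lborel. F y \<bullet> moll_hess d u y) - hess_pairing u F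
        = (LINT x|lborel. u x * (hess_div (conv_field F (mollifier d)) x - hess_div F x))" .
    have "\<bar>(LINT y|lborel. F y \<bullet> moll_hess d u y) - hess_pairing u F\<bar>
        \<le> (LINT x|lborel. \<bar>u x * (hess_div (conv_field F (mollifier d)) x - hess_div F x)\<bar>)"
      unfolding eq by (rule integral_abs_bound)
    also have "\<dots> \<le> (LINT x|lborel. \<bar>u x\<bar> * (?n\<^sup>2 * e'))"
    proof (rule integral_mono)
      show "integrable lborel (\<lambda>x. \<bar>u x * (hess_div (conv_field F (mollifier d)) x - hess_div F x)\<bar>)"
        unfolding right_diff_distrib
        by (intro integrable_abs Bochner_Integration.integrable_diff integrable_hess_pairing u tm test_fields_test_matrix[OF F])
      show "\<bar>u x * (hess_div (conv_field F (mollifier d)) x - hess_div F x)\<bar> \<le> \<bar>u x\<bar> * (?n\<^sup>2 * e')" for x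
        unfolding abs_mult by (rule mult_left_mono[OF close]) simp
    qed (use u in simp)
    also have "\<dots> = ?I * (?n\<^sup>2 * e')" by simp
    also have "\<dots> \<le> (?I + 1) * (?n\<^sup>2 * e')" using e' by (intro mult_right_mono) auto
    also have "\<dots> = e" using I n by (simp add: e'_def add_nonneg_eq_0_iff)
    finally show "\<bar>(LINT y|lborel. F y \<bullet> moll_hess d u y) - hess_pairing u F\<bar> \<le> e" .
  qed
qed

section \<open>Functions with vanishing Hessian\<close>

text \<open>\<open>ennreal\<close> truncates at 0, so the two densities are the positive and the
  negative part of \<open>v\<close>. Their measures agree on boxes, an intersection-stable
  generator, hence everywhere, and densities are unique almost everywhere.\<close>

lemma AE_eq_0_of_box_integrals:
  fixes v :: "'a::euclidean_space \<Rightarrow> real"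
  assumes v: "integrable lborel v" and box: "\<And>a b. (LINT x|lborel. v x * indicator (box a b) x) = 0"
  shows "AE x in lborel. v x = 0"
proof -
  have [measurable]: "v \<in> borel_measurable lborel" using v by simp
  let ?M = "density lborel (\<lambda>x. ennreal (v x))" and ?N = "density lborel (\<lambda>x. ennreal (- v x))"
  have eq: "emeasure ?M (box a b) = emeasure ?N (box a b)" for a b
  proof -
    let ?p = "\<lambda>x. max 0 (v x * indicator (box a b) x)" and ?q = "\<lambda>x. max 0 (- (v x * indicator (box a b) x))"
    have int: "integrable lborel (\<lambda>x. v x * indicator (box a b) x)"
      using v by (rule integrable_real_mult_indicator[rotated]) simp
    then have pq: "integrable lborel ?p" "integrable lborel ?q"
      by (intro integrable_max integrable_zero integrable_minus; simp)+
    have "(LINT x|lborel. ?p x) - (LINT x|lborel. ?q x) = (LINT x|lborel. v x * indicator (box a b) x)"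
      by (subst Bochner_Integration.integral_diff[OF pq, symmetric]) (intro Bochner_Integration.integral_cong refl, auto simp: max_def)
    then have "(LINT x|lborel. ?p x) = (LINT x|lborel. ?q x)" using box by simp
    moreover have "emeasure ?M (box a b) = ennreal (LINT x|lborel. ?p x)"
      by (subst emeasure_density, simp, simp, subst nn_integral_eq_integral[OF pq(1), symmetric])
        (auto intro!: nn_integral_cong simp: indicator_def max_def ennreal_neg)
    moreover have "emeasure ?N (box a b) = ennreal (LINT x|lborel. ?q x)"
      by (subst emeasure_density, simp, simp, subst nn_integral_eq_integral[OF pq(2), symmetric])
        (auto intro!: nn_integral_cong simp: indicator_def max_def ennreal_neg)
    ultimately show ?thesis by simp
  qed
  have fin: "emeasure ?M (box a b) \<noteq> \<infinity>" for a b
  proof -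
    have "emeasure ?M (box a b) \<le> emeasure ?M (space ?M)" by (rule emeasure_space)
    also have "\<dots> \<le> (\<integral>\<^sup>+x. norm (v x) \<partial>lborel)"
      by (subst emeasure_density) (auto intro!: nn_integral_mono ennreal_leI)
    also have "\<dots> < \<infinity>" using v by (simp add: integrable_iff_bounded)
    finally show ?thesis by simp
  qed
  let ?E = "range (\<lambda>(a, b). box a b :: 'a set)"
  have "?M = ?N"
  proof (rule measure_eqI_generator_eq[of ?E UNIV, where A = "\<lambda>n::nat. box (- (real n *\<^sub>R One)) (real n *\<^sub>R One)"])
    show "Int_stable ?E" by (auto simp: Int_stable_def box_Int_box)
    show "sets ?M = sigma_sets UNIV ?E" "sets ?N = sigma_sets UNIV ?E"
      by (simp_all add: borel_eq_box)
    show "(\<Union>n::nat. box (- (real n *\<^sub>R One)) (real n *\<^sub>R One)) = (UNIV :: 'a set)"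
      by (rule UN_box_eq_UNIV)
  qed (use eq fin in auto)
  then have "AE x in lborel. ennreal (v x) = ennreal (- v x)"
    by (intro sigma_finite_measure.density_unique[OF sigma_finite_lborel]) auto
  \<comment> \<open>At each point one of \<open>v x\<close> and \<open>- v x\<close> is nonpositive,
    so the common truncated value is 0.\<close>
  then show ?thesis
    by (rule AE_mp) (intro AE_I2 impI, metis ennreal_eq_0_iff linorder_le_cases neg_le_0_iff_le order_antisym)
qed

section \<open>Smoothed indicator functions\<close>

lemma conv_indicator_bounds:
  fixes P :: "(real^'n::finite) set"
  assumes P: "P \<in> sets borel" "bounded P" and d: "d > 0"
  shows "0 \<le> conv (indicator P) (mollifier d) x" "conv (indicator P) (mollifier d) x \<le> 1"
proof -
  have int: "integrable lborel (indicator P :: real^'n \<Rightarrow> real)"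
    using P emeasure_bounded_finite[OF P(2)] by (intro integrable_real_indicator) auto
  \<comment> \<open>The values 0 and 1 both lie at distance 1/2 from 1/2, which gives both bounds at
    once.\<close>
  have "\<bar>conv (indicator P) (mollifier d) x - 1/2\<bar> \<le> 1/2"
    by (rule conv_mollifier_close[OF d int]) (auto simp: indicator_def)
  then show "0 \<le> conv (indicator P) (mollifier d) x" "conv (indicator P) (mollifier d) x \<le> 1"
    by linarith+
qed

lemma conv_indicator_eq:
  fixes P :: "(real^'n::finite) set"
  assumes P: "P \<in> sets borel" "bounded P" and d: "d > 0" and c: "\<And>y. dist x y < d \<Longrightarrow> indicator P y = c"
  shows "conv (indicator P) (mollifier d) x = c"
proof -
  have int: "integrable lborel (indicator P :: real^'n \<Rightarrow> real)"
    using P emeasure_bounded_finite[OF P(2)] by (intro integrable_real_indicator) auto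
  have "\<bar>conv (indicator P) (mollifier d) x - c\<bar> \<le> 0"
    by (rule conv_mollifier_close[OF d int]) (auto simp: c)
  then show ?thesis by simp
qed

lemma smooth_conv_indicator:
  fixes P :: "(real^'n::finite) set"
  assumes P: "P \<in> sets borel" "bounded P" and d: "d > 0"
  shows "smooth (conv (indicator P) (mollifier d))"
  using P emeasure_bounded_finite[OF P(2)]
  by (intro smooth_conv integrable_real_indicator test_fun_mollifier d) auto

text \<open>Off the frontier an indicator is locally constant, so its mollification eventually
  equals it; the frontier is null and \<open>|u|\<close> dominates.\<close>

lemma integral_conv_indicator_tendsto:
  fixes u :: "real^'n::finite \<Rightarrow> real"
  assumes u: "integrable lborel u" and P: "P \<in> sets borel" "bounded P" "emeasure lborel (frontier P) = 0"
    and d: "\<And>k. d k > 0" "d \<longlonglongrightarrow> 0"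
  shows "(\<lambda>k. LINT x|lborel. u x * conv (indicator P) (mollifier (d k)) x)
    \<longlonglongrightarrow> (LINT x|lborel. u x * indicator P x)"
proof (rule integral_dominated_convergence[where w = "\<lambda>x. \<bar>u x\<bar>"])
  show "integrable lborel (\<lambda>x. \<bar>u x\<bar>)" using u by simp
  show "(\<lambda>x. u x * indicator P x) \<in> borel_measurable lborel"
    using u P(1) by auto
  show "(\<lambda>x. u x * conv (indicator P) (mollifier (d k)) x) \<in> borel_measurable lborel" for k
    using u borel_measurable_continuous_onI[OF smooth_continuous[OF smooth_conv_indicator[OF P(1,2) d(1)]]]
    by (intro borel_measurable_times) auto
  show "AE x in lborel. norm (u x * conv (indicator P) (mollifier (d k)) x) \<le> \<bar>u x\<bar>" for k
    using conv_indicator_bounds[OF P(1,2) d(1)]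
    by (intro AE_I2) (simp add: abs_mult mult_left_le)
  have "frontier P \<in> null_sets lborel"
    using P(3) frontier_closed by (auto intro!: null_setsI)
  then have "AE x in lborel. x \<notin> frontier P" by (rule AE_not_in)
  then show "AE x in lborel. (\<lambda>k. u x * conv (indicator P) (mollifier (d k)) x) \<longlonglongrightarrow> u x * indicator P x"
  proof (rule AE_mp, intro AE_I2 impI)
    fix x assume x: "x \<notin> frontier P"
    have "\<exists>e>0. \<forall>y. dist x y < e \<longrightarrow> indicator P y = (indicator P x :: real)"
    proof (cases "x \<in> interior P")
      case True
      then obtain e where "e > 0" "ball x e \<subseteq> P" by (auto simp: mem_interior)
      then show ?thesis using True interior_subset[of P]
        by (intro exI[of _ e]) (auto simp: indicator_def subset_iff)
    next
      case False
      then have "x \<notin> closure P" using x by (simp add: frontier_def)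
      then obtain e where "e > 0" "ball x e \<subseteq> - closure P"
        using open_contains_ball[of "- closure P"] by auto
      then show ?thesis using closure_subset[of P] \<open>x \<notin> closure P\<close>
        by (intro exI[of _ e]) (auto simp: indicator_def subset_iff)
    qed
    then obtain e where e: "e > 0" "\<And>y. dist x y < e \<Longrightarrow> indicator P y = (indicator P x :: real)" by blast
    have "\<forall>\<^sub>F k in sequentially. d k < e"
      using order_tendstoD(2)[OF d(2) e(1)] .
    then have "\<forall>\<^sub>F k in sequentially. u x * conv (indicator P) (mollifier (d k)) x = u x * indicator P x"
    proof (rule eventually_mono)
      fix k assume "d k < e"
      then show "u x * conv (indicator P) (mollifier (d k)) x = u x * indicator P x"
        using e(2) by (subst conv_indicator_eq[OF P(1,2) d(1)[of k], where c = "indicator P x"]) auto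
    qed
    then show "(\<lambda>k. u x * conv (indicator P) (mollifier (d k)) x) \<longlonglongrightarrow> u x * indicator P x"
      by (rule tendsto_eventually)
  qed
qed

lemma emeasure_frontier_convex:
  fixes P :: "'a::euclidean_space set"
  assumes "convex P"
  shows "emeasure lborel (frontier P) = 0"
proof -
  have "frontier P \<in> null_sets lebesgue"
    using negligible_convex_frontier[OF assms] by (simp add: negligible_iff_null_sets)
  then show ?thesis
    by (subst (asm) null_sets_completion_iff) auto
qed

lemma constant_of_zero_partial_derivs:
  fixes f :: "real^'n::finite \<Rightarrow> real"
  assumes f: "\<And>x. f differentiable (at x)" and S: "convex S" "open S" "\<And>x i. x \<in> S \<Longrightarrow> partial_deriv i f x = 0"
  obtains c where "\<And>x. x \<in> S \<Longrightarrow> f x = c"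
proof -
  have "\<exists>c. \<forall>x\<in>S. f x = c"
  proof (rule has_derivative_zero_constant[OF S(1)])
    fix x assume "x \<in> S"
    then have "(f has_derivative (\<lambda>v. \<Sum>i\<in>UNIV. v $ i * 0)) (at x)"
      using has_derivative_partial_deriv[OF f, of x] S(3) by simp
    then show "(f has_derivative (\<lambda>h. 0)) (at x within S)"
      by (simp add: has_derivative_at_withinI)
  qed
  then show ?thesis using that by blast
qed

lemma affine_of_zero_second_partial_derivs:
  fixes f :: "real^'n::finite \<Rightarrow> real"
  assumes f: "smooth f" and S: "convex S" "open S" "\<And>x i j. x \<in> S \<Longrightarrow> partial_deriv i (partial_deriv j f) x = 0"
  obtains a b where "\<And>x. x \<in> S \<Longrightarrow> f x = a \<bullet> x + b"
proof -
  have "\<exists>c. \<forall>x\<in>S. partial_deriv j f x = c" for j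
    using constant_of_zero_partial_derivs[OF smooth_differentiable[OF smooth_partial_deriv[OF f]] S] by metis
  then obtain c where c: "\<And>j x. x \<in> S \<Longrightarrow> partial_deriv j f x = c j" by metis
  define a where "a = (\<chi> j. c j)"
  have ax: "smooth (\<lambda>x. a \<bullet> x)"
    unfolding inner_vec_def inner_real_def by (intro smooth_sum smooth_cmult smooth_coord)
  have pa: "partial_deriv j (\<lambda>x. (-1) * (a \<bullet> x)) x = - c j" for j x
  proof -
    have "((\<lambda>x. (-1) * (a \<bullet> x)) has_derivative (\<lambda>v. (-1) * (a \<bullet> v))) (at x)"
      by (auto intro!: derivative_eq_intros)
    from partial_deriv_eqI[OF this, of j] show ?thesis by (simp add: inner_axis a_def)
  qed
  have sm: "smooth (\<lambda>x. (-1) * (a \<bullet> x))" by (rule smooth_cmult[OF ax])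
  have "partial_deriv j (\<lambda>x. f x + (-1) * (a \<bullet> x)) x = 0" if "x \<in> S" for j x
    using partial_deriv_add[OF smooth_differentiable[OF f] smooth_differentiable[OF sm], of j x]
    unfolding pa c[OF that] by simp
  then obtain b where "\<And>x. x \<in> S \<Longrightarrow> f x + (-1) * (a \<bullet> x) = b"
    using constant_of_zero_partial_derivs[OF smooth_differentiable[OF smooth_add[OF f sm]] S(1,2)] by metis
  then show ?thesis by (intro that[of a b]) (simp add: algebra_simps eq_diff_eq)
qed

lemma sum_if_out: "(\<Sum>x\<in>A. if c then f x else 0) = (if c then \<Sum>x\<in>A. f x else 0)"
  by simp

lemma hess_pairing_single_entry:
  fixes \<psi> :: "real^'n::finite \<Rightarrow> real"
  shows "hess_pairing u (\<lambda>z. \<psi> z *\<^sub>R ((\<chi> i j. if i = k \<and> j = l then 1 else 0) :: real^'n^'n))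
    = (LINT z|lborel. u z * partial_deriv k (partial_deriv l \<psi>) z)"
proof -
  have "partial_deriv i (partial_deriv j (\<lambda>y. (\<psi> y *\<^sub>R ((\<chi> i j. if i = k \<and> j = l then 1 else 0) :: real^'n^'n)) $ i $ j)) x
     = (if i = k then if j = l then partial_deriv k (partial_deriv l \<psi>) x else 0 else 0)" for i j x
    by (cases "i = k"; cases "j = l") simp_all
  then show ?thesis
    by (simp add: hess_pairing_def hess_div_def if_distrib[of "\<lambda>x. _ * x"] sum_if_out)
qed

text \<open>Up to a factor, this entry of the mollified Hessian is the pairing of \<open>u\<close>
  with a translated mollifier placed in a single matrix entry. Scaling by a bound of the mollifier
  makes that field admissible.\<close>

lemma conv_second_deriv_eq_0:
  fixes u :: "real^'n::finite \<Rightarrow> real"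
  assumes L0: "\<And>F. F \<in> test_fields U \<Longrightarrow> hess_pairing u F = 0" and d: "d > 0" and y: "cball y d \<subseteq> U"
  shows "conv u (partial_deriv i (partial_deriv j (mollifier d))) y = 0"
proof -
  let ?m = "mollifier d :: real^'n \<Rightarrow> real"
  let ?E = "(\<chi> k l. if k = i \<and> l = j then 1 else 0) :: real^'n^'n"
  obtain B where B: "B \<ge> 0" "\<And>x. \<bar>?m x\<bar> \<le> B"
    using test_fun_bounded[OF test_fun_mollifier[OF d]] by metis
  define c where "c = 1 / (B + 1)"
  have c: "c > 0" using B(1) by (simp add: c_def)
  define \<psi> where "\<psi> z = c * ?m (z + (- y))" for z
  have sm: "smooth (\<lambda>z. ?m (z + (- y)))" by (rule smooth_translate[OF smooth_mollifier])
  have "(\<lambda>z. \<psi> z *\<^sub>R ?E) \<in> test_fields U"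
  proof (rule test_fieldsI[of _ "cball y d"])
    show "smooth (\<lambda>z. (\<psi> z *\<^sub>R ?E) $ k $ l)" for k l
      using smooth_cmult[OF smooth_cmult[OF sm, of c], of "?E $ k $ l"] by (simp add: \<psi>_def mult_ac)
    show "\<psi> z *\<^sub>R ?E = 0" if "z \<notin> cball y d" for z
      using that mollifier_eq_0[OF d, of "z - y"] by (simp add: \<psi>_def dist_norm norm_minus_commute)
    have "\<bar>\<psi> z\<bar> \<le> 1" for z
      using B(2)[of "z + (- y)"] B(1) by (simp add: \<psi>_def c_def abs_mult field_simps)
    then show "contraction (\<psi> z *\<^sub>R ?E)" for z
      by (intro contraction_scaleR contraction_single_entry)
  qed (use y in auto)
  from L0[OF this] have 0: "(LINT z|lborel. u z * partial_deriv i (partial_deriv j \<psi>) z) = 0"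
    by (simp only: hess_pairing_single_entry)
  have "partial_deriv j \<psi> = (\<lambda>z. c * partial_deriv j ?m (z + (- y)))"
  proof
    fix z
    have "partial_deriv j \<psi> z = c * partial_deriv j (\<lambda>z. ?m (z + (- y))) z"
      unfolding \<psi>_def by (rule partial_deriv_cmult[OF smooth_differentiable[OF sm]])
    also have "partial_deriv j (\<lambda>z. ?m (z + (- y))) z = partial_deriv j ?m (z + (- y))"
      using partial_deriv_affine_comp[OF smooth_differentiable[OF smooth_mollifier], where c = 1 and x = z and v = "- y" and i = j] by simp
    finally show "partial_deriv j \<psi> z = c * partial_deriv j ?m (z + (- y))" .
  qed
  then have "partial_deriv i (partial_deriv j \<psi>) z = c * partial_deriv i (partial_deriv j ?m) (y - z)" for z
  proof -
    have sm': "smooth (\<lambda>z. partial_deriv j ?m (z + (- y)))"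
      by (rule smooth_translate[OF smooth_partial_deriv[OF smooth_mollifier]])
    assume "partial_deriv j \<psi> = (\<lambda>z. c * partial_deriv j ?m (z + (- y)))"
    then have "partial_deriv i (partial_deriv j \<psi>) z = c * partial_deriv i (\<lambda>z. partial_deriv j ?m (z + (- y))) z"
      by (simp only: partial_deriv_cmult[OF smooth_differentiable[OF sm']])
    also have "partial_deriv i (\<lambda>z. partial_deriv j ?m (z + (- y))) z = partial_deriv i (partial_deriv j ?m) (z + (- y))"
      using partial_deriv_affine_comp[OF smooth_differentiable[OF smooth_partial_deriv[OF smooth_mollifier]], where c = 1 and x = z and v = "- y" and i = i] by simp
    also have "\<dots> = partial_deriv i (partial_deriv j ?m) (y - z)"
      using partial_deriv2_even[OF smooth_mollifier mollifier_even, of i j _ "y - z"] by simp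
    finally show ?thesis .
  qed
  with 0 have "c * conv u (partial_deriv i (partial_deriv j ?m)) y = 0"
    by (simp add: conv_def mult.left_commute)
  with c show ?thesis by simp
qed

text \<open>All mollifications of \<open>u\<close> at small scales are affine near \<open>x\<close>. An affine function is reproduced
  by an even mollifier and mollifications commute, so they all coincide there, hence with \<open>u\<close>.\<close>

lemma affine_of_zero_hessian:
  fixes u :: "real^'n::finite \<Rightarrow> real"
  assumes u: "integrable lborel u" and U: "open U" "x \<in> U"
    and L0: "\<And>F. F \<in> test_fields U \<Longrightarrow> hess_pairing u F = 0"
  obtains r a b where "r > 0" "AE y in lborel. y \<in> ball x r \<longrightarrow> u y = a \<bullet> y + b"
proof -
  obtain r' where r': "r' > 0" "ball x r' \<subseteq> U" using U by (auto simp: open_contains_ball)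
  \<comment> \<open>Room for mollifying twice at scales up to \<open>r\<close> around points of
    \<open>ball x r\<close>: \<open>w e\<close> is affine on \<open>ball x (3 * r)\<close>, and
    computing its Hessian there reaches into \<open>ball x (4 * r)\<close>.\<close>
  define r where "r = r' / 4"
  have r: "r > 0" "ball x (4 * r) \<subseteq> U" using r' by (auto simp: r_def)
  define w where "w e = conv u (mollifier e)" for e
  have um: "u \<in> borel_measurable borel" using u by simp
  have smw: "smooth (w e)" if "e > 0" for e
    unfolding w_def by (rule smooth_conv[OF u test_fun_mollifier[OF that]])
  have wm: "w e \<in> borel_measurable borel" if "e > 0" for e
    by (rule borel_measurable_continuous_onI[OF smooth_continuous[OF smw[OF that]]])
  have aff: "\<exists>a b. \<forall>y\<in>ball x (3 * r). w e y = a \<bullet> y + b" if e: "0 < e" "e \<le> r" for e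
  proof -
    have "partial_deriv i (partial_deriv j (w e)) y = 0" if y: "y \<in> ball x (3 * r)" for i j y
    proof -
      have "cball y e \<subseteq> ball x (4 * r)"
        using y e r(1) by (intro cball_subset_ball_iff[THEN iffD2]) (auto simp: dist_commute)
      then have "cball y e \<subseteq> U" using r(2) by blast
      then have "conv u (partial_deriv i (partial_deriv j (mollifier e))) y = 0"
        by (intro conv_second_deriv_eq_0[where U = U] L0 e(1))
      then show ?thesis
        by (simp add: w_def partial_deriv_conv u test_fun_mollifier e test_fun_partial_deriv)
    qed
    from affine_of_zero_second_partial_derivs[OF smw[OF e(1)] convex_ball open_ball this]
    show ?thesis by metis
  qed
  have same: "w e y = w r y" if e: "0 < e" "e \<le> r" and y: "y \<in> ball x r" for e y
  proof -
    have K: "conv (w e) (mollifier d) y = w e y" if ed: "0 < e" "e \<le> r" "0 < d" "d \<le> r" for e d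
    proof -
      obtain a b where ab: "\<forall>y\<in>ball x (3 * r). w e y = a \<bullet> y + b" using aff[OF ed(1,2)] by blast
      have sub: "z \<in> ball x (3 * r)" if "z \<in> ball y d" for z
        using that y \<open>d \<le> r\<close> r(1) dist_triangle[of x z y] by (auto simp: dist_commute)
      have "conv (w e) (mollifier d) y = a \<bullet> y + b"
        using ab sub by (intro conv_mollifier_affine[OF \<open>0 < d\<close> wm[OF \<open>0 < e\<close>]]) auto
      moreover have "y \<in> ball x (3 * r)" using y r(1) by auto
      ultimately show ?thesis using ab by simp
    qed
    \<comment> \<open>Mollifying the locally affine \<open>w e\<close> again changes nothing; after
      the exchange of scales the same holds for \<open>w r\<close>.\<close>
    have "w e y = conv (w e) (mollifier r) y" by (rule K[symmetric]) (use e r in auto)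
    also have "\<dots> = conv (w r) (mollifier e) y"
      unfolding conv_def[of "w _"] unfolding w_def
      by (rule conv_conv_commute[OF u test_fun_mollifier[OF e(1)] mollifier_even test_fun_mollifier[OF r(1)] mollifier_even])
    also have "\<dots> = w r y" by (rule K) (use e r in auto)
    finally show ?thesis .
  qed
  obtain a b where ab: "\<And>y. y \<in> ball x (3 * r) \<Longrightarrow> w r y = a \<bullet> y + b"
    using aff[OF r(1)] by blast
  obtain c d where cd: "x \<in> box c d" "box c d \<subseteq> ball x r"
    using open_contains_box[OF open_ball, of x x r] centre_in_ball[of x r] r(1) by metis
  let ?v = "\<lambda>y. (w r y - u y) * indicator (box c d) y"
  have iw: "integrable lborel (\<lambda>y. w r y * indicator P y)" if P: "bounded P" "P \<in> sets borel" "P \<subseteq> ball x r" for P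
  proof (rule integrable_bounded_compact_support[of _ "norm a * (norm x + r) + \<bar>b\<bar>" "cball x r"])
    show "(\<lambda>y. w r y * indicator P y) \<in> borel_measurable borel" using wm[OF r(1)] P by auto
    show "\<bar>w r y * indicator P y\<bar> \<le> norm a * (norm x + r) + \<bar>b\<bar>" for y
    proof (cases "y \<in> P")
      case True
      then have y: "y \<in> ball x r" using P by auto
      then have "norm y \<le> norm x + r" using norm_triangle_ineq2[of y x] by (simp add: dist_norm norm_minus_commute)
      then have "\<bar>a \<bullet> y\<bar> \<le> norm a * (norm x + r)"
        by (meson Cauchy_Schwarz_ineq2 mult_left_mono norm_ge_zero order_trans)
      moreover have "w r y = a \<bullet> y + b" using ab y r(1) by auto
      ultimately show ?thesis using True by simp
    qed (use r(1) in simp)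
    show "w r y * indicator P y = 0" if "y \<notin> cball x r" for y
      using that P(3) by (auto simp: indicator_def)
  qed simp
  have iu: "integrable lborel (\<lambda>y. u y * indicator P y)" if "P \<in> sets borel" for P
    using integrable_real_mult_indicator[OF _ u] that by simp
  \<comment> \<open>By adjointness the smoothed indicator of a box turns into a mollification of
    \<open>u\<close>, which is \<open>w r\<close> on the box at every small scale; in the limit
    \<open>u\<close> itself is left on the other side.\<close>
  have eq_box: "(LINT y|lborel. w r y * indicator P y) = (LINT y|lborel. u y * indicator P y)"
    if P: "P = box p q" "P \<subseteq> ball x r" for P p q
  proof -
    define e where "e k = r / (real k + 1)" for k :: nat
    have e: "0 < e k" "e k \<le> r" for k using r(1) by (auto simp: e_def field_simps)
    have e0: "e \<longlonglongrightarrow> 0" unfolding e_def using tendsto_mult_right_zero[OF LIMSEQ_inverse_real_of_nat, of r] by (simp add: divide_inverse add.commute)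
    have Pb: "P \<in> sets borel" "bounded P" by (auto simp: P)
    have fr: "emeasure lborel (frontier P) = 0"
      by (rule emeasure_frontier_convex) (simp add: P)
    have "(LINT y|lborel. u y * conv (indicator P) (mollifier (e k)) y) = (LINT y|lborel. w r y * indicator P y)" for k
    proof -
      have "(LINT y|lborel. u y * conv (indicator P) (mollifier (e k)) y)
          = (LINT y|lborel. indicator P y * conv u (mollifier (e k)) y)"
        using Pb emeasure_bounded_finite[OF Pb(2)]
        by (intro conv_adjoint u test_fun_mollifier e mollifier_even integrable_real_indicator) auto
      also have "\<dots> = (LINT y|lborel. w r y * indicator P y)"
        using same[OF e] P(2) by (intro Bochner_Integration.integral_cong refl) (auto simp: indicator_def w_def)
      finally show ?thesis .
    qed
    then show ?thesis
      using integral_conv_indicator_tendsto[OF u Pb fr e(1) e0] by (simp add: LIMSEQ_const_iff)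
  qed
  have cdm: "box c d \<in> sets borel" "bounded (box c d)" by auto
  have vint: "integrable lborel ?v"
    using iw[OF cdm(2,1) cd(2)] iu[OF cdm(1)] by (simp add: left_diff_distrib)
  have "AE y in lborel. ?v y = 0"
  proof (rule AE_eq_0_of_box_integrals[OF vint])
    fix p q :: "real^'n"
    obtain p' q' where pq: "box c d \<inter> box p q = box p' q'" by (auto simp: box_Int_box)
    let ?P = "box c d \<inter> box p q"
    have sub: "?P \<subseteq> ball x r" using cd(2) by blast
    have meas: "?P \<in> sets borel" "bounded ?P" by (auto intro: bounded_Int)
    have "(LINT y|lborel. ?v y * indicator (box p q) y)
        = (LINT y|lborel. w r y * indicator ?P y - u y * indicator ?P y)"
      by (intro Bochner_Integration.integral_cong refl) (auto simp: indicator_def)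
    also have "\<dots> = 0"
      using iw[OF meas(2,1) sub] iu[OF meas(1)] eq_box[OF pq sub] by simp
    finally show "(LINT y|lborel. ?v y * indicator (box p q) y) = 0" .
  qed
  moreover obtain s where s: "s > 0" "ball x s \<subseteq> box c d"
    using open_contains_ball[of "box c d"] cd(1) open_box by blast
  ultimately have "AE y in lborel. y \<in> ball x s \<longrightarrow> u y = a \<bullet> y + b"
  proof (elim AE_mp, intro AE_I2 impI)
    fix y assume y: "?v y = 0" "y \<in> ball x s"
    then have "y \<in> box c d" "y \<in> ball x (3 * r)" using s cd(2) r(1) by force+
    then show "u y = a \<bullet> y + b" using y ab by auto
  qed
  with s(1) show ?thesis by (rule that)
qed

section \<open>Second differences and the absence of jumps\<close>

lemma lborel_integral_translate:
  fixes f :: "'a::euclidean_space \<Rightarrow> real"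
  assumes [measurable]: "f \<in> borel_measurable borel"
  shows "(LINT x|lborel. f (x + v)) = (LINT x|lborel. f x)"
proof -
  have "(LINT x|lborel. f x) = (LINT x|distr lborel borel ((+) v). f x)"
    by (simp add: lborel_distr_plus)
  also have "\<dots> = (LINT x|lborel. f (v + x))" by (subst integral_distr) auto
  finally show ?thesis by (simp add: add.commute)
qed

lemma lborel_integrable_translate:
  fixes f :: "'a::euclidean_space \<Rightarrow> real"
  assumes f: "integrable lborel f"
  shows "integrable lborel (\<lambda>x. f (x + v))"
proof -
  have "integrable (distr lborel borel ((+) v)) f" using f by (simp add: lborel_distr_plus)
  then have "integrable lborel (\<lambda>x. f (v + x))" by (subst (asm) integrable_distr_eq) (use f in auto)
  then show ?thesis by (simp add: add.commute)
qed

lemma AE_lborel_translate: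
  fixes P :: "'a::euclidean_space \<Rightarrow> bool"
  assumes "AE x in lborel. P x"
  shows "AE x in lborel. P (x + v)"
proof -
  obtain N where N: "{x. \<not> P x} \<subseteq> N" "N \<in> null_sets lborel"
    using assms by (auto elim!: AE_E simp: null_sets_def)
  have "AE x in distr lborel borel ((+) v). x \<notin> N"
    unfolding lborel_distr_plus by (rule AE_not_in[OF N(2)])
  then have "AE x in lborel. v + x \<notin> N"
    using N(2) by (subst (asm) AE_distr_iff) (auto simp: null_sets_def)
  then show ?thesis
    using N(1) by (elim AE_mp) (auto intro!: AE_I2 simp: add.commute)
qed

text \<open>The mean value theorem for both first differences and then for the first derivative; the
  intermediate points are less than \<open>2 * t\<close> apart, hence the constant 2.\<close>

lemma second_difference_le:
  fixes W :: "real^'n::finite \<Rightarrow> real" and a :: "real^'n"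
  assumes W: "smooth W" and t: "t \<ge> 0"
    and V: "\<And>s. 0 \<le> s \<Longrightarrow> s \<le> 2 * t \<Longrightarrow>
      \<bar>\<Sum>i\<in>UNIV. \<Sum>j\<in>UNIV. a $ i * a $ j * partial_deriv i (partial_deriv j W) (s *\<^sub>R a)\<bar> \<le> V"
  shows "\<bar>W ((2 * t) *\<^sub>R a) - 2 * W (t *\<^sub>R a) + W 0\<bar> \<le> 2 * V * t\<^sup>2"
proof (cases "t = 0")
  case False
  then have t: "t > 0" using t by simp
  have der: "((\<lambda>s. f (s *\<^sub>R a)) has_real_derivative (\<Sum>i\<in>UNIV. a $ i * partial_deriv i f (s *\<^sub>R a))) (at s)"
    if f: "smooth f" for f :: "real^'n \<Rightarrow> real" and s
  proof -
    have "((\<lambda>s. s *\<^sub>R a) has_derivative (\<lambda>h. h *\<^sub>R a)) (at s)"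
      by (auto intro!: derivative_eq_intros)
    from has_derivative_compose[OF this has_derivative_partial_deriv[OF smooth_differentiable[OF f]]]
    have "((\<lambda>s. f (s *\<^sub>R a)) has_derivative (\<lambda>h. \<Sum>i\<in>UNIV. (h *\<^sub>R a) $ i * partial_deriv i f (s *\<^sub>R a))) (at s)" .
    moreover have "(\<lambda>h. \<Sum>i\<in>UNIV. (h *\<^sub>R a) $ i * partial_deriv i f (s *\<^sub>R a)) = (*) (\<Sum>i\<in>UNIV. a $ i * partial_deriv i f (s *\<^sub>R a))"
      by (auto simp: fun_eq_iff sum_distrib_right intro!: sum.cong)
    ultimately show ?thesis by (simp add: has_field_derivative_def)
  qed
  define q' where "q' s = (\<Sum>i\<in>UNIV. a $ i * partial_deriv i W (s *\<^sub>R a))" for s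
  define q'' where "q'' s = (\<Sum>j\<in>UNIV. a $ j * (\<Sum>i\<in>UNIV. a $ i * partial_deriv i (partial_deriv j W) (s *\<^sub>R a)))" for s
  have d1: "((\<lambda>s. W (s *\<^sub>R a)) has_real_derivative q' s) (at s)" for s
    unfolding q'_def by (rule der[OF W])
  have d2: "(q' has_real_derivative q'' s) (at s)" for s
    unfolding q'_def[abs_def] q''_def
    by (intro DERIV_sum DERIV_cmult der smooth_partial_deriv W)
  have q'': "\<bar>q'' s\<bar> \<le> V" if "0 \<le> s" "s \<le> 2 * t" for s
  proof -
    have "q'' s = (\<Sum>i\<in>UNIV. \<Sum>j\<in>UNIV. a $ i * a $ j * partial_deriv i (partial_deriv j W) (s *\<^sub>R a))"
      unfolding q''_def sum_distrib_left by (subst sum.swap) (simp add: mult_ac)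
    then show ?thesis using V[OF that] by simp
  qed
  obtain z1 where z1: "t < z1" "z1 < 2 * t" "W ((2 * t) *\<^sub>R a) - W (t *\<^sub>R a) = (2 * t - t) * q' z1"
    using MVT2[of t "2 * t" "\<lambda>s. W (s *\<^sub>R a)" q'] t d1 by auto
  obtain z2 where z2: "0 < z2" "z2 < t" "W (t *\<^sub>R a) - W (0 *\<^sub>R a) = (t - 0) * q' z2"
    using MVT2[of 0 t "\<lambda>s. W (s *\<^sub>R a)" q'] t d1 by auto
  obtain z3 where z3: "z2 < z3" "z3 < z1" "q' z1 - q' z2 = (z1 - z2) * q'' z3"
    using MVT2[of z2 z1 q' q''] z1 z2 d2 by auto
  have "W ((2 * t) *\<^sub>R a) - 2 * W (t *\<^sub>R a) + W 0 = t * ((z1 - z2) * q'' z3)"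
    using z1(3) z2(3) unfolding z3(3)[symmetric] by (simp add: algebra_simps)
  also have "\<bar>\<dots>\<bar> \<le> t * ((2 * t) * V)"
    unfolding abs_mult using z1 z2 z3 t q''[of z3] by (intro mult_mono) auto
  finally show ?thesis by (simp add: power2_eq_square algebra_simps)
qed simp

text \<open>The integral is a second difference in \<open>s\<close> of the integral of
  \<open>u (z + s a)\<close> against the indicator of \<open>P\<close>. For a smoothed indicator
  \<open>\<psi>\<close>, the second derivative in \<open>s\<close> pairs \<open>u\<close> with a
  translate of \<open>\<psi>\<close> times \<open>a a^T\<close>, an admissible field, and is
  therefore bounded by \<open>V\<close>.\<close>

lemma integral_second_difference_le:
  fixes u :: "real^'n::finite \<Rightarrow> real"
  assumes u: "integrable lborel u" and V: "hessian_variation u U \<le> ereal V"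
    and a: "norm a = 1" and t: "t \<ge> 0" and P: "P \<in> sets borel" "bounded P" "convex P"
    and e: "e > 0" "\<And>x s. x \<in> P \<Longrightarrow> 0 \<le> s \<Longrightarrow> s \<le> 2 * t \<Longrightarrow> cball (x + s *\<^sub>R a) e \<subseteq> U"
  shows "\<bar>LINT z|lborel. (u (z + (2 * t) *\<^sub>R a) - 2 * u (z + t *\<^sub>R a) + u z) * indicator P z\<bar> \<le> 2 * V * t\<^sup>2"
proof -
  define d where "d k = (e / 2) * inverse (real (Suc k))" for k :: nat
  have d: "0 < d k" "d k \<le> e / 2" for k using e(1) by (auto simp: d_def field_simps)
  have d0: "d \<longlonglongrightarrow> 0"
    unfolding d_def by (rule tendsto_mult_right_zero[OF LIMSEQ_inverse_real_of_nat])
  define \<psi> where "\<psi> k = conv (indicator P) (mollifier (d k))" for k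
  define q where "q k s = (LINT z|lborel. u (z + s *\<^sub>R a) * \<psi> k z)" for k s
  have cl: "compact (closure P)" using P(2) by simp
  define K where "K k = {x + y |x y. x \<in> closure P \<and> y \<in> cball 0 (d k)}" for k
  have K: "compact (K k)" for k unfolding K_def by (intro compact_sums cl compact_cball)
  have \<psi>0: "\<psi> k z = 0" if "z \<notin> K k" for k z
    unfolding \<psi>_def
  proof (rule conv_eq_0[of "d k"])
    show "mollifier (d k) z = 0" if "norm z \<ge> d k" for z :: "real^'n" using that by (rule mollifier_eq_0[OF d(1)])
    fix y assume y: "dist z y < d k"
    show "indicator P y = (0::real)"
    proof (rule ccontr)
      assume "indicator P y \<noteq> (0::real)"
      then have "y \<in> closure P" using closure_subset[of P] by (auto simp: indicator_def split: if_splits)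
      moreover have "z - y \<in> cball 0 (d k)" using y by (simp add: dist_norm norm_minus_commute)
      ultimately have "y + (z - y) \<in> K k" unfolding K_def by blast
      with that show False by simp
    qed
  qed
  have sm: "smooth (\<psi> k)" for k unfolding \<psi>_def by (rule smooth_conv_indicator[OF P(1,2) d(1)])
  have tf: "test_fun (\<psi> k)" for k by (rule test_fun_compact[OF sm K \<psi>0])
  have um: "u \<in> borel_measurable borel" using u by simp
  have bound: "\<bar>q k (2 * t) - 2 * q k t + q k 0\<bar> \<le> 2 * V * t\<^sup>2" for k
  proof -
    \<comment> \<open>The reflection turns the correlation integral \<open>q\<close> into a
      convolution evaluated at \<open>s *\<^sub>R a\<close>.\<close>
    define \<eta> where "\<eta> x = \<psi> k ((-1) *\<^sub>R x + 0)" for x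
    have \<eta>s: "smooth \<eta>" unfolding \<eta>_def by (rule smooth_affine_comp[OF sm])
    have \<eta>: "test_fun \<eta>"
    proof -
      obtain R where "\<forall>x. x \<notin> cball 0 R \<longrightarrow> \<psi> k x = 0" using test_fun_support[OF tf] by blast
      then show ?thesis by (intro test_funI[OF \<eta>s, of "R + 1"]) (auto simp: \<eta>_def)
    qed
    have q: "q k s = conv u \<eta> (s *\<^sub>R a)" for s
    proof -
      have "q k s = (LINT z|lborel. u (z + s *\<^sub>R a) * \<psi> k ((z + s *\<^sub>R a) - s *\<^sub>R a))" by (simp add: q_def)
      also have "\<dots> = (LINT z|lborel. u z * \<psi> k (z - s *\<^sub>R a))"
      proof (rule lborel_integral_translate[of "\<lambda>z. u z * \<psi> k (z - s *\<^sub>R a)"])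
        have "continuous_on UNIV (\<lambda>z. \<psi> k (z - s *\<^sub>R a))"
          by (rule continuous_on_compose2[OF smooth_continuous[OF sm]]) (auto intro!: continuous_intros)
        then show "(\<lambda>z. u z * \<psi> k (z - s *\<^sub>R a)) \<in> borel_measurable borel"
          by (intro borel_measurable_times um borel_measurable_continuous_onI)
      qed
      finally show ?thesis by (simp add: conv_def \<eta>_def)
    qed
    have d2: "partial_deriv i (partial_deriv j \<eta>) x = partial_deriv i (partial_deriv j (\<psi> k)) (- x)" for i j x
    proof -
      have "partial_deriv j \<eta> = (\<lambda>x. (-1) * partial_deriv j (\<psi> k) ((-1) *\<^sub>R x + 0))"
        unfolding \<eta>_def by (intro ext partial_deriv_affine_comp smooth_differentiable sm)
      moreover have "partial_deriv i (\<lambda>x. (-1) * partial_deriv j (\<psi> k) ((-1) *\<^sub>R x + 0)) x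
          = (-1) * partial_deriv i (\<lambda>x. partial_deriv j (\<psi> k) ((-1) *\<^sub>R x + 0)) x"
        by (rule partial_deriv_cmult[OF smooth_differentiable[OF smooth_affine_comp[OF smooth_partial_deriv[OF sm]]]])
      moreover have "partial_deriv i (\<lambda>x. partial_deriv j (\<psi> k) ((-1) *\<^sub>R x + 0)) x
          = (-1) * partial_deriv i (partial_deriv j (\<psi> k)) ((-1) *\<^sub>R x + 0)"
        by (rule partial_deriv_affine_comp[OF smooth_differentiable[OF smooth_partial_deriv[OF sm]]])
      ultimately show ?thesis by simp
    qed
    have "\<bar>conv u \<eta> ((2 * t) *\<^sub>R a) - 2 * conv u \<eta> (t *\<^sub>R a) + conv u \<eta> 0\<bar> \<le> 2 * V * t\<^sup>2"
    proof (rule second_difference_le[OF smooth_conv[OF u \<eta>] t])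
      fix s assume s: "0 \<le> s" "s \<le> 2 * t"
      let ?A = "(\<chi> i j. a $ i * a $ j) :: real^'n^'n"
      define F where "F z = \<psi> k (z + (- s *\<^sub>R a)) *\<^sub>R ?A" for z
      have smt: "smooth (\<lambda>z. \<psi> k (z + (- s *\<^sub>R a)))" by (rule smooth_translate[OF sm])
      have F: "F \<in> test_fields U"
      proof (rule test_fieldsI[of _ "(\<lambda>z. s *\<^sub>R a + z) ` K k"])
        show "smooth (\<lambda>z. F z $ i $ j)" for i j
          using smooth_cmult[OF smt, of "a $ i * a $ j"] by (simp add: F_def mult.commute)
        show "compact ((\<lambda>z. s *\<^sub>R a + z) ` K k)" by (rule compact_translation[OF K])
        show "F z = 0" if "z \<notin> (\<lambda>z. s *\<^sub>R a + z) ` K k" for z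
        proof -
          have "z + (- s *\<^sub>R a) \<notin> K k"
          proof
            assume "z + (- s *\<^sub>R a) \<in> K k"
            then have "s *\<^sub>R a + (z + (- s *\<^sub>R a)) \<in> (\<lambda>z. s *\<^sub>R a + z) ` K k" by (rule imageI)
            with that show False by simp
          qed
          then show ?thesis by (simp add: F_def \<psi>0)
        qed
        show "contraction (F z)" for z
          unfolding F_def using conv_indicator_bounds[OF P(1,2) d(1)[of k]]
          by (intro contraction_scaleR contraction_outer a) (auto simp: \<psi>_def abs_le_iff intro: order_trans[of _ 0])
        show "(\<lambda>z. s *\<^sub>R a + z) ` K k \<subseteq> U"
        proof
          fix z assume "z \<in> (\<lambda>z. s *\<^sub>R a + z) ` K k"
          then obtain x y where xy: "x \<in> closure P" "norm y \<le> d k" "z = s *\<^sub>R a + (x + y)"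
            by (auto simp: K_def)
          obtain x' where x': "x' \<in> P" "dist x' x < e / 2"
            using xy(1) e(1) unfolding closure_approachable by (metis half_gt_zero)
          have "z - (x' + s *\<^sub>R a) = (x - x') + y" using xy(3) by simp
          then have "norm (z - (x' + s *\<^sub>R a)) \<le> norm (x - x') + norm y" by (metis norm_triangle_ineq)
          also have "\<dots> \<le> e" using x'(2) xy(2) d(2)[of k] by (simp add: dist_norm norm_minus_commute)
          finally have "z \<in> cball (x' + s *\<^sub>R a) e" by (simp add: dist_norm norm_minus_commute)
          then show "z \<in> U" using e(2)[OF x'(1) s] by blast
        qed
      qed
      have "hess_pairing u F \<le> V" by (rule hess_pairing_le_variation[OF um V F])
      moreover have "- hess_pairing u F \<le> V"
        using hess_pairing_le_variation[OF um V test_fields_uminus[OF F]]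
        by (simp add: hess_pairing_uminus_field[OF test_fields_test_matrix[OF F]])
      moreover have "hess_pairing u F = (\<Sum>i\<in>UNIV. \<Sum>j\<in>UNIV. a $ i * a $ j * partial_deriv i (partial_deriv j (conv u \<eta>)) (s *\<^sub>R a))"
      proof -
        have pF: "partial_deriv i (partial_deriv j (\<lambda>z. F z $ i $ j)) z
            = (a $ i * a $ j) * partial_deriv i (partial_deriv j \<eta>) (s *\<^sub>R a - z)" for i j z
        proof -
          have c: "(\<lambda>z. F z $ i $ j) = (\<lambda>z. (a $ i * a $ j) * \<psi> k (1 *\<^sub>R z + (- s *\<^sub>R a)))"
            by (simp add: F_def mult.commute)
          have sj: "smooth (\<lambda>z. \<psi> k (1 *\<^sub>R z + (- s *\<^sub>R a)))" "smooth (\<lambda>z. partial_deriv j (\<psi> k) (1 *\<^sub>R z + (- s *\<^sub>R a)))"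
            by (rule smooth_affine_comp[OF sm], rule smooth_affine_comp[OF smooth_partial_deriv[OF sm]])
          have "partial_deriv j (\<lambda>z. (a $ i * a $ j) * \<psi> k (1 *\<^sub>R z + (- s *\<^sub>R a)))
             = (\<lambda>z. (a $ i * a $ j) * partial_deriv j (\<psi> k) (1 *\<^sub>R z + (- s *\<^sub>R a)))"
            by (intro ext, subst partial_deriv_cmult[OF smooth_differentiable[OF sj(1)]],
                subst partial_deriv_affine_comp[OF smooth_differentiable[OF sm]]) simp
          moreover have "partial_deriv i (\<lambda>z. (a $ i * a $ j) * partial_deriv j (\<psi> k) (1 *\<^sub>R z + (- s *\<^sub>R a))) z
             = (a $ i * a $ j) * partial_deriv i (partial_deriv j (\<psi> k)) (1 *\<^sub>R z + (- s *\<^sub>R a))"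
            by (subst partial_deriv_cmult[OF smooth_differentiable[OF sj(2)]],
                subst partial_deriv_affine_comp[OF smooth_differentiable[OF smooth_partial_deriv[OF sm]]]) simp
          ultimately show ?thesis unfolding c d2 by simp
        qed
        have int: "integrable lborel (\<lambda>z. (a $ i * a $ j) * (u z * partial_deriv i (partial_deriv j \<eta>) (s *\<^sub>R a - z)))" for i j
          by (intro integrable_mult_right integrable_conv_integrand u test_fun_partial_deriv \<eta>)
        have "hess_pairing u F = (LINT z|lborel. (\<Sum>i\<in>UNIV. \<Sum>j\<in>UNIV. (a $ i * a $ j) * (u z * partial_deriv i (partial_deriv j \<eta>) (s *\<^sub>R a - z))))"
          unfolding hess_pairing_def hess_div_def pF sum_distrib_left
          by (intro Bochner_Integration.integral_cong refl sum.cong) simp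
        also have "\<dots> = (\<Sum>i\<in>UNIV. \<Sum>j\<in>UNIV. (a $ i * a $ j) * conv u (partial_deriv i (partial_deriv j \<eta>)) (s *\<^sub>R a))"
          unfolding integral_sum2[OF int] conv_def by simp
        finally show ?thesis
          by (simp add: partial_deriv_conv[OF u] \<eta> test_fun_partial_deriv)
      qed
      ultimately show "\<bar>\<Sum>i\<in>UNIV. \<Sum>j\<in>UNIV. a $ i * a $ j * partial_deriv i (partial_deriv j (conv u \<eta>)) (s *\<^sub>R a)\<bar> \<le> V"
        by linarith
    qed
    then show ?thesis by (simp add: q)
  qed
  have uint: "integrable lborel (\<lambda>z. u (z + s *\<^sub>R a))" for s
    by (rule lborel_integrable_translate[OF u])
  have lim: "(\<lambda>k. q k s) \<longlonglongrightarrow> (LINT z|lborel. u (z + s *\<^sub>R a) * indicator P z)" for s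
    unfolding q_def \<psi>_def
    by (rule integral_conv_indicator_tendsto[OF uint P(1,2) emeasure_frontier_convex[OF P(3)] d(1) d0])
  have "(\<lambda>k. \<bar>q k (2 * t) - 2 * q k t + q k 0\<bar>) \<longlonglongrightarrow> \<bar>(LINT z|lborel. u (z + (2 * t) *\<^sub>R a) * indicator P z)
      - 2 * (LINT z|lborel. u (z + t *\<^sub>R a) * indicator P z) + (LINT z|lborel. u (z + 0 *\<^sub>R a) * indicator P z)\<bar>"
    by (intro tendsto_intros lim)
  then have le: "\<bar>(LINT z|lborel. u (z + (2 * t) *\<^sub>R a) * indicator P z)
      - 2 * (LINT z|lborel. u (z + t *\<^sub>R a) * indicator P z) + (LINT z|lborel. u (z + 0 *\<^sub>R a) * indicator P z)\<bar> \<le> 2 * V * t\<^sup>2"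
    by (rule LIMSEQ_le_const2) (use bound in blast)
  have iP: "integrable lborel (\<lambda>z. u (z + s *\<^sub>R a) * indicator P z)" for s
    using integrable_real_mult_indicator[OF _ uint] P(1) by simp
  have "(LINT z|lborel. (u (z + (2 * t) *\<^sub>R a) - 2 * u (z + t *\<^sub>R a) + u z) * indicator P z)
      = (LINT z|lborel. (u (z + (2 * t) *\<^sub>R a) * indicator P z - 2 * (u (z + t *\<^sub>R a) * indicator P z)) + u (z + 0 *\<^sub>R a) * indicator P z)"
    by (intro Bochner_Integration.integral_cong refl) (simp add: algebra_simps)
  also have "\<dots> = (LINT z|lborel. u (z + (2 * t) *\<^sub>R a) * indicator P z)
      - 2 * (LINT z|lborel. u (z + t *\<^sub>R a) * indicator P z) + (LINT z|lborel. u (z + 0 *\<^sub>R a) * indicator P z)"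
  proof -
    have i2: "integrable lborel (\<lambda>z. 2 * (u (z + t *\<^sub>R a) * indicator P z))"
      by (rule integrable_mult_right[OF iP])
    show ?thesis
      unfolding Bochner_Integration.integral_add[OF Bochner_Integration.integrable_diff[OF iP i2] iP]
        Bochner_Integration.integral_diff[OF iP i2] by simp
  qed
  finally show ?thesis using le by simp
qed

text \<open>With \<open>t = r / (N + 1)\<close>, the translates of the slab by
  \<open>(k + 2) * t\<close> along \<open>a\<close>, for \<open>k < N\<close>, cover a fixed piece
  of the strip above the hyperplane. No translation exceeds \<open>r\<close>, which is why the slab
  is taken in the doubled ball.\<close>

lemma slab_volume_lower_bound:
  fixes a p :: "real^'n::finite"
  assumes a: "norm a = 1" and r: "r > 0" and pc: "a \<bullet> p = c"
  shows "\<exists>v>0. \<forall>N::nat. N \<ge> 1 \<longrightarrow>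
    v \<le> real N * measure lborel {z \<in> ball p (2 * r). c - 2 * (r / (real N + 1)) < a \<bullet> z \<and> a \<bullet> z \<le> c - r / (real N + 1)}"
proof -
  have aa: "a \<bullet> a = 1" using a by (simp add: norm_eq_1)
  define S where "S = {z \<in> ball p r. c < a \<bullet> z \<and> a \<bullet> z < c + r / 2}"
  have "open S"
  proof -
    have "S = ball p r \<inter> {z. c < a \<bullet> z} \<inter> {z. a \<bullet> z < c + r / 2}" by (auto simp: S_def)
    then show ?thesis by (auto intro!: open_Int open_halfspace_gt open_halfspace_lt)
  qed
  moreover have "p + (r / 4) *\<^sub>R a \<in> S"
    using r by (auto simp: S_def dist_norm a inner_add_right pc aa)
  ultimately have ne: "\<not> negligible S" using open_not_negligible by blast
  have Sl: "S \<in> lmeasurable" using \<open>open S\<close>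
    by (intro bounded_set_imp_lmeasurable bounded_subset[OF bounded_ball[of p r]]) (auto simp: S_def)
  have Spos: "measure lebesgue S > 0"
    using ne Sl by (metis measure_nonneg negligible_iff_measure order_le_less)
  show ?thesis
  proof (intro exI[of _ "measure lebesgue S"] conjI Spos allI impI)
    fix N :: nat assume N: "N \<ge> 1"
    define t where "t = r / (real N + 1)"
    have t: "t > 0" using r by (simp add: t_def)
    have Nt: "(real N + 1) * t = r" by (simp add: t_def)
    let ?P = "{z \<in> ball p (2 * r). c - 2 * t < a \<bullet> z \<and> a \<bullet> z \<le> c - t}"
    have Pb: "?P \<in> sets borel" by measurable
    have Pl: "?P \<in> lmeasurable"
      using Pb by (intro bounded_set_imp_lmeasurable bounded_subset[OF bounded_ball[of p "2 * r"]]) auto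
    have sub: "S \<subseteq> (\<Union>k<N. (+) (((real k + 2) * t) *\<^sub>R a) ` ?P)"
    proof
      fix z assume "z \<in> S"
      then have z: "dist p z < r" "c < a \<bullet> z" "a \<bullet> z < c + r / 2" by (auto simp: S_def)
      \<comment> \<open>The translated slabs are open below and closed above, so the index is the
        ceiling minus one.\<close>
      define k where "k = nat (\<lceil>(a \<bullet> z - c) / t\<rceil> - 1)"
      have pos: "(a \<bullet> z - c) / t > 0" using z t by simp
      then have c1: "\<lceil>(a \<bullet> z - c) / t\<rceil> \<ge> 1" by (simp add: one_le_ceiling)
      have k: "real k = of_int \<lceil>(a \<bullet> z - c) / t\<rceil> - 1" using c1 by (simp add: k_def)
      have "(a \<bullet> z - c) / t \<le> real k + 1" "real k < (a \<bullet> z - c) / t"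
        unfolding k using ceiling_correct[of "(a \<bullet> z - c) / t"] by auto
      then have kz: "a \<bullet> z \<le> c + (real k + 1) * t" "c + real k * t < a \<bullet> z"
        using t by (auto simp: field_simps)
      have "real k * t < r / 2" using kz(2) z(3) by linarith
      also have "r / 2 \<le> real N * t"
      proof -
        have "1 * t \<le> real N * t" using N t by (intro mult_right_mono) auto
        moreover have "real N * t + t = r" using Nt by (simp add: distrib_right)
        ultimately show ?thesis by linarith
      qed
      finally have "k < N" using t by simp
      have "(real k + 2) * t \<le> r"
      proof -
        have "(real k + 2) \<le> real N + 1" using \<open>k < N\<close> by simp
        then show ?thesis using Nt t by (metis mult_right_mono less_imp_le)
      qed
      let ?w = "z - ((real k + 2) * t) *\<^sub>R a"
      have "dist p ?w \<le> dist p z + norm (((real k + 2) * t) *\<^sub>R a)"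
        using norm_triangle_ineq[of "p - z" "((real k + 2) * t) *\<^sub>R a"]
        by (simp only: dist_norm diff_diff_eq2 add_diff_eq diff_add_eq)
      also have "\<dots> < 2 * r" using z(1) \<open>(real k + 2) * t \<le> r\<close> t by (simp add: a)
      finally have "?w \<in> ?P" using kz by (simp add: inner_diff_right aa algebra_simps)
      moreover have "z = ((real k + 2) * t) *\<^sub>R a + ?w" by simp
      ultimately show "z \<in> (\<Union>k<N. (+) (((real k + 2) * t) *\<^sub>R a) ` ?P)" using \<open>k < N\<close> by blast
    qed
    have meas: "(+) (((real k + 2) * t) *\<^sub>R a) ` ?P \<in> lmeasurable" for k
      by (rule measurable_translation[OF Pl])
    have "measure lebesgue S \<le> measure lebesgue (\<Union>k<N. (+) (((real k + 2) * t) *\<^sub>R a) ` ?P)"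
      by (rule measure_mono_fmeasurable[OF sub]) (use Sl meas in auto)
    also have "\<dots> \<le> (\<Sum>k<N. measure lebesgue ((+) (((real k + 2) * t) *\<^sub>R a) ` ?P))"
      by (rule measure_UNION_le) (use meas in auto)
    also have "\<dots> = real N * measure lebesgue ?P" by (simp add: measure_translation)
    also have "measure lebesgue ?P = measure lborel ?P" using Pb by (simp add: measure_completion)
    finally show "measure lebesgue S \<le> real N * measure lborel {z \<in> ball p (2 * r). c - 2 * (r / (real N + 1)) < a \<bullet> z \<and> a \<bullet> z \<le> c - r / (real N + 1)}"
      by (simp add: t_def)
  qed
qed

text \<open>Across a jump, the second differences with step \<open>t\<close> in normal direction are of order one on a slab
  of volume of order \<open>t\<close>, whereas a bounded Hessian variation only allows an integral of order \<open>t\<^sup>2\<close>.\<close>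

lemma no_jump:
  fixes u :: "real^'n::finite \<Rightarrow> real"
  assumes u: "integrable lborel u" and V: "hessian_variation u U \<le> ereal V"
    and a: "norm a = 1" and B: "ball x r \<subseteq> U"
    and aff: "AE z in lborel. z \<in> ball x r \<longrightarrow> u z = a1 \<bullet> z + b1 + (if a \<bullet> z > c then a2 \<bullet> z + b2 else 0)"
    and p: "p \<in> ball x r" "a \<bullet> p = c"
  shows "a2 \<bullet> p + b2 = 0"
proof (rule ccontr)
  assume nz: "a2 \<bullet> p + b2 \<noteq> 0"
  have aa: "a \<bullet> a = 1" using a by (simp add: norm_eq_1)
  define m where "m = \<bar>a2 \<bullet> p + b2\<bar> / 2"
  define sg where "sg = sgn (a2 \<bullet> p + b2)"
  have m: "m > 0" using nz by (simp add: m_def)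
  obtain r1 where r1: "r1 > 0" "ball p r1 \<subseteq> ball x r"
    using bspec[OF open_contains_ball[of "ball x r", THEN iffD1, OF open_ball] p(1)] by blast
  \<comment> \<open>On \<open>ball p (4 * \<rho>)\<close> the jump keeps its sign and at least half
    of its size. The slabs lie in the ball of radius \<open>2 * \<rho>\<close> and are moved by at
    most \<open>\<rho>\<close>.\<close>
  define \<rho> where "\<rho> = min (r1 / 4) (m / (4 * (norm a2 + 1)))"
  have \<rho>: "\<rho> > 0" "4 * \<rho> \<le> r1"
    using r1(1) m by (auto simp: \<rho>_def add_nonneg_pos)
  have \<rho>m: "norm a2 * (4 * \<rho>) \<le> m"
  proof -
    have "norm a2 * (4 * \<rho>) \<le> (norm a2 + 1) * (4 * (m / (4 * (norm a2 + 1))))"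
      by (intro mult_mono) (use \<rho> in \<open>auto simp: \<rho>_def\<close>)
    also have "\<dots> = m"
    proof -
      have "4 * norm a2 + 4 \<noteq> 0" using norm_ge_zero[of a2] by linarith
      then show ?thesis by (simp add: field_simps)
    qed
    finally show ?thesis .
  qed
  have A: "sg * (a2 \<bullet> z + b2) \<ge> m" if "z \<in> ball p (4 * \<rho>)" for z
  proof -
    have "\<bar>a2 \<bullet> (z - p)\<bar> \<le> norm a2 * norm (z - p)" by (rule Cauchy_Schwarz_ineq2)
    also have "\<dots> \<le> norm a2 * (4 * \<rho>)"
      using that by (intro mult_left_mono) (auto simp: dist_norm norm_minus_commute)
    finally have "\<bar>(a2 \<bullet> z + b2) - (a2 \<bullet> p + b2)\<bar> \<le> m"
      using \<rho>m by (simp add: inner_diff_right)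
    then show ?thesis using nz unfolding sg_def m_def sgn_real_def by (auto simp: abs_if split: if_splits)
  qed
  obtain v where v: "v > 0"
    "\<And>N::nat. N \<ge> 1 \<Longrightarrow> v \<le> real N * measure lborel {z \<in> ball p (2 * \<rho>). c - 2 * (\<rho> / (real N + 1)) < a \<bullet> z \<and> a \<bullet> z \<le> c - \<rho> / (real N + 1)}"
    using slab_volume_lower_bound[OF a \<rho>(1) p(2)] by blast
  have key: "m * v \<le> real N * (2 * V * (\<rho> / (real N + 1))\<^sup>2)" if N: "N \<ge> 1" for N :: nat
  proof -
    define t where "t = \<rho> / (real N + 1)"
    have t: "t > 0" using \<rho> by (simp add: t_def)
    have t2: "2 * t \<le> \<rho>" using N \<rho> by (simp add: t_def field_simps)
    \<comment> \<open>For \<open>z\<close> in this slab, neither \<open>z\<close> nor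
      \<open>z + t *\<^sub>R a\<close> is above the hyperplane, but
      \<open>z + (2 * t) *\<^sub>R a\<close> is; so the second difference is exactly the jump
      term.\<close>
    let ?P = "{z \<in> ball p (2 * \<rho>). c - 2 * t < a \<bullet> z \<and> a \<bullet> z \<le> c - t}"
    have Pb: "?P \<in> sets borel" by measurable
    have Pbd: "bounded ?P" by (rule bounded_subset[OF bounded_ball[of p "2 * \<rho>"]]) auto
    have Pc: "convex ?P"
    proof -
      have "?P = ball p (2 * \<rho>) \<inter> {z. a \<bullet> z > c - 2 * t} \<inter> {z. a \<bullet> z \<le> c - t}" by auto
      then show ?thesis by (auto intro!: convex_Int convex_halfspace_gt convex_halfspace_le)
    qed
    have in_ball: "z + s *\<^sub>R a \<in> ball p (3 * \<rho>)" if "z \<in> ?P" "0 \<le> s" "s \<le> 2 * t" for z s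
    proof -
      have "dist p (z + s *\<^sub>R a) \<le> dist p z + norm (s *\<^sub>R a)"
        using norm_triangle_ineq4[of "p - z" "s *\<^sub>R a"] by (simp only: dist_norm diff_diff_eq)
      then show ?thesis using that t2 by (simp add: a)
    qed
    have D: "\<bar>LINT z|lborel. (u (z + (2 * t) *\<^sub>R a) - 2 * u (z + t *\<^sub>R a) + u z) * indicator ?P z\<bar> \<le> 2 * V * t\<^sup>2"
    proof (rule integral_second_difference_le[OF u V a less_imp_le[OF t] Pb Pbd Pc])
      show "\<rho> / 2 > 0" using \<rho> by simp
      fix z s assume "z \<in> ?P" "0 \<le> s" "s \<le> 2 * t"
      then have "z + s *\<^sub>R a \<in> ball p (3 * \<rho>)" by (rule in_ball)
      then have "cball (z + s *\<^sub>R a) (\<rho> / 2) \<subseteq> ball p r1"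
        using \<rho> by (intro cball_subset_ball_iff[THEN iffD2]) (auto simp: dist_commute)
      then show "cball (z + s *\<^sub>R a) (\<rho> / 2) \<subseteq> U" using r1(2) B by blast
    qed
    have "AE z in lborel. (u (z + (2 * t) *\<^sub>R a) - 2 * u (z + t *\<^sub>R a) + u z) * indicator ?P z
        = (a2 \<bullet> (z + (2 * t) *\<^sub>R a) + b2) * indicator ?P z"
      using AE_lborel_translate[OF aff, of "(2 * t) *\<^sub>R a"] AE_lborel_translate[OF aff, of "t *\<^sub>R a"] aff
    proof (elim AE_mp, intro AE_I2 impI)
      fix z
      assume 1: "z + (2 * t) *\<^sub>R a \<in> ball x r \<longrightarrow> u (z + (2 * t) *\<^sub>R a) = a1 \<bullet> (z + (2 * t) *\<^sub>R a) + b1 + (if a \<bullet> (z + (2 * t) *\<^sub>R a) > c then a2 \<bullet> (z + (2 * t) *\<^sub>R a) + b2 else 0)"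
        and 2: "z + t *\<^sub>R a \<in> ball x r \<longrightarrow> u (z + t *\<^sub>R a) = a1 \<bullet> (z + t *\<^sub>R a) + b1 + (if a \<bullet> (z + t *\<^sub>R a) > c then a2 \<bullet> (z + t *\<^sub>R a) + b2 else 0)"
        and 3: "z \<in> ball x r \<longrightarrow> u z = a1 \<bullet> z + b1 + (if a \<bullet> z > c then a2 \<bullet> z + b2 else 0)"
      show "(u (z + (2 * t) *\<^sub>R a) - 2 * u (z + t *\<^sub>R a) + u z) * indicator ?P z
        = (a2 \<bullet> (z + (2 * t) *\<^sub>R a) + b2) * indicator ?P z"
      proof (cases "z \<in> ?P")
        case True
        have sub: "ball p (3 * \<rho>) \<subseteq> ball x r" using r1(2) \<rho> by (auto simp: subset_iff)
        have "z + (2 * t) *\<^sub>R a \<in> ball x r" "z + t *\<^sub>R a \<in> ball x r" "z \<in> ball x r"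
          using in_ball[OF True, of "2 * t"] in_ball[OF True, of t] in_ball[OF True, of 0] t sub by auto
        moreover have "a \<bullet> (z + (2 * t) *\<^sub>R a) > c" "\<not> a \<bullet> (z + t *\<^sub>R a) > c" "\<not> a \<bullet> z > c"
          using True t by (auto simp: inner_add_right aa)
        ultimately have "u (z + (2 * t) *\<^sub>R a) - 2 * u (z + t *\<^sub>R a) + u z = a2 \<bullet> (z + (2 * t) *\<^sub>R a) + b2"
          using 1 2 3 by (simp add: inner_add_right algebra_simps)
        then show ?thesis by simp
      qed simp
    qed
    moreover have mz: "(\<lambda>z. u (z + v)) \<in> borel_measurable borel" for v
      using lborel_integrable_translate[OF u, of v] by simp
    have um: "u \<in> borel_measurable borel" using u by simp
    have am: "(\<lambda>z. a2 \<bullet> (z + (2 * t) *\<^sub>R a) + b2) \<in> borel_measurable borel"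
      by (intro borel_measurable_continuous_onI continuous_intros)
    ultimately have eq: "(LINT z|lborel. (u (z + (2 * t) *\<^sub>R a) - 2 * u (z + t *\<^sub>R a) + u z) * indicator ?P z)
        = (LINT z|lborel. (a2 \<bullet> (z + (2 * t) *\<^sub>R a) + b2) * indicator ?P z)"
      using mz um am Pb by (intro integral_cong_AE) auto
    have iP: "integrable lborel (indicator ?P :: real^'n \<Rightarrow> real)"
      using Pb emeasure_bounded_finite[OF Pbd] by (intro integrable_real_indicator) auto
    have "m * measure lborel ?P = (LINT z|lborel. m * indicator ?P z)" using Pb by simp
    also have "\<dots> \<le> (LINT z|lborel. sg * ((a2 \<bullet> (z + (2 * t) *\<^sub>R a) + b2) * indicator ?P z))"
    proof (rule integral_mono)
      show "integrable lborel (\<lambda>z. m * indicator ?P z)" by (rule integrable_mult_right[OF iP])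
      show "integrable lborel (\<lambda>z. sg * ((a2 \<bullet> (z + (2 * t) *\<^sub>R a) + b2) * indicator ?P z))"
      proof (rule integrable_mult_right, rule integrable_bounded_compact_support[of _ "norm a2 * (norm p + 3 * \<rho>) + \<bar>b2\<bar>" "cball p (2 * \<rho>)"])
        show "(\<lambda>z. (a2 \<bullet> (z + (2 * t) *\<^sub>R a) + b2) * indicator ?P z) \<in> borel_measurable borel"
          using am Pb by auto
        show "\<bar>(a2 \<bullet> (z + (2 * t) *\<^sub>R a) + b2) * indicator ?P z\<bar> \<le> norm a2 * (norm p + 3 * \<rho>) + \<bar>b2\<bar>" for z
        proof (cases "z \<in> ?P")
          case True
          have "z + (2 * t) *\<^sub>R a \<in> ball p (3 * \<rho>)" using in_ball[OF True, of "2 * t"] t by simp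
          then have "norm (z + (2 * t) *\<^sub>R a) \<le> norm p + 3 * \<rho>"
            using norm_triangle_ineq2[of "z + (2 * t) *\<^sub>R a" p] by (simp add: dist_norm norm_minus_commute)
          then have "\<bar>a2 \<bullet> (z + (2 * t) *\<^sub>R a)\<bar> \<le> norm a2 * (norm p + 3 * \<rho>)"
            by (meson Cauchy_Schwarz_ineq2 mult_left_mono norm_ge_zero order_trans)
          then show ?thesis using True by simp
        qed (use \<rho> in simp)
      qed auto
      show "m * indicator ?P z \<le> sg * ((a2 \<bullet> (z + (2 * t) *\<^sub>R a) + b2) * indicator ?P z)" for z
      proof (cases "z \<in> ?P")
        case True
        have "z + (2 * t) *\<^sub>R a \<in> ball p (4 * \<rho>)"
          using in_ball[OF True, of "2 * t"] t \<rho> by simp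
        from A[OF this] show ?thesis using True by simp
      qed simp
    qed
    also have "\<dots> \<le> \<bar>LINT z|lborel. (a2 \<bullet> (z + (2 * t) *\<^sub>R a) + b2) * indicator ?P z\<bar>"
    proof -
      have "sg * y \<le> \<bar>y\<bar>" for y by (auto simp: sg_def sgn_real_def)
      then show ?thesis by (simp only: integral_mult_right_zero)
    qed
    also have "\<dots> \<le> 2 * V * t\<^sup>2" using D unfolding eq .
    finally have "m * measure lborel ?P \<le> 2 * V * t\<^sup>2" .
    then have "real N * (m * measure lborel ?P) \<le> real N * (2 * V * t\<^sup>2)"
      by (rule mult_left_mono) simp
    moreover have "m * v \<le> m * (real N * measure lborel ?P)"
      using v(2)[OF N] m unfolding t_def by (intro mult_left_mono) auto
    ultimately show ?thesis unfolding t_def by (simp add: mult.left_commute)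
  qed
  have mv: "m * v > 0" using m v by simp
  \<comment> \<open>By \<open>key\<close> the positive number \<open>m * v\<close> is at most a
    constant multiple of \<open>1 / N\<close>, which fails for large \<open>N\<close>; the absolute
    value of \<open>V\<close> avoids a case distinction on its sign.\<close>
  obtain N :: nat where N: "real N > 2 * \<bar>V\<bar> * \<rho>\<^sup>2 / (m * v)" "N \<ge> 1"
    using reals_Archimedean2[of "max 1 (2 * \<bar>V\<bar> * \<rho>\<^sup>2 / (m * v))"] by (metis less_imp_le max_less_iff_conj of_nat_1 of_nat_less_iff)
  have "m * v \<le> real N * (2 * V * (\<rho> / (real N + 1))\<^sup>2)" by (rule key[OF N(2)])
  also have "\<dots> \<le> real N * (2 * \<bar>V\<bar> * (\<rho> / real N)\<^sup>2)"
    using N(2) \<rho> by (intro mult_left_mono mult_mono power_mono divide_left_mono) auto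
  also have "\<dots> = 2 * \<bar>V\<bar> * \<rho>\<^sup>2 / real N"
    using N(2) by (simp add: power2_eq_square field_simps)
  finally have "m * v * real N \<le> 2 * \<bar>V\<bar> * \<rho>\<^sup>2" using N(2) by (simp add: field_simps)
  moreover have "2 * \<bar>V\<bar> * \<rho>\<^sup>2 < real N * (m * v)" using N(1) mv by (simp add: pos_divide_less_eq)
  ultimately show False by (simp add: mult.commute)
qed

section \<open>Piecewise affine functions on a hyperplane arrangement\<close>

definition lf :: "(real^'n::finite) \<times> real \<Rightarrow> real^'n \<Rightarrow> real" where
  "lf p x = fst p \<bullet> x - snd p"

text \<open>Off the hyperplanes this sign pattern names the cell of \<open>x\<close>; crossing only
  the hyperplane \<open>k\<close> adds or removes \<open>k\<close>. Points on a hyperplane count as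
  not positive.\<close>

definition pos_set :: "((real^'n::finite) \<times> real) set \<Rightarrow> real^'n \<Rightarrow> ((real^'n) \<times> real) set" where
  "pos_set H x = {p \<in> H. lf p x > 0}"

lemma lf_continuous: "continuous_on S (lf p)"
  unfolding lf_def[abs_def] by (intro continuous_intros)

lemma lf_measurable [measurable]: "lf p \<in> borel_measurable borel"
  by (intro borel_measurable_continuous_onI lf_continuous)

lemma pos_set_subset: "pos_set H x \<subseteq> H"
  by (auto simp: pos_set_def)

lemma lf_sign_const:
  assumes C: "convex C" "\<And>y. y \<in> C \<Longrightarrow> lf p y \<noteq> 0" and xy: "x \<in> C" "y \<in> C"
  shows "lf p x > 0 \<longleftrightarrow> lf p y > 0"
proof -
  have K: False if "v \<in> C" "w \<in> C" "lf p v > 0" "\<not> lf p w > 0" for v w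
    using connected_ivt_hyperplane[OF convex_connected[OF C(1)] that(2,1), of "fst p" "snd p"] that C(2)
    by (force simp: lf_def)
  show ?thesis using K[OF xy] K[OF xy(2,1)] by blast
qed

lemma lf_ball_nonzero:
  assumes "norm (fst p) = 1" "\<bar>lf p x\<bar> \<ge> d" "y \<in> ball x d"
  shows "lf p y \<noteq> 0"
proof
  assume "lf p y = 0"
  then have "lf p x = fst p \<bullet> (x - y)" by (simp add: lf_def inner_diff_right)
  then have "\<bar>lf p x\<bar> \<le> norm (x - y)"
    using Cauchy_Schwarz_ineq2[of "fst p" "x - y"] assms(1) by simp
  with assms(2,3) show False by (simp add: dist_norm)
qed

text \<open>Near \<open>p0\<close> the hyperplane contains small steps in all directions orthogonal
  to \<open>a\<close>; vanishing along them makes \<open>\<alpha>\<close> a multiple of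
  \<open>a\<close>.\<close>

lemma affine_vanishing_on_hyperplane:
  fixes a \<alpha> :: "real^'n::finite"
  assumes a: "norm a = 1" and p0: "p0 \<in> ball x d" "a \<bullet> p0 = b"
    and van: "\<And>p. p \<in> ball x d \<Longrightarrow> a \<bullet> p = b \<Longrightarrow> \<alpha> \<bullet> p + \<beta> = 0"
  shows "\<alpha> \<bullet> z + \<beta> = (\<alpha> \<bullet> a) * (a \<bullet> z - b)"
proof -
  have aa: "a \<bullet> a = 1" using a by (simp add: norm_eq_1)
  obtain e where e: "e > 0" "ball p0 e \<subseteq> ball x d"
    using bspec[OF open_contains_ball[of "ball x d", THEN iffD1, OF open_ball] p0(1)] by blast
  have perp: "\<alpha> \<bullet> v = 0" if v: "a \<bullet> v = 0" for v
  proof -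
    define s where "s = e / (2 * (norm v + 1))"
    have nv: "norm v + 1 > 0" by (simp add: add_nonneg_pos)
    have s: "s > 0" using e(1) nv by (simp add: s_def)
    have "norm (s *\<^sub>R v) \<le> s * (norm v + 1)" using s by simp
    also have "\<dots> = e / 2"
    proof -
      have "2 * norm v + 2 \<noteq> 0" using nv by linarith
      then show ?thesis by (simp add: s_def field_simps)
    qed
    finally have "norm (s *\<^sub>R v) < e" using e(1) by simp
    then have "p0 + s *\<^sub>R v \<in> ball p0 e" by (simp add: dist_norm)
    then have "\<alpha> \<bullet> (p0 + s *\<^sub>R v) + \<beta> = 0"
      using e(2) p0(2) v by (intro van) (auto simp: inner_add_right)
    with van[OF p0] have "s * (\<alpha> \<bullet> v) = 0" unfolding inner_add_right inner_scaleR_right by linarith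
    with s show ?thesis by simp
  qed
  have "a \<bullet> (z - p0 - (a \<bullet> (z - p0)) *\<^sub>R a) = 0" by (simp add: inner_diff_right aa)
  from perp[OF this] have "\<alpha> \<bullet> (z - p0) = (a \<bullet> (z - p0)) * (\<alpha> \<bullet> a)" by (simp add: inner_diff_right)
  then show ?thesis using van[OF p0] p0(2) by (simp add: inner_diff_right algebra_simps)
qed

text \<open>A pair \<open>(a, b)\<close> with \<open>|a| = 1\<close> stands for the hyperplane \<open>a \<bullet> x = b\<close>; of the two pairs
  describing a hyperplane at most one is allowed.\<close>

locale arrangement =
  fixes H :: "((real^'n::finite) \<times> real) set"
  assumes finite_H: "finite H"
    and unit_normal: "p \<in> H \<Longrightarrow> norm (fst p) = 1"
    and antipodal: "p \<in> H \<Longrightarrow> (- fst p, - snd p) \<notin> H"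
begin

lemma pos_set_const:
  assumes "convex C" "\<And>p y. p \<in> H \<Longrightarrow> y \<in> C \<Longrightarrow> lf p y \<noteq> 0" "x \<in> C" "y \<in> C"
  shows "pos_set H y = pos_set H x"
  using lf_sign_const[OF assms(1) _ assms(3,4)] assms(2) by (auto simp: pos_set_def)

lemma pos_set_one:
  assumes "convex C" "\<forall>p\<in>H - {k}. \<forall>y\<in>C. lf p y \<noteq> 0" "x \<in> C" "y \<in> C" "k \<in> H"
  shows "pos_set H y = (if lf k y > 0 then insert k (pos_set H x - {k}) else pos_set H x - {k})"
proof -
  have "p \<in> pos_set H y \<longleftrightarrow> p \<in> pos_set H x" if "p \<noteq> k" for p
  proof (cases "p \<in> H")
    case True
    then have "lf p z \<noteq> 0" if "z \<in> C" for z using assms(2) \<open>p \<noteq> k\<close> that by blast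
    from lf_sign_const[OF assms(1) this assms(3,4)] True show ?thesis by (simp add: pos_set_def)
  qed (simp add: pos_set_def)
  moreover have "k \<in> pos_set H y \<longleftrightarrow> lf k y > 0" using assms(5) by (simp add: pos_set_def)
  ultimately have "p \<in> pos_set H y \<longleftrightarrow> p \<in> (if lf k y > 0 then insert k (pos_set H x - {k}) else pos_set H x - {k})" for p
    by (cases "p = k") auto
  then show ?thesis by blast
qed

lemma AE_off_hyperplane:
  fixes a :: "real^'n"
  assumes "a \<noteq> 0"
  shows "AE x in lborel. a \<bullet> x \<noteq> b"
proof -
  have "negligible {x. a \<bullet> x = b}" by (rule negligible_hyperplane) (use assms in auto)
  moreover have "closed {x. a \<bullet> x = b}" by (rule closed_hyperplane)
  ultimately have "{x. a \<bullet> x = b} \<in> null_sets lborel"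
    unfolding negligible_iff_null_sets by (subst (asm) null_sets_completion_iff) auto
  from AE_not_in[OF this] show ?thesis by simp
qed

lemma AE_off_arrangement: "AE x in lborel. \<forall>p\<in>H. lf p x \<noteq> 0"
proof (rule AE_finite_allI[OF finite_H])
  fix p assume "p \<in> H"
  then have "fst p \<noteq> 0" using unit_normal by fastforce
  from AE_off_hyperplane[OF this, of "snd p"] show "AE x in lborel. lf p x \<noteq> 0"
    by (simp add: lf_def)
qed

end

text \<open>Coefficients are attached to sign patterns, so two functions over the same arrangement
  can be compared piece by piece. Patterns of empty cells carry arbitrary coefficients, which merely
  enlarge the finite bounds formed from them.\<close>

locale piecewise_affine = arrangement H for H :: "((real^'n::finite) \<times> real) set" +
  fixes U :: "(real^'n) set" and u :: "real^'n \<Rightarrow> real"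
    and A :: "((real^'n) \<times> real) set \<Rightarrow> real^'n" and B :: "((real^'n) \<times> real) set \<Rightarrow> real" and V :: real
  assumes open_U: "open U"
    and integrable: "integrable lborel u"
    and variation: "hessian_variation u U \<le> ereal V"
    and pieces: "AE x in lborel. x \<in> U \<longrightarrow> u x = A (pos_set H x) \<bullet> x + B (pos_set H x)"
begin

text \<open>A representative defined at every point: the Lipschitz estimate uses continuity at the
  points of a segment, whereas \<open>u\<close> is prescribed only almost everywhere.\<close>

definition rep :: "real^'n \<Rightarrow> real" where
  "rep x = A (pos_set H x) \<bullet> x + B (pos_set H x)"

text \<open>The normal component of the gradient jump on the facet of \<open>k\<close> between the
  cells \<open>S\<close> and \<open>insert k S\<close>. Where the two pieces agree on the facet it
  is the whole jump, the coefficient of \<open>a a^T\<close> in the Hessian for the normal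
  \<open>a\<close>.\<close>

definition jump :: "((real^'n) \<times> real) set \<Rightarrow> (real^'n) \<times> real \<Rightarrow> real" where
  "jump S k = (A (insert k S) - A S) \<bullet> fst k"

lemma measurable: "u \<in> borel_measurable borel"
  using integrable by simp

lemma affine_on_cell:
  assumes "ball x d \<subseteq> U" "\<And>p y. p \<in> H \<Longrightarrow> y \<in> ball x d \<Longrightarrow> lf p y \<noteq> 0"
  shows "AE y in lborel. y \<in> ball x d \<longrightarrow> u y = A (pos_set H x) \<bullet> y + B (pos_set H x)"
  using pieces
proof (elim AE_mp, intro AE_I2 impI)
  fix y assume *: "y \<in> U \<longrightarrow> u y = A (pos_set H y) \<bullet> y + B (pos_set H y)" "y \<in> ball x d"
  then have "d > 0" by (metis ball_eq_empty empty_iff not_le)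
  then have "pos_set H y = pos_set H x"
    using * by (intro pos_set_const[of "ball x d"] assms(2)) auto
  then show "u y = A (pos_set H x) \<bullet> y + B (pos_set H x)" using * assms(1) by auto
qed

text \<open>\<open>no_jump\<close> makes the difference of the two adjacent pieces vanish on the
  hyperplane inside the ball, and an affine function vanishing there is a multiple of
  \<open>lf k\<close>. The point \<open>p0\<close> ensures that the hyperplane does meet the
  ball.\<close>

lemma jump_eq:
  assumes sub: "ball x d \<subseteq> U" and k: "k \<in> H"
    and others: "\<forall>p\<in>H - {k}. \<forall>y\<in>ball x d. lf p y \<noteq> 0"
    and p0: "p0 \<in> ball x d" "lf k p0 = 0"
  defines "S \<equiv> pos_set H x - {k}"
  shows "A (insert k S) \<bullet> z + B (insert k S) = A S \<bullet> z + B S + jump S k * lf k z"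
    and "AE y in lborel. y \<in> ball x d \<longrightarrow>
      u y = A S \<bullet> y + B S + (if fst k \<bullet> y > snd k then (A (insert k S) - A S) \<bullet> y + (B (insert k S) - B S) else 0)"
proof -
  have x: "x \<in> ball x d" using p0(1) by (metis ball_eq_empty centre_in_ball empty_iff not_le)
  show aff: "AE y in lborel. y \<in> ball x d \<longrightarrow>
      u y = A S \<bullet> y + B S + (if fst k \<bullet> y > snd k then (A (insert k S) - A S) \<bullet> y + (B (insert k S) - B S) else 0)"
    using pieces
  proof (elim AE_mp, intro AE_I2 impI)
    fix y assume *: "y \<in> U \<longrightarrow> u y = A (pos_set H y) \<bullet> y + B (pos_set H y)" "y \<in> ball x d"
    have "pos_set H y = (if lf k y > 0 then insert k S else S)"
      unfolding S_def by (rule pos_set_one[OF convex_ball others x *(2) k])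
    then show "u y = A S \<bullet> y + B S + (if fst k \<bullet> y > snd k then (A (insert k S) - A S) \<bullet> y + (B (insert k S) - B S) else 0)"
      using * sub by (auto simp: lf_def inner_diff_left)
  qed
  have van: "(A (insert k S) - A S) \<bullet> p + (B (insert k S) - B S) = 0" if "p \<in> ball x d" "fst k \<bullet> p = snd k" for p
    by (rule no_jump[OF integrable variation unit_normal[OF k] sub aff that])
  have "(A (insert k S) - A S) \<bullet> z + (B (insert k S) - B S) = jump S k * (fst k \<bullet> z - snd k)"
    unfolding jump_def
    by (rule affine_vanishing_on_hyperplane[OF unit_normal[OF k] p0(1)]) (use p0 van in \<open>auto simp: lf_def\<close>)
  then show "A (insert k S) \<bullet> z + B (insert k S) = A S \<bullet> z + B S + jump S k * lf k z"
    by (simp add: lf_def inner_diff_left)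
qed

lemma moll_hess_affine:
  assumes d: "d > 0" and aff: "AE y in lborel. y \<in> ball x d \<longrightarrow> u y = a \<bullet> y + b"
  shows "moll_hess d u x = 0"
  by (simp add: moll_hess_def vec_eq_iff
      conv_second_deriv_affine[OF test_fun_mollifier[OF d] mollifier_eq_0[OF d] measurable aff])

end

lemma AE_affine_unique:
  fixes a a' :: "real^'n::finite"
  assumes S: "open S" "S \<noteq> {}" and eq: "AE y in lborel. y \<in> S \<longrightarrow> a \<bullet> y + b = a' \<bullet> y + b'"
  shows "a = a'" "b = b'"
proof -
  have all: "a \<bullet> y + b = a' \<bullet> y + b'" if "y \<in> S" for y
  proof (rule ccontr)
    assume ne: "a \<bullet> y + b \<noteq> a' \<bullet> y + b'"
    let ?T = "S \<inter> {y. a \<bullet> y + b \<noteq> a' \<bullet> y + b'}"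
    have "open {y. a \<bullet> y + b \<noteq> a' \<bullet> y + b'}"
      by (intro open_Collect_neq continuous_intros)
    then have "open ?T" using S(1) by (rule open_Int[rotated])
    moreover have "y \<in> ?T" using that ne by simp
    ultimately have "\<not> negligible ?T" using open_not_negligible by blast
    moreover have "?T \<in> null_sets lborel"
    proof -
      have "AE y in lborel. y \<notin> ?T" using eq by (elim AE_mp) (auto intro!: AE_I2)
      then show ?thesis
        using \<open>open ?T\<close> by (subst AE_iff_null_sets) auto
    qed
    then have "negligible ?T" by (simp add: negligible_iff_null_sets null_sets_completionI)
    ultimately show False by blast
  qed
  obtain x where "x \<in> S" using S(2) by blast
  then obtain e where e: "e > 0" "ball x e \<subseteq> S" using S(1) open_contains_ball by blast
  have xe: "x \<in> S" by fact
  have "a = a'"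
  proof (rule ccontr)
    assume "a \<noteq> a'"
    define v where "v = (e / (2 * norm (a - a'))) *\<^sub>R (a - a')"
    have "norm v < e" using \<open>a \<noteq> a'\<close> e(1) by (simp add: v_def)
    then have "x + v \<in> S" using e(2) by (auto simp: dist_norm subset_iff)
    from all[OF this] all[OF xe] have "(a - a') \<bullet> v = 0" by (simp add: inner_add_right inner_diff_left)
    then have "(e / (2 * norm (a - a'))) * ((a - a') \<bullet> (a - a')) = 0" by (simp add: v_def)
    then show False using \<open>a \<noteq> a'\<close> e(1) by simp
  qed
  then show "a = a'" "b = b'" using all[OF xe] by auto
qed

text \<open>The last assumption abstracts the inclusion of the support of \<open>|D\<^sup>2 h|\<close> in that of \<open>|D\<^sup>2 g|\<close>.\<close>

locale piecewise_affine_pair =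
  G: piecewise_affine H U g Ag Bg Vg + h: piecewise_affine H U h Ah Bh Vh
  for H :: "((real^'n::finite) \<times> real) set" and U g Ag Bg Vg h Ah Bh Vh +
  assumes support: "\<lbrakk>ball x d \<subseteq> U; AE y in lborel. y \<in> ball x d \<longrightarrow> g y = a \<bullet> y + b; z \<in> ball x d\<rbrakk>
    \<Longrightarrow> \<exists>r>0. \<exists>a b. AE y in lborel. y \<in> ball z r \<longrightarrow> h y = a \<bullet> y + b"
begin

text \<open>Division by zero is harmless: where \<open>g\<close> has no kink, neither has \<open>h\<close>.\<close>

definition ratio_bound :: real where
  "ratio_bound = (\<Sum>S\<in>Pow H. \<Sum>k\<in>H. \<bar>h.jump S k / G.jump S k\<bar>)"

lemma ratio_bound_nonneg: "ratio_bound \<ge> 0"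
  unfolding ratio_bound_def by (intro sum_nonneg) auto

lemma ratio_le_bound:
  assumes "S \<subseteq> H" "k \<in> H"
  shows "\<bar>h.jump S k / G.jump S k\<bar> \<le> ratio_bound"
proof -
  have "\<bar>h.jump S k / G.jump S k\<bar> \<le> (\<Sum>k\<in>H. \<bar>h.jump S k / G.jump S k\<bar>)"
    by (rule member_le_sum[OF assms(2) _ G.finite_H]) auto
  also have "\<dots> \<le> ratio_bound"
    unfolding ratio_bound_def
    by (rule member_le_sum[where f = "\<lambda>S. \<Sum>k\<in>H. \<bar>h.jump S k / G.jump S k\<bar>"])
      (use assms G.finite_H in \<open>auto intro: sum_nonneg\<close>)
  finally show ?thesis .
qed

text \<open>If the ball meets a single hyperplane \<open>k\<close>, then \<open>g\<close> and
  \<open>h\<close> are there affine plus multiples of the same kink \<open>max 0 (lf k)\<close>.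
  With \<open>l\<close> the quotient of these multiples, \<open>h - l g\<close> is affine, so its
  mollified Hessian vanishes.\<close>

lemma moll_hess_proportional:
  assumes d: "d > 0" and sub: "ball y d \<subseteq> U"
    and good: "\<And>p q. p \<in> H \<Longrightarrow> q \<in> H \<Longrightarrow> \<bar>lf p y\<bar> < d \<Longrightarrow> \<bar>lf q y\<bar> < d \<Longrightarrow> p = q"
  shows "\<exists>l. \<bar>l\<bar> \<le> ratio_bound \<and> moll_hess d h y = l *\<^sub>R moll_hess d g y"
proof (cases "\<exists>k\<in>H. \<bar>lf k y\<bar> < d")
  case False
  then have nz: "lf p z \<noteq> 0" if "p \<in> H" "z \<in> ball y d" for p z
    using that lf_ball_nonzero[OF G.unit_normal[OF that(1)], of d y z] by force
  have "moll_hess d h y = 0"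
    by (rule h.moll_hess_affine[OF d h.affine_on_cell[OF sub nz]])
  then show ?thesis using ratio_bound_nonneg by (intro exI[of _ 0]) simp
next
  case True
  then obtain k where k: "k \<in> H" "\<bar>lf k y\<bar> < d" by blast
  have others: "\<forall>p\<in>H - {k}. \<forall>z\<in>ball y d. lf p z \<noteq> 0"
  proof (intro ballI)
    fix p z assume p: "p \<in> H - {k}" and z: "z \<in> ball y d"
    then have "\<bar>lf p y\<bar> \<ge> d" using good[of p k] k by force
    then show "lf p z \<noteq> 0" using lf_ball_nonzero[OF G.unit_normal] p z by blast
  qed
  define p0 where "p0 = y - lf k y *\<^sub>R fst k"
  have kk: "fst k \<bullet> fst k = 1" using G.unit_normal[OF k(1)] by (simp add: norm_eq_1)
  have p0: "p0 \<in> ball y d" "lf k p0 = 0"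
    using k G.unit_normal[OF k(1)] by (auto simp: p0_def dist_norm lf_def inner_diff_right kk)
  define S where "S = pos_set H y - {k}"
  have SH: "S \<subseteq> H" using pos_set_subset by (auto simp: S_def)
  note Gj = G.jump_eq[OF sub k(1) others p0, folded S_def]
  note hj = h.jump_eq[OF sub k(1) others p0, folded S_def]
  \<comment> \<open>Without a kink \<open>g\<close> is affine on the whole ball, so
    \<open>support\<close> makes \<open>h\<close> affine near \<open>p0\<close>, with the same
    coefficients on both sides of the hyperplane.\<close>
  have zero: "h.jump S k = 0" if 0: "G.jump S k = 0"
  proof -
    have "AE z in lborel. z \<in> ball y d \<longrightarrow> g z = Ag S \<bullet> z + Bg S"
      using Gj(2)
    proof (elim AE_mp, intro AE_I2 impI)
      fix z assume "z \<in> ball y d \<longrightarrow> g z = Ag S \<bullet> z + Bg S + (if fst k \<bullet> z > snd k then (Ag (insert k S) - Ag S) \<bullet> z + (Bg (insert k S) - Bg S) else 0)"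
        and "z \<in> ball y d"
      then show "g z = Ag S \<bullet> z + Bg S"
        using Gj(1)[of z] 0 by (auto simp: inner_diff_left split: if_splits)
    qed
    from support[OF sub this p0(1)] obtain r a b where r: "r > 0"
      and hr: "AE z in lborel. z \<in> ball p0 r \<longrightarrow> h z = a \<bullet> z + b" by blast
    have eq: "a = Ah T" "b = Bh T"
      if T: "open W" "p \<in> ball p0 r \<inter> ball y d \<inter> W" and
        W: "\<And>z. z \<in> W \<Longrightarrow> Ah S \<bullet> z + Bh S + (if fst k \<bullet> z > snd k then (Ah (insert k S) - Ah S) \<bullet> z + (Bh (insert k S) - Bh S) else 0) = Ah T \<bullet> z + Bh T"
      for T W p
    proof -
      have "AE z in lborel. z \<in> ball p0 r \<inter> ball y d \<inter> W \<longrightarrow> a \<bullet> z + b = Ah T \<bullet> z + Bh T"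
        using hr hj(2)
      proof (elim AE_mp, intro AE_I2 impI)
        fix z assume "z \<in> ball p0 r \<longrightarrow> h z = a \<bullet> z + b" and
          "z \<in> ball y d \<longrightarrow> h z = Ah S \<bullet> z + Bh S + (if fst k \<bullet> z > snd k then (Ah (insert k S) - Ah S) \<bullet> z + (Bh (insert k S) - Bh S) else 0)"
          and "z \<in> ball p0 r \<inter> ball y d \<inter> W"
        then show "a \<bullet> z + b = Ah T \<bullet> z + Bh T" using W[of z] by (metis IntE)
      qed
      moreover have "open (ball p0 r \<inter> ball y d \<inter> W)" "ball p0 r \<inter> ball y d \<inter> W \<noteq> {}"
        using T by (auto intro!: open_Int)
      ultimately show "a = Ah T" "b = Bh T"
        using AE_affine_unique[of "ball p0 r \<inter> ball y d \<inter> W"] by blast+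
    qed
    \<comment> \<open>A step of this length from \<open>p0\<close> along or against the normal stays
      in both balls and lands in one of the open half spaces, where the coefficients of
      \<open>h\<close> can be read off.\<close>
    define e where "e = min r (d - dist y p0) / 2"
    have e: "e > 0" "e < r" "e < d - dist y p0" using r p0(1) by (auto simp: e_def)
    have near: "p0 + s *\<^sub>R fst k \<in> ball p0 r \<inter> ball y d" if "\<bar>s\<bar> = e" for s
    proof -
      have "dist y (p0 + s *\<^sub>R fst k) \<le> dist y p0 + norm (s *\<^sub>R fst k)"
        using norm_triangle_ineq4[of "y - p0" "s *\<^sub>R fst k"] by (simp only: dist_norm diff_diff_eq)
      then show ?thesis using e that G.unit_normal[OF k(1)] by (simp add: dist_norm)
    qed
    have kp0: "fst k \<bullet> p0 = snd k" using p0(2) by (simp add: lf_def)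
    have "a = Ah (insert k S)" "b = Bh (insert k S)"
      by (rule eq[of "{z. fst k \<bullet> z > snd k}" "p0 + e *\<^sub>R fst k"];
          use near[of e] e(1) kp0 kk in \<open>auto simp: open_halfspace_gt inner_add_right inner_diff_left\<close>)+
    moreover have "a = Ah S" "b = Bh S"
      by (rule eq[of "{z. fst k \<bullet> z < snd k}" "p0 + (- e) *\<^sub>R fst k"];
          use near[of "- e"] e(1) kp0 kk in \<open>auto simp: open_halfspace_lt inner_add_right inner_diff_right inner_diff_left\<close>)+
    ultimately show ?thesis by (simp add: h.jump_def)
  qed
  define l where "l = h.jump S k / G.jump S k"
  have hl: "h.jump S k = l * G.jump S k" using zero by (cases "G.jump S k = 0") (auto simp: l_def)
  have "AE z in lborel. z \<in> ball y d \<longrightarrow> h z + (- l) * g z = (Ah S - l *\<^sub>R Ag S) \<bullet> z + (Bh S - l * Bg S)"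
    using Gj(2) hj(2)
  proof (elim AE_mp, intro AE_I2 impI)
    fix z assume z: "z \<in> ball y d \<longrightarrow> g z = Ag S \<bullet> z + Bg S + (if fst k \<bullet> z > snd k then (Ag (insert k S) - Ag S) \<bullet> z + (Bg (insert k S) - Bg S) else 0)"
      "z \<in> ball y d \<longrightarrow> h z = Ah S \<bullet> z + Bh S + (if fst k \<bullet> z > snd k then (Ah (insert k S) - Ah S) \<bullet> z + (Bh (insert k S) - Bh S) else 0)"
      "z \<in> ball y d"
    have "(Ag (insert k S) - Ag S) \<bullet> z + (Bg (insert k S) - Bg S) = G.jump S k * lf k z"
      "(Ah (insert k S) - Ah S) \<bullet> z + (Bh (insert k S) - Bh S) = l * (G.jump S k * lf k z)"
      using Gj(1)[of z] hj(1)[of z] hl by (auto simp: inner_diff_left)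
    then show "h z + (- l) * g z = (Ah S - l *\<^sub>R Ag S) \<bullet> z + (Bh S - l * Bg S)"
      using z by (auto simp: inner_diff_left algebra_simps)
  qed
  then have "conv (\<lambda>z. h z + (- l) * g z) (partial_deriv i (partial_deriv j (mollifier d))) y = 0" for i j
    using G.measurable h.measurable
    by (intro conv_second_deriv_affine[OF test_fun_mollifier[OF d] mollifier_eq_0[OF d]]) auto
  moreover have "conv (\<lambda>z. h z + (- l) * g z) D y = conv h D y - l * conv g D y" if D: "test_fun D" for D
  proof -
    note i = integrable_conv_integrand[OF h.integrable D, of y] integrable_conv_integrand[OF G.integrable D, of y]
    have "conv (\<lambda>z. h z + (- l) * g z) D y = (LINT z|lborel. h z * D (y - z) - l * (g z * D (y - z)))"
      unfolding conv_def by (intro Bochner_Integration.integral_cong refl) (simp add: algebra_simps)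
    also have "\<dots> = conv h D y - l * conv g D y"
      unfolding conv_def Bochner_Integration.integral_diff[OF i(1) integrable_mult_right[OF i(2)]] by simp
    finally show ?thesis .
  qed
  ultimately have "conv h (partial_deriv i (partial_deriv j (mollifier d))) y
      = l * conv g (partial_deriv i (partial_deriv j (mollifier d))) y" for i j
    using test_fun_partial_deriv[OF test_fun_partial_deriv[OF test_fun_mollifier[OF d]]] by force
  then have "moll_hess d h y = l *\<^sub>R moll_hess d g y"
    by (simp add: moll_hess_def vec_eq_iff)
  moreover have "\<bar>l\<bar> \<le> ratio_bound" unfolding l_def by (rule ratio_le_bound[OF SH k(1)])
  ultimately show ?thesis by blast
qed

end

section \<open>Lipschitz bounds off the codimension-two skeleton\<close>

lemma AE_open_ex:
  fixes S :: "'a::euclidean_space set"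
  assumes "AE x in lborel. P x" "open S" "S \<noteq> {}"
  obtains x where "x \<in> S" "P x"
proof -
  have "\<exists>x\<in>S. P x"
  proof (rule ccontr)
    assume "\<not> (\<exists>x\<in>S. P x)"
    then have "AE x in lborel. x \<notin> S" using assms(1) by (elim AE_mp) (auto intro!: AE_I2)
    then have "S \<in> null_sets lborel"
      using assms(2) by (subst AE_iff_null_sets) auto
    then have "negligible S" by (simp add: negligible_iff_null_sets null_sets_completionI)
    with open_not_negligible[OF assms(2,3)] show False by blast
  qed
  then show ?thesis using that by blast
qed

context piecewise_affine
begin

definition lip :: real where
  "lip = (\<Sum>S\<in>Pow H. norm (A S))"

lemma norm_A_le_lip: "S \<subseteq> H \<Longrightarrow> norm (A S) \<le> lip"
  unfolding lip_def by (rule member_le_sum) (use finite_H in auto)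

lemma lip_nonneg: "lip \<ge> 0"
  unfolding lip_def by (intro sum_nonneg) auto

text \<open>With at most one hyperplane through \<open>z\<close>, both adjacent pieces agree at
  \<open>z\<close>, so the increment is given by the linear part of the piece containing
  \<open>y\<close>.\<close>

lemma rep_lipschitz_at:
  assumes z: "z \<in> U" and one: "\<And>p q. p \<in> H \<Longrightarrow> q \<in> H \<Longrightarrow> lf p z = 0 \<Longrightarrow> lf q z = 0 \<Longrightarrow> p = q"
  shows "\<exists>e>0. \<forall>y\<in>ball z e. \<bar>rep y - rep z\<bar> \<le> lip * norm (y - z)"
proof -
  obtain e1 where e1: "e1 > 0" "ball z e1 \<subseteq> U" using open_U z open_contains_ball by blast
  \<comment> \<open>No hyperplane that misses \<open>z\<close> comes closer than this.\<close>
  define e where "e = Min (insert e1 ((\<lambda>p. \<bar>lf p z\<bar>) ` {p \<in> H. lf p z \<noteq> 0}))"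
  have fin: "finite (insert e1 ((\<lambda>p. \<bar>lf p z\<bar>) ` {p \<in> H. lf p z \<noteq> 0}))" using finite_H by simp
  have e: "e > 0" "e \<le> e1" "\<And>p. p \<in> H \<Longrightarrow> lf p z \<noteq> 0 \<Longrightarrow> e \<le> \<bar>lf p z\<bar>"
    unfolding e_def using fin e1(1) by (auto simp: Min_gr_iff intro!: Min_le)
  have sub: "ball z e \<subseteq> U" using e1(2) e(2) by auto
  have nz: "lf p y \<noteq> 0" if "p \<in> H" "lf p z \<noteq> 0" "y \<in> ball z e" for p y
    by (rule lf_ball_nonzero[OF unit_normal[OF that(1)] e(3)[OF that(1,2)] that(3)])
  have lin: "\<bar>A S \<bullet> (y - z)\<bar> \<le> lip * norm (y - z)" if "S \<subseteq> H" for S y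
    by (meson Cauchy_Schwarz_ineq2 mult_right_mono norm_A_le_lip[OF that] norm_ge_zero order_trans)
  have "\<bar>rep y - rep z\<bar> \<le> lip * norm (y - z)" if y: "y \<in> ball z e" for y
  proof (cases "\<exists>k\<in>H. lf k z = 0")
    case False
    then have "pos_set H y = pos_set H z"
      by (intro pos_set_const[OF convex_ball[of z e]]) (use nz y e in auto)
    then have "rep y - rep z = A (pos_set H z) \<bullet> (y - z)"
      by (simp add: rep_def inner_diff_right)
    then show ?thesis using lin[OF pos_set_subset] by simp
  next
    case True
    then obtain k where k: "k \<in> H" "lf k z = 0" by blast
    have others: "\<forall>p\<in>H - {k}. \<forall>y\<in>ball z e. lf p y \<noteq> 0"
      using nz one k by blast
    define S where "S = pos_set H z - {k}"
    have zc: "z \<in> ball z e" using e(1) by simp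
    have j: "A (insert k S) \<bullet> z + B (insert k S) = A S \<bullet> z + B S"
      using jump_eq(1)[OF sub k(1) others zc k(2), of z] k(2) by (simp add: S_def)
    have pz: "pos_set H z = S" using k by (auto simp: S_def pos_set_def)
    have py: "pos_set H y = (if lf k y > 0 then insert k S else S)"
      unfolding S_def by (rule pos_set_one[OF convex_ball others zc y k(1)])
    have SH: "S \<subseteq> H" "insert k S \<subseteq> H" using pos_set_subset k by (auto simp: S_def)
    have "rep y - rep z = A (pos_set H y) \<bullet> (y - z)"
      using j by (auto simp: rep_def pz py inner_diff_right)
    then show ?thesis using lin[OF pos_set_subset] by simp
  qed
  with e(1) show ?thesis by blast
qed

text \<open>Continuity is available only where at most one hyperplane passes. For almost every
  \<open>x\<close> the segment from \<open>x0\<close> avoids the points where two of them meet, and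
  the local bounds add up along it.\<close>

lemma rep_lipschitz_AE:
  assumes U: "convex U" and x0: "x0 \<in> U" "\<forall>p\<in>H. lf p x0 \<noteq> 0"
  shows "AE x in lborel. x \<in> U \<longrightarrow> \<bar>rep x - rep x0\<bar> \<le> lip * norm (x - x0)"
proof -
  \<comment> \<open>The excluded \<open>x\<close> form a hyperplane through \<open>x0\<close>
    containing the intersection of \<open>p\<close> and \<open>q\<close>; its normal
    \<open>?a\<close> vanishes only if \<open>p\<close> and \<open>q\<close> describe the same
    hyperplane.\<close>
  have "AE x in lborel. lf p x0 * lf q x \<noteq> lf q x0 * lf p x" if pq: "p \<in> H" "q \<in> H" "p \<noteq> q" for p q
  proof -
    let ?a = "lf p x0 *\<^sub>R fst q - lf q x0 *\<^sub>R fst p"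
    have "?a \<noteq> 0"
    proof
      assume "?a = 0"
      then have eq: "lf p x0 *\<^sub>R fst q = lf q x0 *\<^sub>R fst p" by simp
      then have "norm (lf p x0 *\<^sub>R fst q) = norm (lf q x0 *\<^sub>R fst p)" by (rule arg_cong)
      then have "\<bar>lf p x0\<bar> = \<bar>lf q x0\<bar>" using unit_normal pq by simp
      then consider "lf p x0 = lf q x0" | "lf p x0 = - lf q x0" by linarith
      then show False
      proof cases
        case 1
        then have "fst q = fst p" using eq x0(2) pq by simp
        moreover from this have "snd q = snd p" using 1 by (simp add: lf_def)
        ultimately show False using pq by (simp add: prod_eq_iff)
      next
        case 2
        then have "lf q x0 *\<^sub>R fst p = - (lf q x0 *\<^sub>R fst q)" using eq by simp
        then have "lf q x0 *\<^sub>R (fst q + fst p) = 0" by (simp add: scaleR_add_right)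
        then have "fst q + fst p = 0" using x0(2) pq by simp
        then have f: "fst q = - fst p" by (simp add: eq_neg_iff_add_eq_0)
        moreover have "snd q = - snd p" using 2 f by (simp add: lf_def)
        ultimately have "q = (- fst p, - snd p)" by (simp add: prod_eq_iff)
        then show False using antipodal[OF pq(1)] pq(2) by simp
      qed
    qed
    from AE_off_hyperplane[OF this, of "lf p x0 * snd q - lf q x0 * snd p"] show ?thesis
      by (rule AE_mp) (auto intro!: AE_I2 simp: lf_def inner_diff_left algebra_simps)
  qed
  then have "AE x in lborel. \<forall>p\<in>H. \<forall>q\<in>H. p \<noteq> q \<longrightarrow> lf p x0 * lf q x \<noteq> lf q x0 * lf p x"
    by (intro AE_finite_allI finite_H AE_impI)
  then show ?thesis
  proof (rule AE_mp, intro AE_I2 impI)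
    fix x
    assume gen: "\<forall>p\<in>H. \<forall>q\<in>H. p \<noteq> q \<longrightarrow> lf p x0 * lf q x \<noteq> lf q x0 * lf p x" and x: "x \<in> U"
    define \<gamma> where "\<gamma> t = x0 + t *\<^sub>R (x - x0)" for t
    have lin: "lf p (\<gamma> t) = (1 - t) * lf p x0 + t * lf p x" for p t
      by (simp add: lf_def \<gamma>_def inner_add_right inner_diff_right algebra_simps)
    have one: "p = q" if "p \<in> H" "q \<in> H" "lf p (\<gamma> t) = 0" "lf q (\<gamma> t) = 0" for p q t
    proof (rule ccontr)
      assume "p \<noteq> q"
      have t: "t \<noteq> 0" using that lin[of p t] x0(2) by auto
      have "lf q x0 * ((1 - t) * lf p x0 + t * lf p x) = lf p x0 * ((1 - t) * lf q x0 + t * lf q x)"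
        using that lin by simp
      then have "t * (lf p x0 * lf q x) = t * (lf q x0 * lf p x)" by (auto simp: algebra_simps)
      then show False using gen that \<open>p \<noteq> q\<close> t by auto
    qed
    have inU: "\<gamma> t \<in> U" if "0 \<le> t" "t \<le> 1" for t
    proof -
      have "(1 - t) *\<^sub>R x0 + t *\<^sub>R x \<in> U" using U x0(1) x that by (intro convexD) auto
      then show ?thesis by (simp add: \<gamma>_def algebra_simps)
    qed
    let ?L = "lip * norm (x - x0)"
    \<comment> \<open>Clamping the parameter to the unit interval lets the local estimate be used on
      both sides of the end points.\<close>
    define f where "f t = rep (\<gamma> (max 0 (min 1 t)))" for t
    have "\<bar>f 1 - f 0\<bar> \<le> ?L * (1 - 0)"
    \<comment> \<open>Bisection: the estimate adds up over adjacent intervals and holds on short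
      intervals around each point.\<close>
    proof (rule Bolzano[of 0 1 "\<lambda>s t. \<bar>f t - f s\<bar> \<le> ?L * (t - s)"])
      fix a b c assume "\<bar>f b - f a\<bar> \<le> ?L * (b - a)" "\<bar>f c - f b\<bar> \<le> ?L * (c - b)"
      then show "\<bar>f c - f a\<bar> \<le> ?L * (c - a)" by (simp add: right_diff_distrib)
    next
      fix t :: real assume t: "0 \<le> t" "t \<le> 1"
      have "\<exists>e>0. \<forall>y\<in>ball (\<gamma> t) e. \<bar>rep y - rep (\<gamma> t)\<bar> \<le> lip * norm (y - \<gamma> t)"
        by (rule rep_lipschitz_at[OF inU[OF t]]) (rule one)
      then obtain e where e: "e > 0" "\<And>y. y \<in> ball (\<gamma> t) e \<Longrightarrow> \<bar>rep y - rep (\<gamma> t)\<bar> \<le> lip * norm (y - \<gamma> t)"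
        by blast
      define d where "d = e / (norm (x - x0) + 1)"
      have nn: "norm (x - x0) + 1 > 0" by (simp add: add_nonneg_pos)
      have d: "d > 0" using e(1) nn by (simp add: d_def)
      have K: "\<bar>f s - f t\<bar> \<le> ?L * \<bar>s - t\<bar>" if s: "\<bar>s - t\<bar> < d" for s
      proof -
        define s' where "s' = max 0 (min 1 s)"
        have s': "\<bar>s' - t\<bar> \<le> \<bar>s - t\<bar>" using t by (auto simp: s'_def)
        have nrm: "norm (\<gamma> s' - \<gamma> t) = \<bar>s' - t\<bar> * norm (x - x0)"
          by (simp add: \<gamma>_def scaleR_diff_left[symmetric])
        also have "\<dots> \<le> \<bar>s - t\<bar> * (norm (x - x0) + 1)" using s' by (intro mult_mono) auto
        also have "\<dots> < d * (norm (x - x0) + 1)" using s nn by (intro mult_strict_right_mono) auto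
        also have "\<dots> = e" using nn by (simp add: d_def)
        finally have "\<gamma> s' \<in> ball (\<gamma> t) e" by (simp add: dist_norm norm_minus_commute)
        then have "\<bar>rep (\<gamma> s') - rep (\<gamma> t)\<bar> \<le> lip * (\<bar>s' - t\<bar> * norm (x - x0))"
          using e(2)[of "\<gamma> s'"] unfolding nrm by blast
        also have "\<dots> \<le> lip * (\<bar>s - t\<bar> * norm (x - x0))"
          using s' lip_nonneg by (intro mult_left_mono mult_right_mono) auto
        finally have "\<bar>rep (\<gamma> s') - rep (\<gamma> t)\<bar> \<le> lip * (\<bar>s - t\<bar> * norm (x - x0))" .
        moreover have "f s = rep (\<gamma> s')" "f t = rep (\<gamma> t)" using t by (simp_all add: f_def s'_def)
        ultimately show ?thesis by (simp add: mult_ac)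
      qed
      show "\<exists>d>0. \<forall>a b. a \<le> t \<and> t \<le> b \<and> b - a < d \<longrightarrow> \<bar>f b - f a\<bar> \<le> ?L * (b - a)"
      proof (intro exI[of _ d] conjI d allI impI)
        fix a b assume ab: "a \<le> t \<and> t \<le> b \<and> b - a < d"
        have "\<bar>f b - f t\<bar> \<le> ?L * (b - t)" "\<bar>f a - f t\<bar> \<le> ?L * (t - a)"
          using K[of b] K[of a] ab by auto
        moreover have "?L * (b - a) = ?L * (b - t) + ?L * (t - a)" by (simp add: algebra_simps)
        ultimately show "\<bar>f b - f a\<bar> \<le> ?L * (b - a)" by linarith
      qed
    qed simp
    then show "\<bar>rep x - rep x0\<bar> \<le> lip * norm (x - x0)" by (simp add: f_def \<gamma>_def)
  qed
qed

text \<open>Second derivatives of the mollifier integrate to zero, so a constant may be subtracted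
  from \<open>u\<close>; the rest is at most \<open>lip * (2 * d)\<close> on the ball and meets a
  kernel of L1 norm at most \<open>C1 / d^2\<close>.\<close>

lemma moll_hess_bound:
  assumes U: "convex U"
  obtains C where "C \<ge> 0"
    "\<And>d y i j. d > 0 \<Longrightarrow> ball y d \<subseteq> U \<Longrightarrow> \<bar>moll_hess d u y $ i $ j\<bar> \<le> C / d"
proof -
  obtain C1 where C1: "C1 \<ge> 0"
    "\<And>d i j. d > 0 \<Longrightarrow> (LINT x|lborel. \<bar>partial_deriv i (partial_deriv j (mollifier d)) (x::real^'n)\<bar>) \<le> C1 / d\<^sup>2"
    using mollifier_second_deriv_L1 by blast
  show ?thesis
  proof (rule that[of "2 * lip * C1"])
    show "2 * lip * C1 \<ge> 0" using C1(1) lip_nonneg by simp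
    fix d y i j assume d: "d > 0" and sub: "ball y d \<subseteq> U"
    let ?D = "partial_deriv i (partial_deriv j (mollifier d)) :: real^'n \<Rightarrow> real"
    have D: "test_fun ?D" by (intro test_fun_partial_deriv test_fun_mollifier d)
    have D0: "?D z = 0" if "norm z \<ge> d" for z
      using that by (intro partial_deriv_zero_outside_ball[where d = d] test_fun_continuous test_fun_partial_deriv test_fun_mollifier d)
        (auto intro: mollifier_eq_0[OF d])
    obtain x0 where x0: "x0 \<in> ball y d" "\<forall>p\<in>H. lf p x0 \<noteq> 0"
      using AE_open_ex[OF AE_off_arrangement open_ball[of y d]] d by auto
    let ?c = "rep x0"
    have x0U: "x0 \<in> U" using x0(1) sub by blast
    have close: "AE x in lborel. x \<in> ball y d \<longrightarrow> \<bar>u x - ?c\<bar> \<le> lip * (2 * d)"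
      using rep_lipschitz_AE[OF U x0U x0(2)] pieces
    proof (elim AE_mp, intro AE_I2 impI)
      fix x assume *: "x \<in> U \<longrightarrow> \<bar>rep x - rep x0\<bar> \<le> lip * norm (x - x0)"
        "x \<in> U \<longrightarrow> u x = A (pos_set H x) \<bullet> x + B (pos_set H x)" "x \<in> ball y d"
      then have xU: "x \<in> U" using sub by blast
      have "norm (x - x0) \<le> 2 * d"
        using *(3) x0(1) dist_triangle2[of x x0 y] by (simp add: dist_norm dist_commute norm_minus_commute)
      then have "lip * norm (x - x0) \<le> lip * (2 * d)" using lip_nonneg by (rule mult_left_mono)
      then show "\<bar>u x - ?c\<bar> \<le> lip * (2 * d)" using * xU by (simp add: rep_def)
    qed
    have i1: "integrable lborel (\<lambda>z. u z * ?D (y - z))" by (rule integrable_conv_integrand[OF integrable D])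
    have i2: "integrable lborel (\<lambda>z. ?D (y - z))"
    proof -
      have "integrable lborel (\<lambda>z. ?D (z + (- y)))"
        by (rule test_fun_integrable[OF test_fun_translate[OF D]])
      moreover have "?D (z + (- y)) = ?D (y - z)" for z
        using partial_deriv2_even[OF smooth_mollifier mollifier_even, of i j d "y - z"] by simp
      ultimately show ?thesis by simp
    qed
    have z0: "(LINT z|lborel. ?D (y - z)) = 0"
    proof -
      have "conv (\<lambda>_. 1) ?D y = 0"
        by (rule conv_second_deriv_affine[OF test_fun_mollifier[OF d] mollifier_eq_0[OF d], where a = 0 and b = 1]) auto
      then show ?thesis by (simp add: conv_def)
    qed
    have eq: "conv u ?D y = (LINT z|lborel. (u z - ?c) * ?D (y - z))"
      unfolding conv_def left_diff_distrib Bochner_Integration.integral_diff[OF i1 integrable_mult_right[OF i2]]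
      by (simp add: z0)
    have "\<bar>conv u ?D y\<bar> \<le> (LINT z|lborel. \<bar>(u z - ?c) * ?D (y - z)\<bar>)"
      unfolding eq by (rule integral_abs_bound)
    also have "\<dots> \<le> (LINT z|lborel. lip * (2 * d) * \<bar>?D (y - z)\<bar>)"
    proof (rule integral_mono_AE)
      show "integrable lborel (\<lambda>z. \<bar>(u z - ?c) * ?D (y - z)\<bar>)"
        unfolding left_diff_distrib
        by (intro integrable_abs Bochner_Integration.integrable_diff i1 integrable_mult_right i2)
      show "integrable lborel (\<lambda>z. lip * (2 * d) * \<bar>?D (y - z)\<bar>)"
        by (intro integrable_mult_right integrable_abs i2)
      show "AE z in lborel. \<bar>(u z - ?c) * ?D (y - z)\<bar> \<le> lip * (2 * d) * \<bar>?D (y - z)\<bar>"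
        using close
      proof (rule AE_mp, intro AE_I2 impI)
        fix z assume z: "z \<in> ball y d \<longrightarrow> \<bar>u z - ?c\<bar> \<le> lip * (2 * d)"
        show "\<bar>(u z - ?c) * ?D (y - z)\<bar> \<le> lip * (2 * d) * \<bar>?D (y - z)\<bar>"
        proof (cases "z \<in> ball y d")
          case True
          then show ?thesis unfolding abs_mult using z by (intro mult_right_mono) auto
        next
          case False
          then have "?D (y - z) = 0" by (intro D0) (simp add: dist_norm)
          then show ?thesis by simp
        qed
      qed
    qed
    also have "\<dots> = lip * (2 * d) * (LINT z|lborel. \<bar>?D z\<bar>)"
      using lborel_integral_reflect[of "\<lambda>z. \<bar>?D z\<bar>" y] test_fun_measurable[OF D] by simp
    also have "\<dots> \<le> lip * (2 * d) * (C1 / d\<^sup>2)"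
      using C1(2)[OF d] lip_nonneg d by (intro mult_left_mono) auto
    also have "\<dots> = 2 * lip * C1 / d" using d by (simp add: power2_eq_square field_simps)
    finally show "\<bar>moll_hess d u y $ i $ j\<bar> \<le> 2 * lip * C1 / d" by (simp add: moll_hess_def)
  qed
qed

end

section \<open>Volume of the neighbourhood of the codimension-two skeleton\<close>

text \<open>The component of \<open>a\<close> orthogonal to \<open>b\<close>, rescaled. Translations
  along \<open>w\<close> shift one of two linear forms at unit speed and preserve the other, which
  allows disjoint translates to be packed into a slab.\<close>

lemma ex_dual_vector:
  fixes a b :: "real^'n::finite"
  assumes "norm a = 1" "norm b = 1" "a \<noteq> b" "a \<noteq> - b"
  obtains w where "a \<bullet> w = 1" "b \<bullet> w = 0"
proof -
  have aa: "a \<bullet> a = 1" "b \<bullet> b = 1" using assms by (simp_all add: norm_eq_1)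
  define v where "v = a - (a \<bullet> b) *\<^sub>R b"
  have bv: "b \<bullet> v = 0" by (simp add: v_def inner_diff_right aa inner_commute)
  have "v \<noteq> 0"
  proof
    assume "v = 0"
    then have e: "a = (a \<bullet> b) *\<^sub>R b" by (simp add: v_def)
    then have "norm a = norm ((a \<bullet> b) *\<^sub>R b)" by (rule arg_cong)
    then have "\<bar>a \<bullet> b\<bar> = 1" using assms by simp
    then have "a \<bullet> b = 1 \<or> a \<bullet> b = -1" by linarith
    then show False using e assms(3,4) by auto
  qed
  moreover have "a \<bullet> v = v \<bullet> v"
  proof -
    have "v \<bullet> v = (a - (a \<bullet> b) *\<^sub>R b) \<bullet> v" by (subst (1) v_def) simp
    then show ?thesis using bv by (simp add: inner_diff_left)
  qed
  ultimately show ?thesis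
    by (intro that[of "v /\<^sub>R (v \<bullet> v)"]) (auto simp: bv)
qed

text \<open>For crossing hyperplanes, \<open>k + 1\<close> disjoint translates of the double slab
  fit into one slab of the same thickness, whose volume in a fixed ball tends to 0 by continuity
  from above. For distinct parallel hyperplanes the slabs are eventually disjoint.\<close>

lemma two_slabs_volume:
  fixes p q :: "(real^'n::finite) \<times> real"
  assumes p: "norm (fst p) = 1" and q: "norm (fst q) = 1" and pq: "p \<noteq> q" "q \<noteq> (- fst p, - snd p)"
  shows "(\<lambda>k. (real k + 1) * measure lborel {y \<in> ball 0 R. \<bar>lf p y\<bar> < 1 / (real k + 1) \<and> \<bar>lf q y\<bar> < 1 / (real k + 1)}) \<longlonglongrightarrow> 0"
proof (cases "fst p = fst q \<or> fst p = - fst q")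
  case True
  obtain s :: real where s: "\<bar>s\<bar> = 1" "fst q = s *\<^sub>R fst p"
    using True by (elim disjE) (auto intro: that[of 1] that[of "-1"])
  have c: "snd q \<noteq> s * snd p"
  proof
    assume "snd q = s * snd p"
    then have "q = (s *\<^sub>R fst p, s * snd p)" using s by (simp add: prod_eq_iff)
    moreover have "s = 1 \<or> s = -1" using s(1) by linarith
    ultimately show False using pq by auto
  qed
  \<comment> \<open>Parallel case: this combination is a nonzero constant, so the two forms cannot
    both be small.\<close>
  have gap: "lf q y - s * lf p y = s * snd p - snd q" for y
    by (simp add: lf_def s right_diff_distrib)
  define g where "g = \<bar>s * snd p - snd q\<bar>"
  have g: "g > 0" using c by (simp add: g_def)
  obtain K :: nat where K: "real K > 2 / g" using reals_Archimedean2 by blast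
  have empty: "{y \<in> ball 0 R. \<bar>lf p y\<bar> < 1 / (real k + 1) \<and> \<bar>lf q y\<bar> < 1 / (real k + 1)} = {}" if "k \<ge> K" for k
  proof -
    have kk: "real k + 1 > 2 / g" using K that by linarith
    have gg: "1 / (real k + 1) + 1 / (real k + 1) < g"
      using kk g by (simp add: field_simps)
    have "g \<le> \<bar>lf q y\<bar> + \<bar>lf p y\<bar>" for y
      unfolding g_def gap[of y, symmetric] using s(1) abs_triangle_ineq4[of "lf q y" "s * lf p y"] by (simp add: abs_mult)
    then have "\<not> (\<bar>lf p y\<bar> < 1 / (real k + 1) \<and> \<bar>lf q y\<bar> < 1 / (real k + 1))" for y
      using gg by (meson add_strict_mono le_less_trans less_asym)
    then show ?thesis by blast
  qed
  have "\<forall>\<^sub>F k in sequentially. (real k + 1) * measure lborel {y \<in> ball 0 R. \<bar>lf p y\<bar> < 1 / (real k + 1) \<and> \<bar>lf q y\<bar> < 1 / (real k + 1)} = 0"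
    unfolding eventually_sequentially
  proof (intro exI[of _ K] allI impI)
    fix k assume "K \<le> k"
    from empty[OF this] show "(real k + 1) * measure lborel {y \<in> ball 0 R. \<bar>lf p y\<bar> < 1 / (real k + 1) \<and> \<bar>lf q y\<bar> < 1 / (real k + 1)} = 0"
      by (simp only: measure_empty mult_zero_right)
  qed
  then show ?thesis by (rule tendsto_eventually)
next
  case False
  then obtain w where w: "fst p \<bullet> w = 1" "fst q \<bullet> w = 0"
    using ex_dual_vector[OF p q] by blast
  define E where "E k = {y \<in> ball 0 R. \<bar>lf p y\<bar> < 1 / (real k + 1) \<and> \<bar>lf q y\<bar> < 1 / (real k + 1)}" for k
  \<comment> \<open>The largest translation is by \<open>2 * d * k\<close> times \<open>w\<close>
    with \<open>d = 1 / (k + 1)\<close>, so the radius grows by at most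
    \<open>2 * norm w\<close>.\<close>
  define Gs where "Gs k = {y \<in> ball 0 (R + 2 * norm w). \<bar>lf q y\<bar> < 1 / (real k + 1)}" for k :: nat
  have Eb: "E k \<in> sets borel" for k unfolding E_def by measurable
  have Gb: "Gs k \<in> sets borel" for k unfolding Gs_def by measurable
  have El: "E k \<in> lmeasurable" for k
    using Eb by (intro bounded_set_imp_lmeasurable bounded_subset[OF bounded_ball[of 0 R]]) (auto simp: E_def)
  have Gl: "Gs k \<in> lmeasurable" for k
    using Gb by (intro bounded_set_imp_lmeasurable bounded_subset[OF bounded_ball[of 0 "R + 2 * norm w"]]) (auto simp: Gs_def)
  have pack: "(real k + 1) * measure lebesgue (E k) \<le> measure lebesgue (Gs k)" for k
  proof -
    define d where "d = 1 / (real k + 1)"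
    have d: "d > 0" by (simp add: d_def)
    \<comment> \<open>Steps of \<open>2 * d\<close> in the value of \<open>lf p\<close> exactly
      separate slabs of half-width \<open>d\<close>.\<close>
    define F where "F j = (+) ((2 * d * real j) *\<^sub>R w) ` E k" for j :: nat
    have Fl: "F j \<in> lmeasurable" for j unfolding F_def by (rule measurable_translation[OF El])
    have slab: "\<bar>lf p z - 2 * d * real j\<bar> < d" "\<bar>lf q z\<bar> < d" "norm z < R + 2 * d * real j * norm w" if "z \<in> F j" for z j
    proof -
      obtain y where y: "y \<in> E k" "z = (2 * d * real j) *\<^sub>R w + y" using \<open>z \<in> F j\<close> by (auto simp: F_def)
      have "lf p z = lf p y + 2 * d * real j" "lf q z = lf q y"
        using w by (simp_all add: y(2) lf_def inner_add_right)
      then show "\<bar>lf p z - 2 * d * real j\<bar> < d" "\<bar>lf q z\<bar> < d" using y(1) by (auto simp: E_def d_def)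
      have "norm z \<le> norm ((2 * d * real j) *\<^sub>R w) + norm y" unfolding y(2) by (rule norm_triangle_ineq)
      also have "\<dots> < R + 2 * d * real j * norm w" using y(1) d by (simp add: E_def)
      finally show "norm z < R + 2 * d * real j * norm w" .
    qed
    have disj: "F i \<inter> F j = {}" if "i \<noteq> j" for i j
    proof (rule ccontr)
      assume "F i \<inter> F j \<noteq> {}"
      then obtain z where z: "z \<in> F i" "z \<in> F j" by blast
      have "\<bar>2 * d * real i - 2 * d * real j\<bar> < 2 * d"
        using slab(1)[OF z(1)] slab(1)[OF z(2)] by linarith
      then have "2 * d * \<bar>real i - real j\<bar> < 2 * d * 1"
        using d by (simp add: abs_mult right_diff_distrib[symmetric])
      then have "\<bar>real i - real j\<bar> < 1" using d by simp
      then show False using that by linarith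
    qed
    have "(\<Union>j<Suc k. F j) \<subseteq> Gs k"
    proof
      fix z assume "z \<in> (\<Union>j<Suc k. F j)"
      then obtain j where j: "j < Suc k" "z \<in> F j" by blast
      have "2 * d * real j \<le> 2" using j(1) by (simp add: d_def field_simps)
      then have "2 * d * real j * norm w \<le> 2 * norm w" by (intro mult_right_mono) auto
      then show "z \<in> Gs k" using slab[OF j(2)] by (simp add: Gs_def d_def)
    qed
    then have "measure lebesgue (\<Union>j<Suc k. F j) \<le> measure lebesgue (Gs k)"
      using Fl Gl by (intro measure_mono_fmeasurable) auto
    moreover have "measure lebesgue (\<Union>j<Suc k. F j) = (\<Sum>j<Suc k. measure lebesgue (F j))"
    proof (rule measure_finite_Union)
      show "F ` {..<Suc k} \<subseteq> sets lebesgue" using fmeasurableD[OF Fl] by blast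
      show "disjoint_family_on F {..<Suc k}" unfolding disjoint_family_on_def using disj by blast
      show "emeasure lebesgue (F j) \<noteq> \<infinity>" for j using fmeasurableD2[OF Fl] by simp
    qed simp
    moreover have "measure lebesgue (F j) = measure lebesgue (E k)" for j
      unfolding F_def by (rule measure_translation)
    ultimately show ?thesis by (simp add: algebra_simps)
  qed
  have G0: "(\<lambda>k. measure lebesgue (Gs k)) \<longlonglongrightarrow> measure lebesgue (\<Inter>k. Gs k)"
  proof (rule Lim_measure_decseq)
    show "range Gs \<subseteq> sets lebesgue" using Gl by auto
    show "decseq Gs"
      unfolding decseq_def Gs_def
      by (auto intro: less_le_trans simp: frac_le)
    show "emeasure lebesgue (Gs i) \<noteq> \<infinity>" for i using Gl[of i] by (auto simp: fmeasurable_def)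
  qed
  moreover have "(\<Inter>k. Gs k) \<subseteq> {y. fst q \<bullet> y = snd q}"
  proof
    fix y assume y: "y \<in> (\<Inter>k. Gs k)"
    have le: "\<bar>lf q y\<bar> \<le> e" if e: "e > 0" for e
    proof -
      obtain k :: nat where k: "1 / (real k + 1) < e"
        using nat_approx_posE[OF e] by (metis of_nat_Suc add.commute)
      moreover have "\<bar>lf q y\<bar> < 1 / (real k + 1)" using y by (auto simp: Gs_def)
      ultimately show ?thesis by linarith
    qed
    have "lf q y = 0"
      using le[of "\<bar>lf q y\<bar> / 2"] by (cases "lf q y = 0") simp_all
    then show "y \<in> {y. fst q \<bullet> y = snd q}" by (simp add: lf_def)
  qed
  moreover have "negligible {y. fst q \<bullet> y = snd q}"
    by (rule negligible_hyperplane) (use q in auto)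
  ultimately have "(\<lambda>k. measure lebesgue (Gs k)) \<longlonglongrightarrow> 0"
    using negligible_subset negligible_imp_measure0 by metis
  then have "(\<lambda>k. (real k + 1) * measure lebesgue (E k)) \<longlonglongrightarrow> 0"
    by (rule Lim_null_comparison[rotated]) (use pack in \<open>auto intro!: always_eventually\<close>)
  moreover have "measure lebesgue (E k) = measure lborel (E k)" for k
    using Eb by (simp add: measure_completion)
  ultimately show ?thesis by (simp add: E_def)
qed

section \<open>Perturbing along a proportional Hessian\<close>

lemma compact_subset_open_cball:
  fixes K :: "'a::euclidean_space set"
  assumes "compact K" "open U" "K \<subseteq> U"
  obtains d where "d > 0" "\<And>x. x \<in> K \<Longrightarrow> cball x d \<subseteq> U"
proof -
  obtain e where e: "e > 0" "(\<Union>x\<in>K. ball x e) \<subseteq> U"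
    by (rule compact_subset_open_imp_ball_epsilon_subset[OF assms])
  show ?thesis
  proof (rule that[of "e / 2"])
    fix x assume "x \<in> K"
    moreover have "cball x (e / 2) \<subseteq> ball x e" using e(1) by (simp add: cball_subset_ball_iff)
    ultimately show "cball x (e / 2) \<subseteq> U" using e(2) by blast
  qed (use e in simp)
qed

lemma moll_hess_measurable:
  fixes u :: "real^'n::finite \<Rightarrow> real"
  assumes "integrable lborel u" "d > 0"
  shows "moll_hess d u \<in> borel_measurable borel"
proof (rule matrix_measurableI)
  fix i j
  have "test_fun (partial_deriv i (partial_deriv j (mollifier d)) :: real^'n \<Rightarrow> real)"
    by (intro test_fun_partial_deriv test_fun_mollifier assms)
  from borel_measurable_continuous_onI[OF smooth_continuous[OF smooth_conv[OF assms(1) this]]]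
  show "(\<lambda>x. moll_hess d u x $ i $ j) \<in> borel_measurable borel"
    by (simp add: moll_hess_def)
qed

lemma hess_pairing_LIMSEQ:
  assumes u: "integrable lborel u" and F: "F \<in> test_fields A"
  shows "(\<lambda>k. LINT y|lborel. F y \<bullet> moll_hess (1 / (real k + 1)) u y) \<longlonglongrightarrow> hess_pairing u F"
proof (rule LIMSEQ_I)
  fix r :: real assume r: "r > 0"
  have "\<exists>d0>0. \<forall>d. 0 < d \<and> d < d0 \<longrightarrow> \<bar>(LINT y|lborel. F y \<bullet> moll_hess d u y) - hess_pairing u F\<bar> \<le> r / 2"
    using hess_pairing_eq_limit[OF u F, of "r / 2"] r by (metis half_gt_zero)
  then obtain d0 where d0: "d0 > 0"
    "\<And>d. 0 < d \<Longrightarrow> d < d0 \<Longrightarrow> \<bar>(LINT y|lborel. F y \<bullet> moll_hess d u y) - hess_pairing u F\<bar> \<le> r / 2" by blast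
  obtain N :: nat where N: "real N > 1 / d0" using reals_Archimedean2 by blast
  have "norm ((LINT y|lborel. F y \<bullet> moll_hess (1 / (real k + 1)) u y) - hess_pairing u F) < r" if "k \<ge> N" for k
  proof -
    have "real k + 1 > 1 / d0" using N that by linarith
    then have "1 / (real k + 1) < d0" using d0(1) by (simp add: field_simps)
    from d0(2)[OF _ this] show ?thesis using r by simp
  qed
  then show "\<exists>no. \<forall>k\<ge>no. norm ((LINT y|lborel. F y \<bullet> moll_hess (1 / (real k + 1)) u y) - hess_pairing u F) < r"
    by blast
qed

lemma abs_inner_matrix_le:
  fixes M N :: "real^'n::finite^'n"
  assumes "contraction M" "\<And>i j. \<bar>N $ i $ j\<bar> \<le> c"
  shows "\<bar>M \<bullet> N\<bar> \<le> (real CARD('n))\<^sup>2 * c"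
proof -
  have "\<bar>M \<bullet> N\<bar> = \<bar>\<Sum>i\<in>UNIV. \<Sum>j\<in>UNIV. M $ i $ j * N $ i $ j\<bar>" by (simp add: inner_vec_def)
  also have "\<dots> \<le> (\<Sum>i\<in>UNIV. \<Sum>j\<in>UNIV. \<bar>M $ i $ j * N $ i $ j\<bar>)"
    by (rule order_trans[OF sum_abs]) (intro sum_mono sum_abs)
  also have "\<dots> \<le> (\<Sum>i\<in>(UNIV::'n set). \<Sum>j\<in>(UNIV::'n set). 1 * c)"
    unfolding abs_mult by (intro sum_mono mult_mono contraction_component_le assms) auto
  also have "\<dots> = (real CARD('n))\<^sup>2 * c" by (simp add: power2_eq_square)
  finally show ?thesis .
qed

context piecewise_affine_pair
begin

text \<open>The points of the ball violating the uniqueness hypothesis of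
  \<open>moll_hess_proportional\<close> at scale \<open>d\<close>. Pairs of parallel hyperplanes
  contribute nothing once \<open>d\<close> is small.\<close>

definition skeleton_nbhd :: "real \<Rightarrow> real \<Rightarrow> (real^'n) set" where
  "skeleton_nbhd R d = {y \<in> ball 0 R. \<exists>p\<in>H. \<exists>q\<in>H. p \<noteq> q \<and> \<bar>lf p y\<bar> < d \<and> \<bar>lf q y\<bar> < d}"

lemma skeleton_nbhd_eq:
  "skeleton_nbhd R d = (\<Union>(p, q)\<in>{(p, q). p \<in> H \<and> q \<in> H \<and> p \<noteq> q}. {y \<in> ball 0 R. \<bar>lf p y\<bar> < d \<and> \<bar>lf q y\<bar> < d})"
  unfolding skeleton_nbhd_def by blast

lemma finite_pairs: "finite {(p, q). p \<in> H \<and> q \<in> H \<and> p \<noteq> q}"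
  by (rule finite_subset[of _ "H \<times> H"]) (auto simp: G.finite_H)

lemma skeleton_nbhd_measurable: "skeleton_nbhd R d \<in> sets borel"
  unfolding skeleton_nbhd_eq by (intro sets.finite_UN finite_pairs) (clarsimp, measurable)

lemma skeleton_nbhd_volume: "(\<lambda>k. (real k + 1) * measure lborel (skeleton_nbhd R (1 / (real k + 1)))) \<longlonglongrightarrow> 0"
proof -
  let ?P = "{(p, q). p \<in> H \<and> q \<in> H \<and> p \<noteq> q}"
  let ?E = "\<lambda>k p q. {y \<in> ball 0 R. \<bar>lf p y\<bar> < 1 / (real k + 1) \<and> \<bar>lf q y\<bar> < 1 / (real k + 1)}"
  have "(\<lambda>k. \<Sum>(p, q)\<in>?P. (real k + 1) * measure lborel (?E k p q)) \<longlonglongrightarrow> (\<Sum>(p, q)\<in>?P. 0)"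
  proof (rule tendsto_sum)
    fix pq assume "pq \<in> ?P"
    then obtain p q where pq: "pq = (p, q)" "p \<in> H" "q \<in> H" "p \<noteq> q" by blast
    then have "q \<noteq> (- fst p, - snd p)" using G.antipodal by blast
    from two_slabs_volume[OF G.unit_normal[OF pq(2)] G.unit_normal[OF pq(3)] pq(4) this, of R]
    show "(\<lambda>k. case pq of (p, q) \<Rightarrow> (real k + 1) * measure lborel (?E k p q)) \<longlonglongrightarrow> (case pq of (p, q) \<Rightarrow> 0)"
      unfolding pq(1) prod.case .
  qed
  then have lim: "(\<lambda>k. \<Sum>(p, q)\<in>?P. (real k + 1) * measure lborel (?E k p q)) \<longlonglongrightarrow> 0"
    by simp
  show ?thesis
  proof (rule Lim_null_comparison[OF always_eventually[OF allI] lim])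
    fix k
    have "measure lborel (skeleton_nbhd R (1 / (real k + 1))) \<le> (\<Sum>pq\<in>?P. measure lborel (case pq of (p, q) \<Rightarrow> ?E k p q))"
      unfolding skeleton_nbhd_eq
      by (rule measure_UNION_le[OF finite_pairs]) (clarsimp, measurable)
    then have "(real k + 1) * measure lborel (skeleton_nbhd R (1 / (real k + 1)))
        \<le> (real k + 1) * (\<Sum>pq\<in>?P. measure lborel (case pq of (p, q) \<Rightarrow> ?E k p q))"
      by (rule mult_left_mono) simp
    also have "\<dots> = (\<Sum>(p, q)\<in>?P. (real k + 1) * measure lborel (?E k p q))"
      unfolding sum_distrib_left by (intro sum.cong refl) auto
    finally show "norm ((real k + 1) * measure lborel (skeleton_nbhd R (1 / (real k + 1))))
        \<le> (\<Sum>(p, q)\<in>?P. (real k + 1) * measure lborel (?E k p q))" by simp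
  qed
qed

text \<open>Away from the neighbourhood of the codimension-two skeleton the mollified Hessian of \<open>h\<close> is \<open>l y\<close>
  times that of \<open>g\<close>, so the left-hand side tests the Hessian of \<open>g\<close> with twice a convex combination
  of \<open>F\<close> and \<open>F'\<close>. That combination is only measurable, but mollifying it gives a test field again.\<close>

lemma perturbed_pairing_le:
  assumes U: "convex U" and \<eta>: "\<eta> \<ge> 0" "\<eta> * ratio_bound \<le> 1"
    and F: "F \<in> test_fields U" and F': "F' \<in> test_fields U"
  shows "hess_pairing g F + hess_pairing g F' + \<eta> * (hess_pairing h F - hess_pairing h F') \<le> 2 * Vg"
proof -
  obtain K1 where K1: "compact K1" "K1 \<subseteq> U" "\<forall>x. x \<notin> K1 \<longrightarrow> F x = 0" using F by (rule test_fieldsE)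
  obtain K2 where K2: "compact K2" "K2 \<subseteq> U" "\<forall>x. x \<notin> K2 \<longrightarrow> F' x = 0" using F' by (rule test_fieldsE)
  define K where "K = K1 \<union> K2"
  have K: "compact K" "K \<subseteq> U" "\<And>x. x \<notin> K \<Longrightarrow> F x = 0" "\<And>x. x \<notin> K \<Longrightarrow> F' x = 0"
    using K1 K2 by (auto simp: K_def)
  have Kb: "K \<in> sets borel" using compact_imp_closed[OF K(1)] by simp
  obtain d1 where d1: "d1 > 0" "\<And>x. x \<in> K \<Longrightarrow> cball x d1 \<subseteq> U"
    using compact_subset_open_cball[OF K(1) G.open_U K(2)] by blast
  obtain R where R: "K \<subseteq> ball 0 R"
    using compact_imp_bounded[OF K(1)] bounded_subset_ballD by blast
  interpret F: bounded_field F K by (rule test_fields_bounded_field[OF F K(1,3)])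
  interpret F': bounded_field F' K by (rule test_fields_bounded_field[OF F' K(1,4)])
  obtain Cg where Cg: "Cg \<ge> 0" "\<And>d y i j. d > 0 \<Longrightarrow> ball y d \<subseteq> U \<Longrightarrow> \<bar>moll_hess d g y $ i $ j\<bar> \<le> Cg / d"
    using G.moll_hess_bound[OF U] by blast
  obtain Ch where Ch: "Ch \<ge> 0" "\<And>d y i j. d > 0 \<Longrightarrow> ball y d \<subseteq> U \<Longrightarrow> \<bar>moll_hess d h y $ i $ j\<bar> \<le> Ch / d"
    using h.moll_hess_bound[OF U] by blast
  \<comment> \<open>\<open>D / d\<close> bounds the tested integrand on the skeleton neighbourhood:
    two terms of size \<open>Cg / d\<close> and two of size \<open>\<eta> * Ch / d\<close>, each
    with \<open>n^2\<close> entries.\<close>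
  define D where "D = 2 * (real CARD('n))\<^sup>2 * (Cg + \<eta> * Ch)"
  have D: "D \<ge> 0" using Cg(1) Ch(1) \<eta>(1) by (simp add: D_def)
  define J where "J d = (LINT y|lborel. F y \<bullet> moll_hess d g y) + (LINT y|lborel. F' y \<bullet> moll_hess d g y)
    + \<eta> * ((LINT y|lborel. F y \<bullet> moll_hess d h y) - (LINT y|lborel. F' y \<bullet> moll_hess d h y))" for d
  have J: "J d \<le> 2 * Vg + D * ((1 / d) * measure lborel (skeleton_nbhd R d))" if d: "0 < d" "d < d1" for d
  proof -
    let ?B = "skeleton_nbhd R d"
    let ?g = "moll_hess d g" and ?h = "moll_hess d h"
    have sub: "cball y d \<subseteq> U" if "y \<in> K" for y
      using d1(2)[OF that] d(2) by (meson cball_subset_cball_iff less_imp_le order_trans subset_cball)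
    then have bsub: "ball y d \<subseteq> U" if "y \<in> K" for y
      using that ball_subset_cball by blast
    \<comment> \<open>An explicit quotient is visibly Borel. Where the Hessian of \<open>g\<close>
      vanishes off the skeleton neighbourhood, the default value 0 is right, because that of
      \<open>h\<close> vanishes as well.\<close>
    define l where "l y = (?h y \<bullet> ?g y) / (?g y \<bullet> ?g y)" for y
    have gm: "?g \<in> borel_measurable borel" and hm: "?h \<in> borel_measurable borel"
      using moll_hess_measurable d(1) G.integrable h.integrable by blast+
    have lm: "l \<in> borel_measurable borel"
      unfolding l_def[abs_def] by (intro borel_measurable_divide borel_measurable_inner gm hm)
    have good: "\<bar>l y\<bar> \<le> ratio_bound" "?h y = l y *\<^sub>R ?g y" if y: "y \<in> K" "y \<notin> ?B" for y
    proof -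
      have yR: "y \<in> ball 0 R" using R y(1) by blast
      have "p = q" if "p \<in> H" "q \<in> H" "\<bar>lf p y\<bar> < d" "\<bar>lf q y\<bar> < d" for p q
        using y(2) yR that by (auto simp: skeleton_nbhd_def)
      from moll_hess_proportional[OF d(1) bsub[OF y(1)] this]
      obtain l' where l': "\<bar>l'\<bar> \<le> ratio_bound" "?h y = l' *\<^sub>R ?g y" by blast
      have "\<bar>l y\<bar> \<le> ratio_bound \<and> ?h y = l y *\<^sub>R ?g y"
      proof (cases "?g y = 0")
        case True
        then show ?thesis using l'(2) ratio_bound_nonneg by (simp add: l_def)
      next
        case False
        then have "l y = l'" using l'(2) by (simp add: l_def)
        then show ?thesis using l' by simp
      qed
      then show "\<bar>l y\<bar> \<le> ratio_bound" "?h y = l y *\<^sub>R ?g y" by blast+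
    qed
    \<comment> \<open>Half the field that tests the Hessian of \<open>g\<close> once that of
      \<open>h\<close> is replaced by \<open>l y\<close> times it; the weights are nonnegative with
      sum 1 because \<open>\<eta> * |l y| \<le> 1\<close>. The bad set is left out and paid for by
      \<open>D\<close>.\<close>
    define M where "M y = (if y \<in> K - ?B then ((1 + \<eta> * l y) / 2) *\<^sub>R F y + ((1 - \<eta> * l y) / 2) *\<^sub>R F' y else 0)" for y
    interpret M: bounded_field M K
    proof
      show "M \<in> borel_measurable borel"
        unfolding M_def[abs_def]
        by (intro measurable_If_set borel_measurable_add borel_measurable_scaleR borel_measurable_divide
            borel_measurable_diff borel_measurable_times borel_measurable_const lm F.measurable F'.measurable)
          (use Kb skeleton_nbhd_measurable[of R d] in auto)
      show "contraction (M y)" for y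
      proof (cases "y \<in> K - ?B")
        case True
        have "\<bar>\<eta> * l y\<bar> \<le> \<eta> * ratio_bound"
          using good(1)[of y] True \<eta>(1) by (auto simp: abs_mult intro: mult_left_mono)
        then have "\<bar>\<eta> * l y\<bar> \<le> 1" using \<eta>(2) by linarith
        then have "0 \<le> 1 + \<eta> * l y" "0 \<le> 1 - \<eta> * l y" by linarith+
        then have "\<bar>(1 + \<eta> * l y) / 2\<bar> + \<bar>(1 - \<eta> * l y) / 2\<bar> \<le> 1" by (simp add: field_simps)
        from contraction_convex_combination[OF F.contraction F'.contraction this] True
        show ?thesis by (simp add: M_def)
      qed (auto simp: M_def)
    qed (auto simp: M_def K(1))
    let ?S = "\<lambda>y. F y \<bullet> ?g y + F' y \<bullet> ?g y + \<eta> * (F y \<bullet> ?h y - F' y \<bullet> ?h y)"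
    note i1 = F.hess_pairing_conv_field(1)[OF G.integrable d(1)] and i2 = F'.hess_pairing_conv_field(1)[OF G.integrable d(1)]
      and i3 = F.hess_pairing_conv_field(1)[OF h.integrable d(1)] and i4 = F'.hess_pairing_conv_field(1)[OF h.integrable d(1)]
    have iS: "integrable lborel ?S"
      by (intro Bochner_Integration.integrable_add Bochner_Integration.integrable_diff integrable_mult_right i1 i2 i3 i4)
    have iB: "integrable lborel (indicator ?B :: real^'n \<Rightarrow> real)"
    proof -
      have "bounded ?B" by (rule bounded_subset[OF bounded_ball[of 0 R]]) (auto simp: skeleton_nbhd_def)
      then show ?thesis using skeleton_nbhd_measurable emeasure_bounded_finite
        by (intro integrable_real_indicator) auto
    qed
    have iM: "integrable lborel (\<lambda>y. M y \<bullet> ?g y)" by (rule M.hess_pairing_conv_field(1)[OF G.integrable d(1)])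
    have "J d = (LINT y|lborel. ?S y)"
      unfolding J_def using i1 i2 i3 i4 by simp
    also have "\<dots> \<le> (LINT y|lborel. 2 * (M y \<bullet> ?g y) + (D / d) * indicator ?B y)"
    proof (rule integral_mono[OF iS])
      show "integrable lborel (\<lambda>y. 2 * (M y \<bullet> ?g y) + (D / d) * indicator ?B y)"
        by (intro Bochner_Integration.integrable_add integrable_mult_right iM iB)
      fix y
      consider "y \<notin> K" | "y \<in> K" "y \<notin> ?B" | "y \<in> K" "y \<in> ?B" by blast
      then show "?S y \<le> 2 * (M y \<bullet> ?g y) + (D / d) * indicator ?B y"
      proof cases
        case 1
        then show ?thesis using D d(1) by (simp add: K(3,4) M_def)
      next
        case 2
        have hy: "x \<bullet> ?h y = l y * (x \<bullet> ?g y)" for x using good(2)[OF 2] by (metis inner_scaleR_right)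
        show ?thesis using 2 unfolding hy by (simp add: M_def inner_add_left field_simps)
      next
        case 3
        have bg: "\<bar>?g y $ i $ j\<bar> \<le> Cg / d" and bh: "\<bar>?h y $ i $ j\<bar> \<le> Ch / d" for i j
          using Cg(2) Ch(2) d(1) bsub[OF 3(1)] by blast+
        let ?n = "(real CARD('n))\<^sup>2"
        have "\<bar>F y \<bullet> ?g y\<bar> \<le> ?n * (Cg / d)" "\<bar>F' y \<bullet> ?g y\<bar> \<le> ?n * (Cg / d)"
          "\<bar>F y \<bullet> ?h y\<bar> \<le> ?n * (Ch / d)" "\<bar>F' y \<bullet> ?h y\<bar> \<le> ?n * (Ch / d)"
          by (intro abs_inner_matrix_le F.contraction F'.contraction bg bh)+
        then have "F y \<bullet> ?g y + F' y \<bullet> ?g y \<le> 2 * (?n * (Cg / d))" "F y \<bullet> ?h y - F' y \<bullet> ?h y \<le> 2 * (?n * (Ch / d))"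
          by linarith+
        then have "?S y \<le> 2 * (?n * (Cg / d)) + \<eta> * (2 * (?n * (Ch / d)))"
          using \<eta>(1) by (intro add_mono mult_left_mono)
        also have "\<dots> = D / d" unfolding D_def divide_inverse by algebra
        finally show ?thesis using 3 by (simp add: M_def)
      qed
    qed
    also have "\<dots> = 2 * (LINT y|lborel. M y \<bullet> ?g y) + (D / d) * measure lborel ?B"
      using iM iB skeleton_nbhd_measurable by simp
    also have "\<dots> \<le> 2 * Vg + (D / d) * measure lborel ?B"
      using M.integral_moll_hess_le[OF G.integrable d(1) sub G.variation] by simp
    finally show ?thesis by simp
  qed
  have "(\<lambda>k. J (1 / (real k + 1))) \<longlonglongrightarrow> hess_pairing g F + hess_pairing g F' + \<eta> * (hess_pairing h F - hess_pairing h F')"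
    unfolding J_def
    by (intro tendsto_add tendsto_mult tendsto_diff tendsto_const
        hess_pairing_LIMSEQ[OF G.integrable F] hess_pairing_LIMSEQ[OF G.integrable F']
        hess_pairing_LIMSEQ[OF h.integrable F] hess_pairing_LIMSEQ[OF h.integrable F'])
  moreover have "(\<lambda>k. 2 * Vg + D * ((real k + 1) * measure lborel (skeleton_nbhd R (1 / (real k + 1))))) \<longlonglongrightarrow> 2 * Vg + D * 0"
    by (intro tendsto_add tendsto_mult tendsto_const skeleton_nbhd_volume)
  moreover have "\<exists>N. \<forall>k\<ge>N. J (1 / (real k + 1)) \<le> 2 * Vg + D * ((real k + 1) * measure lborel (skeleton_nbhd R (1 / (real k + 1))))"
  proof -
    obtain N :: nat where N: "real N > 1 / d1" using reals_Archimedean2 by blast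
    have "J (1 / (real k + 1)) \<le> 2 * Vg + D * ((real k + 1) * measure lborel (skeleton_nbhd R (1 / (real k + 1))))" if "k \<ge> N" for k
    proof -
      have "real k + 1 > 1 / d1" using N that by linarith
      then have "1 / (real k + 1) < d1" using d1(1) by (simp add: field_simps)
      from J[OF _ this] show ?thesis by simp
    qed
    then show ?thesis by blast
  qed
  ultimately show ?thesis using LIMSEQ_le by fastforce
qed

end

section \<open>Hyperplane arrangements of continuous piecewise linear functions\<close>

lemma unit_cube_eq_box: "unit_cube = (box 0 1 :: (real^'n::finite) set)"
  by (auto simp: unit_cube_def mem_box_cart)

lemma unit_cube_facts:
  "open (unit_cube :: (real^'n::finite) set)" "convex (unit_cube :: (real^'n) set)"
  "bounded (unit_cube :: (real^'n) set)" "(unit_cube :: (real^'n) set) \<in> sets borel"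
  by (simp_all add: unit_cube_eq_box open_box)

lemma polyhedron_unit_normals:
  fixes P :: "(real^'n::finite) set"
  assumes "polyhedron P"
  shows "\<exists>N. finite N \<and> (\<forall>p\<in>N. norm (fst p) = 1) \<and> P = {x. \<forall>p\<in>N. lf p x \<le> 0}"
proof -
  obtain F where F: "finite F" "P = \<Inter>F" "\<forall>h\<in>F. \<exists>a b. a \<noteq> 0 \<and> h = {x. a \<bullet> x \<le> b}"
    using assms unfolding polyhedron_def by blast
  then obtain a b where ab: "\<And>h. h \<in> F \<Longrightarrow> a h \<noteq> 0" "\<And>h. h \<in> F \<Longrightarrow> h = {x. a h \<bullet> x \<le> b h}"
    by metis
  define q where "q h = (a h /\<^sub>R norm (a h), b h / norm (a h))" for h
  have h: "x \<in> h \<longleftrightarrow> lf (q h) x \<le> 0" if "h \<in> F" for h x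
  proof -
    have "norm (a h) > 0" using ab(1)[OF that] by simp
    moreover have "lf (q h) x = (a h \<bullet> x - b h) / norm (a h)"
      unfolding lf_def q_def by (simp add: diff_divide_distrib inverse_eq_divide)
    ultimately have "lf (q h) x \<le> 0 \<longleftrightarrow> a h \<bullet> x \<le> b h"
      by (simp add: divide_le_0_iff)
    then show ?thesis using ab(2)[OF that] by blast
  qed
  show ?thesis
  proof (intro exI[of _ "q ` F"] conjI)
    show "finite (q ` F)" using F(1) by simp
    show "\<forall>p\<in>q ` F. norm (fst p) = 1" using ab(1) by (auto simp: q_def)
    show "P = {x. \<forall>p\<in>q ` F. lf p x \<le> 0}" using F(2) h by auto
  qed
qed

lemma lf_uminus: "lf (- p) x = - lf p x"
  by (simp add: lf_def)

text \<open>Finitely many polytopes meet a ball around the cube. The arrangement consists of the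
  boundary hyperplanes of their defining half spaces, so a sign pattern decides membership in each
  of these polytopes, and one polytope serves for a whole cell.\<close>

lemma cpwl_arrangement:
  fixes f :: "real^'n::finite \<Rightarrow> real"
  assumes "f \<in> cpwl unit_cube"
  shows "\<exists>H A B. arrangement H \<and>
    (\<forall>x\<in>unit_cube. (\<forall>p\<in>H. lf p x \<noteq> 0) \<longrightarrow> f x = A (pos_set H x) \<bullet> x + B (pos_set H x))"
proof -
  obtain \<P> where \<P>: "\<Union>\<P> = (UNIV :: (real^'n) set)" "\<forall>P\<in>\<P>. polytope P \<and> aff_dim P = int CARD('n)"
    "\<forall>P\<in>\<P>. \<exists>a b. \<forall>x\<in>P \<inter> unit_cube. f x = a \<bullet> x + b"
    "\<forall>x r. finite {P\<in>\<P>. P \<inter> ball x r \<noteq> {}}"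
    using assms unfolding cpwl_def by (elim CollectE conjE exE) (rule that; assumption)
  obtain r where r: "(unit_cube :: (real^'n) set) \<subseteq> ball 0 r"
    using bounded_subset_ballD[OF unit_cube_facts(3)] by blast
  define Q where "Q = {P\<in>\<P>. P \<inter> ball 0 r \<noteq> {}}"
  have Q: "finite Q" unfolding Q_def using \<P>(4) by blast
  have "\<forall>P\<in>Q. \<exists>N. finite N \<and> (\<forall>p\<in>N. norm (fst p) = 1) \<and> P = {x. \<forall>p\<in>N. lf p x \<le> 0}"
    using \<P>(2) polytope_imp_polyhedron polyhedron_unit_normals by (auto simp: Q_def)
  from bchoice[OF this] obtain N
    where NQ: "\<forall>P\<in>Q. finite (N P) \<and> (\<forall>p\<in>N P. norm (fst p) = 1) \<and> P = {x. \<forall>p\<in>N P. lf p x \<le> 0}" ..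
  have N: "finite (N P)" "\<And>p. p \<in> N P \<Longrightarrow> norm (fst p) = 1" "P = {x. \<forall>p\<in>N P. lf p x \<le> 0}"
    if "P \<in> Q" for P
    using bspec[OF NQ that] by (elim conjE; simp)+
  define I where "I = (\<Union>P\<in>Q. N P)"
  \<comment> \<open>The choice depends only on the unordered pair of \<open>p\<close> and
    \<open>- p\<close>, so of the two descriptions of a hyperplane exactly one is kept.\<close>
  define s where "s p = (SOME q. q = p \<or> q = - p)" for p :: "(real^'n) \<times> real"
  have s: "s p = p \<or> s p = - p" for p
    unfolding s_def by (rule someI[of _ p]) simp
  have sm: "s (- p) = s p" for p
  proof -
    have "(\<lambda>q. q = - p \<or> q = - (- p)) = (\<lambda>q. q = p \<or> q = - p)" by auto
    then show ?thesis unfolding s_def by simp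
  qed
  define H where "H = s ` I"
  have arr: "arrangement H"
  proof
    show "finite H" unfolding H_def I_def using Q N(1) by blast
    show unit: "norm (fst p) = 1" if p: "p \<in> H" for p
    proof -
      obtain p' P where p': "P \<in> Q" "p' \<in> N P" "p = s p'" using p by (auto simp: H_def I_def)
      have "norm (fst p) = norm (fst p')" using s[of p'] p'(3) by auto
      then show ?thesis using N(2)[OF p'(1,2)] by simp
    qed
    show "(- fst p, - snd p) \<notin> H" if p: "p \<in> H" for p
    proof
      assume "(- fst p, - snd p) \<in> H"
      then obtain b where b: "- p = s b" by (auto simp: H_def uminus_prod_def)
      obtain a where a: "p = s a" using p by (auto simp: H_def)
      have "s p = s a" using s[of a] a sm by metis
      moreover have "s (- p) = s b" using s[of b] b sm by metis
      ultimately have "s a = s b" using sm by simp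
      then have "p = - p" using a b by simp
      then have "fst p = - fst p" by (metis fst_uminus)
      then have "fst p = 0" by (auto simp: vec_eq_iff)
      then show False using unit[OF p] by simp
    qed
  qed
  have same: "lf p x > 0 \<longleftrightarrow> lf p y > 0" "lf p x \<noteq> 0"
    if p: "p \<in> I" and x: "\<forall>q\<in>H. lf q x \<noteq> 0" and y: "\<forall>q\<in>H. lf q y \<noteq> 0" and e: "pos_set H x = pos_set H y" for p x y
  proof -
    have sp: "s p \<in> H" using p by (simp add: H_def)
    have "lf (s p) x > 0 \<longleftrightarrow> lf (s p) y > 0" using e sp unfolding pos_set_def by blast
    moreover have "lf (s p) x \<noteq> 0" "lf (s p) y \<noteq> 0" using x y sp by blast+
    moreover have "lf (s p) z = lf p z \<or> lf (s p) z = - lf p z" for z using s[of p] lf_uminus[of p z] by auto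
    ultimately show "lf p x > 0 \<longleftrightarrow> lf p y > 0" "lf p x \<noteq> 0"
      using s[of p] lf_uminus[of p x] lf_uminus[of p y] by auto
  qed
  \<comment> \<open>Any point \<open>x0\<close> of the cell selects a polytope, which then contains
    the entire cell; for empty cells any coefficients do.\<close>
  have "\<exists>a b. \<forall>x\<in>unit_cube. (\<forall>p\<in>H. lf p x \<noteq> 0) \<and> pos_set H x = S \<longrightarrow> f x = a \<bullet> x + b" for S
  proof (cases "\<exists>x0\<in>unit_cube. (\<forall>p\<in>H. lf p x0 \<noteq> 0) \<and> pos_set H x0 = S")
    case True
    then obtain x0 where x0: "x0 \<in> unit_cube" "\<forall>p\<in>H. lf p x0 \<noteq> 0" "pos_set H x0 = S" by blast
    obtain P where P: "P \<in> \<P>" "x0 \<in> P" using \<P>(1) by blast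
    have PQ: "P \<in> Q" using P x0(1) r by (auto simp: Q_def)
    obtain a b where ab: "\<forall>x\<in>P \<inter> unit_cube. f x = a \<bullet> x + b" using \<P>(3) P(1) by blast
    have "x \<in> P" if x: "\<forall>p\<in>H. lf p x \<noteq> 0" "pos_set H x = S" for x
    proof -
      have "lf p x \<le> 0" if "p \<in> N P" for p
      proof -
        have "p \<in> I" using that PQ by (auto simp: I_def)
        moreover have "lf p x0 \<le> 0" using P(2) N(3)[OF PQ] that by blast
        ultimately show ?thesis using same[of p x x0] x x0(2,3) by force
      qed
      then show ?thesis using N(3)[OF PQ] by blast
    qed
    then show ?thesis using ab by blast
  qed blast
  then obtain A B where "\<And>S x. x \<in> unit_cube \<Longrightarrow> \<forall>p\<in>H. lf p x \<noteq> 0 \<Longrightarrow> pos_set H x = S \<Longrightarrow> f x = A S \<bullet> x + B S"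
    by metis
  with arr show ?thesis by blast
qed

section \<open>Representatives and supports\<close>

text \<open>Extension by zero off the cube, followed by a Borel modification on a null set:
  convolution and Fubini are carried out over \<open>lborel\<close> on the whole space.\<close>

lemma borel_representative:
  fixes f :: "real^'n::finite \<Rightarrow> real"
  assumes f: "f absolutely_integrable_on unit_cube"
  shows "\<exists>u. integrable lborel u \<and> eq_mod_affine u f \<and> (AE x in lborel. x \<in> unit_cube \<longrightarrow> u x = f x)"
proof -
  let ?w = "\<lambda>x. indicator unit_cube x *\<^sub>R f x"
  have w: "integrable lebesgue ?w" using f by (simp add: set_integrable_def)
  obtain u where u: "u \<in> borel_measurable lborel" "AE x in lborel. ?w x = u x"
    using completion_ex_borel_measurable_real[of ?w lborel] w borel_measurable_integrable by blast
  have ul: "integrable lebesgue u"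
  proof (rule integrable_cong_AE_imp[OF w])
    show "u \<in> borel_measurable lebesgue" using u(1) by (rule measurable_completion)
    show "AE x in lebesgue. ?w x = u x" by (rule AE_completion[OF u(2)])
  qed
  have ui: "integrable lborel u" using ul u(1) integrable_completion by blast
  have ae: "AE x in lborel. x \<in> unit_cube \<longrightarrow> u x = f x"
    using u(2) by (elim AE_mp) (auto intro!: AE_I2)
  have ua: "u absolutely_integrable_on unit_cube"
  proof -
    have "integrable lborel (\<lambda>x. indicator unit_cube x *\<^sub>R u x)"
      using integrable_mult_indicator[OF _ ui] unit_cube_facts(4) by simp
    then have "integrable lebesgue (\<lambda>x. indicator unit_cube x *\<^sub>R u x)"
      by (subst integrable_completion) auto
    then show ?thesis by (simp add: set_integrable_def)
  qed
  have "eq_mod_affine u f"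
    by (rule eq_mod_affineI[OF ua f, where a = 0 and b = 0])
      (use AE_completion[OF ae] in simp)
  with ui ae show ?thesis by blast
qed

lemma hess_pairing_affine_eq_0:
  fixes u :: "real^'n::finite \<Rightarrow> real"
  assumes u: "integrable lborel u" and W: "AE x in lborel. x \<in> W \<longrightarrow> u x = a \<bullet> x + b" and F: "F \<in> test_fields W"
  shows "hess_pairing u F = 0"
proof -
  obtain K where K: "compact K" "K \<subseteq> W" "\<forall>x. x \<notin> K \<longrightarrow> F x = 0" using F by (rule test_fieldsE)
  have tm: "test_matrix F" by (rule test_fields_test_matrix[OF F])
  let ?D = "\<lambda>i j. partial_deriv i (partial_deriv j (\<lambda>y. F y $ i $ j))"
  have D0: "?D i j x = 0" if "x \<notin> K" for i j x
    by (rule partial_deriv_zero_outside[of K], use K in \<open>simp add: compact_imp_closed\<close>,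
        rule partial_deriv_zero_outside[of K]) (use K that in \<open>auto simp: compact_imp_closed\<close>)
  have cont: "continuous_on UNIV (?D i j)" for i j
    by (intro test_fun_continuous test_fun_partial_deriv test_matrixD tm)
  have int: "integrable lborel (\<lambda>x. (a \<bullet> x + b) * ?D i j x)" for i j
    by (rule integrable_compact_support[OF _ K(1)]) (use cont D0 in \<open>auto intro!: continuous_intros\<close>)
  have "hess_pairing u F = (LINT x|lborel. (\<Sum>i\<in>UNIV. \<Sum>j\<in>UNIV. (a \<bullet> x + b) * ?D i j x))"
    unfolding hess_pairing_def
  proof (rule integral_cong_AE)
    show "(\<lambda>x. u x * hess_div F x) \<in> borel_measurable lborel"
      using integrable_hess_pairing[OF u tm] by (rule borel_measurable_integrable)
    show "(\<lambda>x. \<Sum>i\<in>UNIV. \<Sum>j\<in>UNIV. (a \<bullet> x + b) * ?D i j x) \<in> borel_measurable lborel"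
      by (intro borel_measurable_sum borel_measurable_integrable int)
    show "AE x in lborel. u x * hess_div F x = (\<Sum>i\<in>UNIV. \<Sum>j\<in>UNIV. (a \<bullet> x + b) * ?D i j x)"
      using W
    proof (rule AE_mp, intro AE_I2 impI)
      fix x assume "x \<in> W \<longrightarrow> u x = a \<bullet> x + b"
      then show "u x * hess_div F x = (\<Sum>i\<in>UNIV. \<Sum>j\<in>UNIV. (a \<bullet> x + b) * ?D i j x)"
        using K(2) by (cases "x \<in> K") (auto simp: hess_div_def sum_distrib_left D0)
    qed
  qed
  also have "\<dots> = 0"
    unfolding integral_sum2[OF int]
  proof (intro sum.neutral ballI)
    fix i j
    have "Ck 2 (\<lambda>y. F y $ i $ j)" using test_fun_smooth[OF test_matrixD[OF tm]] by (simp add: smooth_def)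
    then show "(LINT x|lborel. (a \<bullet> x + b) * ?D i j x) = 0"
      by (rule integral_affine_second_deriv_eq_0[OF _ K(1)]) (simp add: K(3))
  qed
  finally show ?thesis .
qed

lemma hessian_var_representative:
  assumes "integrable lborel u" "eq_mod_affine u f"
  shows "hessian_var (proj f) W = (SUP F\<in>test_fields (W \<inter> unit_cube). ereal (hess_pairing u F))"
proof -
  have "f absolutely_integrable_on unit_cube" using assms(2) by (rule eq_mod_affineE)
  then have "hessian_var (proj f) W = hessian_variation f (W \<inter> unit_cube)" by (rule hessian_var_proj)
  also have "\<dots> = hessian_variation u (W \<inter> unit_cube)"
    by (rule hessian_variation_cong_mod_affine[OF assms(2), symmetric]) simp
  also have "\<dots> = (SUP F\<in>test_fields (W \<inter> unit_cube). ereal (hess_pairing u F))"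
    using assms(1) by (intro hessian_variation_eq) auto
  finally show ?thesis .
qed

text \<open>Where \<open>ug\<close> is affine its Hessian vanishes, so \<open>z\<close> is off both
  supports. Near \<open>z\<close> the pairings of \<open>uh\<close> are nonpositive for
  \<open>F\<close> and \<open>- F\<close> alike, hence zero, and vanishing Hessian means
  affine.\<close>

lemma support_affine_transfer:
  fixes ug uh f1 f2 :: "real^'n::finite \<Rightarrow> real"
  assumes g: "integrable lborel ug" "eq_mod_affine ug f1" and h: "integrable lborel uh" "eq_mod_affine uh f2"
    and supp: "hessian_support (proj f2) \<subseteq> hessian_support (proj f1)"
    and W: "open W" "W \<subseteq> unit_cube" "AE y in lborel. y \<in> W \<longrightarrow> ug y = a \<bullet> y + b" and z: "z \<in> W"
  shows "\<exists>r>0. \<exists>a b. AE y in lborel. y \<in> ball z r \<longrightarrow> uh y = a \<bullet> y + b"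
proof -
  have WW: "W \<inter> unit_cube = W" using W(2) by blast
  have "hessian_var (proj f1) W \<le> 0"
    unfolding hessian_var_representative[OF g] WW
    by (rule SUP_least) (simp add: hess_pairing_affine_eq_0[OF g(1) W(3)])
  then have "\<not> hessian_var (proj f1) W > 0" by simp
  then have "z \<notin> hessian_support (proj f1)"
    using W(1,2) z unfolding hessian_support_def by blast
  then have "z \<notin> hessian_support (proj f2)" using supp by blast
  then obtain U where U: "open U" "U \<subseteq> unit_cube" "z \<in> U" "\<not> hessian_var (proj f2) U > 0"
    using z W(2) unfolding hessian_support_def by blast
  have UU: "U \<inter> unit_cube = U" using U(2) by blast
  have le: "hess_pairing uh F \<le> 0" if "F \<in> test_fields U" for F
  proof -
    have "ereal (hess_pairing uh F) \<le> hessian_var (proj f2) U"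
      unfolding hessian_var_representative[OF h] UU by (rule SUP_upper[OF that])
    then have "ereal (hess_pairing uh F) \<le> 0" using U(4) by (metis le_less_trans not_less)
    then show ?thesis by simp
  qed
  have "hess_pairing uh F = 0" if F: "F \<in> test_fields U" for F
    using le[OF F] le[OF test_fields_uminus[OF F]]
    by (simp add: hess_pairing_uminus_field[OF test_fields_test_matrix[OF F]])
  from affine_of_zero_hessian[OF h(1) U(1,3) this] show ?thesis by metis
qed

text \<open>Affine functions agreeing almost everywhere on an open overlap are equal, so the local
  coefficients are locally constant and, by connectedness, constant. A countable subcover keeps the
  exceptional set null.\<close>

lemma locally_affine_imp_affine:
  fixes u :: "real^'n::finite \<Rightarrow> real"
  assumes C: "convex C" "open C"
    and loc: "\<And>x. x \<in> C \<Longrightarrow> \<exists>r>0. \<exists>a b. AE y in lborel. y \<in> ball x r \<longrightarrow> u y = a \<bullet> y + b"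
  shows "\<exists>a b. AE y in lborel. y \<in> C \<longrightarrow> u y = a \<bullet> y + b"
proof (cases "C = {}")
  case False
  then obtain x0 where x0: "x0 \<in> C" by blast
  let ?P = "\<lambda>x t. fst t > 0 \<and> (AE y in lborel. y \<in> ball x (fst t) \<longrightarrow> u y = fst (snd t) \<bullet> y + snd (snd t))"
  have "\<forall>x\<in>C. \<exists>t. ?P x t"
  proof
    fix x assume "x \<in> C"
    then obtain r a b where "r > 0" "AE y in lborel. y \<in> ball x r \<longrightarrow> u y = a \<bullet> y + b" using loc by blast
    then show "\<exists>t. ?P x t" by (intro exI[of _ "(r, a, b)"]) simp
  qed
  from bchoice[OF this] obtain t where t: "\<forall>x\<in>C. ?P x (t x)" ..
  define r where "r x = fst (t x)" for x
  define a where "a x = fst (snd (t x))" for x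
  define b where "b x = snd (snd (t x))" for x
  have r: "r x > 0" and ab: "AE y in lborel. y \<in> ball x (r x) \<longrightarrow> u y = a x \<bullet> y + b x" if "x \<in> C" for x
    using bspec[OF t that] by (simp_all add: r_def a_def b_def)
  have same: "(a x, b x) = (a z, b z)" if "x \<in> C" "z \<in> C" "z \<in> ball x (r x)" for x z
  proof -
    let ?S = "ball x (r x) \<inter> ball z (r z)"
    have ae: "AE y in lborel. y \<in> ?S \<longrightarrow> a x \<bullet> y + b x = a z \<bullet> y + b z"
      using ab[OF that(1)] ab[OF that(2)] by (elim AE_mp) (auto intro!: AE_I2)
    have ne: "?S \<noteq> {}" using that(3) r[OF that(2)] by (metis IntI centre_in_ball empty_iff)
    from AE_affine_unique[OF open_Int[OF open_ball open_ball] ne ae] show ?thesis by simp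
  qed
  have const: "(a x, b x) = (a x0, b x0)" if "x \<in> C" for x
  proof (rule connected_local_const[OF convex_connected[OF C(1)] that x0], rule ballI)
    fix x assume x: "x \<in> C"
    show "\<forall>\<^sub>F z in at x within C. (a x, b x) = (a z, b z)"
      unfolding eventually_at
      using same[OF x] r[OF x] by (intro exI[of _ "r x"]) (auto simp: dist_commute)
  qed
  obtain F where F: "F \<subseteq> (\<lambda>x. ball x (r x)) ` C" "countable F" "\<Union>F = \<Union>((\<lambda>x. ball x (r x)) ` C)"
    using Lindelof[of "(\<lambda>x. ball x (r x)) ` C"] by blast
  have "AE y in lborel. \<forall>S\<in>F. y \<in> S \<longrightarrow> u y = a x0 \<bullet> y + b x0"
  proof (subst AE_ball_countable[OF F(2)], rule ballI)
    fix S assume "S \<in> F"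
    then obtain x where x: "x \<in> C" "S = ball x (r x)" using F(1) by blast
    then show "AE y in lborel. y \<in> S \<longrightarrow> u y = a x0 \<bullet> y + b x0" using ab[OF x(1)] const[OF x(1)] by simp
  qed
  then have "AE y in lborel. y \<in> C \<longrightarrow> u y = a x0 \<bullet> y + b x0"
  proof (rule AE_mp, intro AE_I2 impI)
    fix y assume *: "\<forall>S\<in>F. y \<in> S \<longrightarrow> u y = a x0 \<bullet> y + b x0" "y \<in> C"
    have "y \<in> \<Union>((\<lambda>x. ball x (r x)) ` C)" using *(2) r by force
    then show "u y = a x0 \<bullet> y + b x0" using * F(3) by blast
  qed
  then show ?thesis by blast
qed simp

lemma (in arrangement) cell_convex_open:
  assumes "convex U" "open U"
  shows "convex {x \<in> U. (\<forall>p\<in>H. lf p x \<noteq> 0) \<and> pos_set H x = S}"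
    "open {x \<in> U. (\<forall>p\<in>H. lf p x \<noteq> 0) \<and> pos_set H x = S}"
proof -
  have "convex {x \<in> U. (\<forall>p\<in>H. lf p x \<noteq> 0) \<and> pos_set H x = S} \<and> open {x \<in> U. (\<forall>p\<in>H. lf p x \<noteq> 0) \<and> pos_set H x = S}"
  proof (cases "S \<subseteq> H")
    case True
    have eq: "{x \<in> U. (\<forall>p\<in>H. lf p x \<noteq> 0) \<and> pos_set H x = S}
        = U \<inter> (\<Inter>p\<in>S. {x. fst p \<bullet> x > snd p}) \<inter> (\<Inter>p\<in>H - S. {x. fst p \<bullet> x < snd p})"
      (is "?L = ?R")
    proof (intro set_eqI iffI)
      fix x assume x: "x \<in> ?L"
      have "lf p x > 0" if "p \<in> S" for p using x that unfolding pos_set_def by blast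
      moreover have "lf p x < 0" if "p \<in> H - S" for p
      proof -
        have "\<not> lf p x > 0" "lf p x \<noteq> 0" using x that unfolding pos_set_def by blast+
        then show ?thesis by linarith
      qed
      ultimately show "x \<in> ?R" using x by (force simp: lf_def)
    next
      fix x assume x: "x \<in> ?R"
      have "lf p x \<noteq> 0 \<and> (lf p x > 0 \<longleftrightarrow> p \<in> S)" if "p \<in> H" for p
      proof (cases "p \<in> S")
        case True
        then have "lf p x > 0" using x by (auto simp: lf_def)
        with True show ?thesis by simp
      next
        case False
        then have "lf p x < 0" using x that by (auto simp: lf_def)
        with False show ?thesis by simp
      qed
      then show "x \<in> ?L" using x True unfolding pos_set_def by blast
    qed
    have "finite S" using True finite_H finite_subset by blast
    then show ?thesis unfolding eq
      by (intro conjI convex_Int convex_INT open_Int open_INT assms finite_Diff finite_H)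
        (auto intro: convex_halfspace_gt convex_halfspace_lt open_halfspace_gt open_halfspace_lt)
  next
    case False
    then have "{x \<in> U. (\<forall>p\<in>H. lf p x \<noteq> 0) \<and> pos_set H x = S} = {}" using pos_set_subset by blast
    then show ?thesis by (simp only: convex_empty open_empty)
  qed
  then show "convex {x \<in> U. (\<forall>p\<in>H. lf p x \<noteq> 0) \<and> pos_set H x = S}"
    "open {x \<in> U. (\<forall>p\<in>H. lf p x \<noteq> 0) \<and> pos_set H x = S}" by blast+
qed

section \<open>The characterisation of extreme points\<close>

lemma eq_mod_affine_refl_iff: "eq_mod_affine w w \<longleftrightarrow> w absolutely_integrable_on unit_cube"
  using eq_mod_affine_refl by (blast elim: eq_mod_affineE)

lemma class_representative:
  fixes g :: "'n::finite l1_mod_affine"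
  shows "\<exists>u. integrable lborel u \<and> eq_mod_affine u u \<and> proj u = g"
proof -
  let ?f = "rep_l1_mod_affine g"
  have "eq_mod_affine ?f ?f" by (rule Quotient3_rep_reflp[OF Quotient3_l1_mod_affine])
  then have "?f absolutely_integrable_on unit_cube" by (rule eq_mod_affineE)
  then obtain u where u: "integrable lborel u" "eq_mod_affine u ?f"
    using borel_representative by blast
  have "proj u = proj ?f" by (rule Quotient3_rel_abs[OF Quotient3_l1_mod_affine, OF u(2)])
  also have "\<dots> = g" by (rule Quotient3_abs_rep[OF Quotient3_l1_mod_affine])
  finally have "proj u = g" .
  moreover have "eq_mod_affine u u"
    using u(2) eq_mod_affine_refl by (blast elim: eq_mod_affineE)
  ultimately show ?thesis using u(1) by blast
qed

section \<open>Ball and sphere in terms of pairings\<close>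

lemma hessian_var_le_iff:
  assumes "integrable lborel u" "eq_mod_affine u u" "W \<subseteq> unit_cube"
  shows "hessian_var (proj u) W \<le> ereal c \<longleftrightarrow> (\<forall>F\<in>test_fields W. hess_pairing u F \<le> c)"
proof -
  have "W \<inter> unit_cube = W" using assms(3) by blast
  then show ?thesis
    unfolding hessian_var_representative[OF assms(1,2)] by (simp add: SUP_le_iff)
qed

lemma proj_linear:
  assumes "eq_mod_affine u u" "eq_mod_affine v v"
  shows "a *\<^sub>R proj u + b *\<^sub>R proj v = proj (\<lambda>x. a * u x + b * v x)"
    and "eq_mod_affine (\<lambda>x. a * u x + b * v x) (\<lambda>x. a * u x + b * v x)"
proof -
  have int: "eq_mod_affine (\<lambda>x. a * w x) (\<lambda>x. a * w x)" if "eq_mod_affine w w" for w a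
    using that by (blast intro: eq_mod_affine_refl absolutely_integrable_on_cmult elim: eq_mod_affineE)
  have "a *\<^sub>R proj u + b *\<^sub>R proj v = proj (\<lambda>x. a * u x) + proj (\<lambda>x. b * v x)"
    by (simp add: scaleR_l1_mod_affine.abs_eq assms)
  also have "\<dots> = proj (\<lambda>x. a * u x + b * v x)"
    by (rule plus_l1_mod_affine.abs_eq) (intro int assms)+
  finally show "a *\<^sub>R proj u + b *\<^sub>R proj v = proj (\<lambda>x. a * u x + b * v x)" .
  show "eq_mod_affine (\<lambda>x. a * u x + b * v x) (\<lambda>x. a * u x + b * v x)"
    using int[OF assms(1), of a] int[OF assms(2), of b]
    unfolding eq_mod_affine_refl_iff by (rule absolutely_integrable_on_plus)
qed

lemma hess_pairing_linear:
  assumes "integrable lborel u" "integrable lborel v" "test_matrix F"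
  shows "hess_pairing (\<lambda>x. a * u x + b * v x) F = a * hess_pairing u F + b * hess_pairing v F"
  using hess_pairing_add_left[of "\<lambda>x. a * u x" "\<lambda>x. b * v x" F] assms
  by (simp add: hess_pairing_cmult_left)

lemma hessian_ball_iff:
  assumes "integrable lborel u" "eq_mod_affine u u"
  shows "proj u \<in> hessian_ball \<longleftrightarrow> (\<forall>F\<in>test_fields unit_cube. hess_pairing u F \<le> 1)"
  using hessian_var_le_iff[OF assms subset_refl, of 1] by (simp add: hessian_ball_def one_ereal_def)

lemma sphere_near_optimal:
  assumes u: "integrable lborel u" "eq_mod_affine u u" and S: "proj u \<in> hessian_sphere" and c: "c < 1"
  shows "\<exists>F\<in>test_fields unit_cube. hess_pairing u F > c"
proof (rule ccontr)
  assume "\<not> ?thesis"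
  then have "hessian_var (proj u) unit_cube \<le> ereal c"
    unfolding hessian_var_le_iff[OF u subset_refl] by force
  then have "(1::ereal) \<le> ereal c" using S by (simp add: hessian_sphere_def)
  with c show False by (simp add: one_ereal_def)
qed

lemma sphere_imp_ball: "g \<in> hessian_sphere \<Longrightarrow> g \<in> hessian_ball"
  by (simp add: hessian_sphere_def hessian_ball_def)

text \<open>For \<open>c > 1\<close>, a field whose pairing with \<open>g\<close> exceeds
  \<open>1 / c\<close> violates the bound for \<open>c g\<close>.\<close>

lemma sphere_scaleR_in_ball:
  fixes g :: "'n::finite l1_mod_affine"
  assumes g: "g \<in> hessian_sphere" and c: "c *\<^sub>R g \<in> hessian_ball"
  shows "c \<le> 1"
proof (rule ccontr)
  assume "\<not> c \<le> 1"
  then have c1: "c > 1" by simp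
  obtain u where u: "integrable lborel u" "eq_mod_affine u u" "proj u = g"
    using class_representative by blast
  have cu: "c *\<^sub>R g = proj (\<lambda>x. c * u x)" using u(2,3) scaleR_l1_mod_affine.abs_eq by metis
  have e: "eq_mod_affine (\<lambda>x. c * u x) (\<lambda>x. c * u x)"
    using u(2) by (blast intro: eq_mod_affine_refl absolutely_integrable_on_cmult elim: eq_mod_affineE)
  have le: "hess_pairing (\<lambda>x. c * u x) F \<le> 1" if "F \<in> test_fields unit_cube" for F
    using hessian_ball_iff[OF integrable_mult_right[OF u(1)] e] c that unfolding cu by blast
  obtain F where F: "F \<in> test_fields unit_cube" "hess_pairing u F > 1 / c"
    using sphere_near_optimal[OF u(1,2), of "1 / c"] g u(3) c1 by (auto simp: field_simps)
  have "c * hess_pairing u F > 1" using F(2) c1 by (simp add: field_simps)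
  with le[OF F(1)] show False by (simp add: hess_pairing_cmult_left)
qed

lemma smooth_cutoff:
  fixes K U :: "(real^'n::finite) set"
  assumes K: "compact K" and U: "open U" "K \<subseteq> U"
  obtains \<eta> K' where "smooth \<eta>" "\<And>x. 0 \<le> \<eta> x" "\<And>x. \<eta> x \<le> 1" "\<And>x. x \<in> K \<Longrightarrow> \<eta> x = 1"
    "compact K'" "K' \<subseteq> U" "\<And>x. x \<notin> K' \<Longrightarrow> \<eta> x = 0"
proof -
  obtain e where e: "e > 0" "\<And>x. x \<in> K \<Longrightarrow> cball x e \<subseteq> U"
    using compact_subset_open_cball[OF K U] by blast
  \<comment> \<open>Half of the margin goes into thickening \<open>K\<close>, the other half into
    the mollification.\<close>
  define d where "d = e / 2"
  have d: "d > 0" using e(1) by (simp add: d_def)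
  define P where "P = {x + y |x y. x \<in> K \<and> y \<in> cball 0 d}"
  define K' where "K' = {x + y |x y. x \<in> K \<and> y \<in> cball 0 e}"
  have Pc: "compact P" "compact K'" unfolding P_def K'_def by (intro compact_sums K compact_cball)+
  have Pb: "P \<in> sets borel" "bounded P" using borel_compact[OF Pc(1)] compact_imp_bounded[OF Pc(1)] .
  show ?thesis
  proof (rule that[of "conv (indicator P) (mollifier d)" K'])
    show "conv (indicator P) (mollifier d) x = 1" if "x \<in> K" for x
    proof (rule conv_indicator_eq[OF Pb d])
      fix y assume "dist x y < d"
      then have "y - x \<in> cball 0 d" by (simp add: dist_norm norm_minus_commute)
      then have "x + (y - x) \<in> P" using that unfolding P_def by blast
      then show "indicator P y = (1::real)" by simp
    qed
    show "K' \<subseteq> U"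
    proof
      fix z assume "z \<in> K'"
      then obtain x y where "z = x + y" "x \<in> K" "norm y \<le> e" by (auto simp: K'_def)
      then have "z \<in> cball x e" by (simp add: dist_norm)
      with e(2)[OF \<open>x \<in> K\<close>] show "z \<in> U" by blast
    qed
    show "conv (indicator P) (mollifier d) z = 0" if "z \<notin> K'" for z
    proof (rule conv_eq_0[of d])
      show "mollifier d x = 0" if "norm x \<ge> d" for x :: "real^'n" by (rule mollifier_eq_0[OF d that])
      fix y assume zy: "dist z y < d"
      have "y \<notin> P"
      proof
        assume "y \<in> P"
        then obtain x w where xw: "y = x + w" "x \<in> K" "norm w \<le> d" by (auto simp: P_def)
        have "norm (w + (z - y)) \<le> e"
          using norm_triangle_ineq[of w "z - y"] xw(3) zy by (simp add: d_def dist_norm)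
        then have "x + (w + (z - y)) \<in> K'" using xw(2) unfolding K'_def by (auto simp: dist_norm)
        then show False using that xw(1) by (simp add: algebra_simps)
      qed
      then show "indicator P y = (0::real)" by simp
    qed
  qed (use smooth_conv_indicator[OF Pb d] conv_indicator_bounds[OF Pb d] Pc in auto)
qed

text \<open>If \<open>g\<close> is flat near \<open>x\<close>, a near-optimal test field for \<open>g\<close> can be cut off near \<open>x\<close> at no
  cost; it is then also near-optimal for \<open>h\<^sub>1\<close>, so there is no variation of \<open>h\<^sub>1\<close> left near \<open>x\<close>.\<close>

lemma support_of_summand:
  fixes g h1 h2 :: "'n::finite l1_mod_affine"
  assumes g: "g \<in> hessian_sphere" and h: "h1 \<in> hessian_ball" "h2 \<in> hessian_ball"
    and t: "0 < t" "t < 1" and eq: "g = (1 - t) *\<^sub>R h1 + t *\<^sub>R h2"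
  shows "hessian_support h1 \<subseteq> hessian_support g"
proof
  fix x assume x: "x \<in> hessian_support h1"
  obtain u1 where u1: "integrable lborel u1" "eq_mod_affine u1 u1" "proj u1 = h1" using class_representative by blast
  obtain u2 where u2: "integrable lborel u2" "eq_mod_affine u2 u2" "proj u2 = h2" using class_representative by blast
  define u where "u x = (1 - t) * u1 x + t * u2 x" for x
  have u: "integrable lborel u" "eq_mod_affine u u" "proj u = g"
    using u1 u2 proj_linear[OF u1(2) u2(2), of "1 - t" t] eq by (auto simp: u_def[abs_def])
  have lin: "hess_pairing u F = (1 - t) * hess_pairing u1 F + t * hess_pairing u2 F" if "test_matrix F" for F
    unfolding u_def[abs_def] by (rule hess_pairing_linear[OF u1(1) u2(1) that])
  have le: "hess_pairing u1 F \<le> 1" "hess_pairing u2 F \<le> 1" if "F \<in> test_fields unit_cube" for F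
    using hessian_ball_iff[OF u1(1,2)] hessian_ball_iff[OF u2(1,2)] h that unfolding u1(3) u2(3) by blast+
  show "x \<in> hessian_support g"
  proof (rule ccontr)
    assume "x \<notin> hessian_support g"
    moreover have "x \<in> unit_cube" using x by (simp add: hessian_support_def)
    ultimately obtain U where U: "open U" "U \<subseteq> unit_cube" "x \<in> U" "\<not> hessian_var g U > 0"
      unfolding hessian_support_def by blast
    have "hessian_var (proj u) U \<le> ereal 0" using U(4) u(3) by (simp add: zero_ereal_def[symmetric])
    then have "hess_pairing u F \<le> 0" if "F \<in> test_fields U" for F
      using hessian_var_le_iff[OF u(1,2) U(2)] that by blast
    then have u0: "hess_pairing u F = 0" if "F \<in> test_fields U" for F
      using that test_fields_uminus[OF that] hess_pairing_uminus_field[OF test_fields_test_matrix[OF that], of u]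
      by (metis antisym neg_le_0_iff_le)
    \<comment> \<open>\<open>F1\<close> is an arbitrary field near \<open>x\<close>. The defect
      \<open>e\<close> of a near-optimal field for \<open>g\<close> becomes
      \<open>e / (1 - t)\<close> for \<open>h1\<close>, because \<open>h2\<close> contributes at
      most \<open>t\<close>.\<close>
    have small: "hess_pairing u1 F1 \<le> e / (1 - t)" if F1: "F1 \<in> test_fields U" and e: "e > 0" for F1 e
    proof -
      obtain F where F: "F \<in> test_fields unit_cube" "hess_pairing u F > 1 - e"
        using sphere_near_optimal[OF u(1,2), of "1 - e"] g u(3) e by auto
      obtain KF where KF: "compact KF" "KF \<subseteq> unit_cube" "\<forall>x. x \<notin> KF \<longrightarrow> F x = 0" using F(1) by (rule test_fieldsE)
      obtain K1 where K1: "compact K1" "K1 \<subseteq> U" "\<forall>x. x \<notin> K1 \<longrightarrow> F1 x = 0" using F1 by (rule test_fieldsE)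
      obtain \<eta> K' where \<eta>: "smooth \<eta>" "\<And>x. 0 \<le> \<eta> x" "\<And>x. \<eta> x \<le> 1" "\<And>x. x \<in> K1 \<Longrightarrow> \<eta> x = 1"
        and K': "compact K'" "K' \<subseteq> U" "\<And>x. x \<notin> K' \<Longrightarrow> \<eta> x = 0"
        using smooth_cutoff[OF K1(1) U(1) K1(2)] by blast
      have smF: "smooth (\<lambda>x. F x $ i $ j)" for i j by (rule test_fun_smooth[OF test_fields_test_fun[OF F(1)]])
      have inner: "(\<lambda>x. \<eta> x *\<^sub>R F x) \<in> test_fields U"
      proof (rule test_fieldsI[OF _ K'(1,2)])
        show "smooth (\<lambda>x. (\<eta> x *\<^sub>R F x) $ i $ j)" for i j
          using smooth_mult[OF \<eta>(1) smF] by simp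
        show "contraction (\<eta> x *\<^sub>R F x)" for x
          using \<eta>(2,3)[of x] by (intro contraction_scaleR test_fields_contraction[OF F(1)]) simp
      qed (simp add: K'(3))
      \<comment> \<open>\<open>F\<close> multiplied by the cutoff \<open>1 - \<eta>\<close>, written
        as a sum so that the removed part, whose pairing with \<open>u\<close> is zero, can be split
        off.\<close>
      define F0 where "F0 x = F x + - (\<eta> x *\<^sub>R F x)" for x
      have F0: "F0 \<in> test_fields unit_cube" and F01: "(\<lambda>x. F0 x + F1 x) \<in> test_fields unit_cube"
      proof -
        have eq0: "F0 x = (1 - \<eta> x) *\<^sub>R F x" for x by (simp add: F0_def scaleR_diff_left)
        have sm0: "smooth (\<lambda>x. F0 x $ i $ j)" for i j
          using smooth_mult[OF smooth_diff[OF smooth_const \<eta>(1)] smF, of 1 i j] by (simp add: eq0)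
        have c0: "contraction (F0 x)" for x
          unfolding eq0 using \<eta>(2,3)[of x] by (intro contraction_scaleR test_fields_contraction[OF F(1)]) simp
        show "F0 \<in> test_fields unit_cube"
          by (rule test_fieldsI[OF sm0 KF(1,2) _ c0]) (simp add: eq0 KF(3))
        show "(\<lambda>x. F0 x + F1 x) \<in> test_fields unit_cube"
        proof (rule test_fieldsI[of _ "KF \<union> K1"])
          show "smooth (\<lambda>x. (F0 x + F1 x) $ i $ j)" for i j
            using smooth_add[OF sm0 test_fun_smooth[OF test_fields_test_fun[OF F1]]] by simp
          show "compact (KF \<union> K1)" by (intro compact_Un KF K1)
          show "KF \<union> K1 \<subseteq> unit_cube" using KF(2) K1(2) U(2) by blast
          show "F0 x + F1 x = 0" if "x \<notin> KF \<union> K1" for x using that by (simp add: eq0 KF(3) K1(3))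
          \<comment> \<open>\<open>F0\<close> vanishes wherever \<open>F1\<close> may not, so at
            each point only one summand is present.\<close>
          show "contraction (F0 x + F1 x)" for x
          proof (cases "x \<in> K1")
            case True
            then show ?thesis using \<eta>(4) test_fields_contraction[OF F1] by (simp add: eq0)
          next
            case False
            then show ?thesis using c0 K1(3) by simp
          qed
        qed
      qed
      have "hess_pairing u F0 = hess_pairing u F + hess_pairing u (\<lambda>x. - (\<eta> x *\<^sub>R F x))"
        unfolding F0_def[abs_def]
        by (rule hess_pairing_add_field[OF u(1) test_fields_test_matrix[OF F(1)] test_fields_test_matrix[OF test_fields_uminus[OF inner]]])
      also have "\<dots> = hess_pairing u F" using u0[OF test_fields_uminus[OF inner]] by simp
      finally have "(1 - t) * hess_pairing u1 F0 + t * hess_pairing u2 F0 > 1 - e"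
        using F(2) lin[OF test_fields_test_matrix[OF F0]] by simp
      moreover have "t * hess_pairing u2 F0 \<le> t * 1" using le(2)[OF F0] t by (intro mult_left_mono) auto
      ultimately have "(1 - t) * hess_pairing u1 F0 \<ge> 1 - t - e" by linarith
      moreover have "hess_pairing u1 F0 + hess_pairing u1 F1 \<le> 1"
        using le(1)[OF F01] hess_pairing_add_field[OF u1(1) test_fields_test_matrix[OF F0] test_fields_test_matrix[OF F1]] by simp
      then have "(1 - t) * (hess_pairing u1 F0 + hess_pairing u1 F1) \<le> (1 - t) * 1" using t by (intro mult_left_mono) auto
      ultimately have "(1 - t) * hess_pairing u1 F1 \<le> e" by (simp add: distrib_left)
      then show ?thesis using t by (simp add: pos_le_divide_eq mult.commute)
    qed
    \<comment> \<open>If the pairing were positive, \<open>small\<close> with \<open>e\<close> equal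
      to \<open>(1 - t) / 2\<close> times it would bound it by half of itself.\<close>
    have "hess_pairing u1 F1 \<le> 0" if F1: "F1 \<in> test_fields U" for F1
    proof (rule ccontr)
      assume "\<not> hess_pairing u1 F1 \<le> 0"
      then have p: "hess_pairing u1 F1 > 0" by simp
      have "hess_pairing u1 F1 \<le> ((1 - t) * (hess_pairing u1 F1 / 2)) / (1 - t)"
        using p t by (intro small[OF F1]) simp
      also have "\<dots> = hess_pairing u1 F1 / 2" using t by (intro nonzero_mult_div_cancel_left) simp
      finally show False using p by simp
    qed
    then have "hessian_var h1 U \<le> 0"
      using hessian_var_le_iff[OF u1(1,2) U(2), of 0] u1(3) by (simp add: zero_ereal_def)
    moreover have "hessian_var h1 U > 0" using x U(1-3) unfolding hessian_support_def by blast
    ultimately show False by simp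
  qed
qed

text \<open>The end points of an open segment through \<open>g\<close> are multiples of
  \<open>g\<close> with factors at most 1, not both equal to 1, so \<open>g\<close> equals a
  multiple of itself with factor below 1. This forces \<open>g = 0\<close>, which is not on the
  sphere.\<close>

lemma extreme_of_rigid:
  fixes g :: "'n::finite l1_mod_affine"
  assumes g: "g \<in> hessian_sphere"
    and rigid: "\<forall>h\<in>hessian_ball. hessian_support h \<subseteq> hessian_support g \<longrightarrow> h \<in> span {g}"
  shows "g extreme_point_of hessian_ball"
  unfolding extreme_point_of_def
proof (intro conjI ballI notI)
  show "g \<in> hessian_ball" by (rule sphere_imp_ball[OF g])
  fix h1 h2 :: "'n l1_mod_affine"
  assume h: "h1 \<in> hessian_ball" "h2 \<in> hessian_ball" and "g \<in> open_segment h1 h2"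
  then obtain t where t: "0 < t" "t < 1" "g = (1 - t) *\<^sub>R h1 + t *\<^sub>R h2" and ne: "h1 \<noteq> h2"
    by (auto simp: in_segment)
  have "hessian_support h1 \<subseteq> hessian_support g" by (rule support_of_summand[OF g h t])
  then obtain c where c: "h1 = c *\<^sub>R g" using rigid h(1) by (auto simp: span_singleton)
  have "hessian_support h2 \<subseteq> hessian_support g"
    by (rule support_of_summand[OF g h(2,1), of "1 - t"]) (use t in \<open>auto simp: add.commute\<close>)
  then obtain d where d: "h2 = d *\<^sub>R g" using rigid h(2) by (auto simp: span_singleton)
  have cd: "c \<le> 1" "d \<le> 1" using sphere_scaleR_in_ball[OF g] h c d by auto
  have "c \<noteq> 1 \<or> d \<noteq> 1" using ne c d by auto
  have "(1 - t) * c + t * d < 1"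
  proof (cases "c = 1")
    case True
    then have "d < 1" using \<open>c \<noteq> 1 \<or> d \<noteq> 1\<close> cd by simp
    then have "t * d < t * 1" using t by (intro mult_strict_left_mono)
    with True show ?thesis by simp
  next
    case False
    then have "(1 - t) * c < (1 - t) * 1" using cd t by (intro mult_strict_left_mono) auto
    moreover have "t * d \<le> t * 1" using cd t by (intro mult_left_mono) auto
    ultimately have "(1 - t) * c + t * d < (1 - t) * 1 + t * 1" by (rule add_less_le_mono)
    then show ?thesis by simp
  qed
  moreover have "g = ((1 - t) * c + t * d) *\<^sub>R g"
    using t(3) unfolding c d by (simp add: scaleR_add_left)
  then have "(1 - ((1 - t) * c + t * d)) *\<^sub>R g = 0" by (simp add: scaleR_diff_left)
  ultimately have "g = 0" by simp
  \<comment> \<open>With \<open>g = 0\<close> also \<open>2 g\<close> lies in the ball, yet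
    multiples of \<open>g\<close> in the ball have factor at most 1.\<close>
  then have "2 *\<^sub>R g \<in> hessian_ball" using sphere_imp_ball[OF g] by simp
  from sphere_scaleR_in_ball[OF g this] show False by simp
qed

text \<open>Let \<open>a\<close> and \<open>b\<close> be the variations of
  \<open>g \<plusminus> e h\<close>. Proportional Hessians give \<open>a + b \<le> 2\<close>, the
  midpoint property gives \<open>a + b \<ge> 2\<close>, so \<open>g\<close> is the combination of
  the two normalised classes with weights \<open>a / 2\<close> and \<open>b / 2\<close>; extremality
  identifies both with \<open>g\<close>.\<close>

lemma rigid_of_extreme:
  fixes g h :: "'n::finite l1_mod_affine"
  assumes gc: "g \<in> cpwl_classes" and g: "g \<in> hessian_sphere" and ext: "g extreme_point_of hessian_ball"
    and h: "h \<in> hessian_ball" and supp: "hessian_support h \<subseteq> hessian_support g"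
  shows "h \<in> span {g}"
proof -
  obtain f where f: "f \<in> cpwl unit_cube" "f absolutely_integrable_on unit_cube" "g = proj f"
    using gc unfolding cpwl_classes_def by blast
  obtain u where u: "integrable lborel u" "eq_mod_affine u f" "AE x in lborel. x \<in> unit_cube \<longrightarrow> u x = f x"
    using borel_representative[OF f(2)] by blast
  have ug: "proj u = g" using Quotient3_rel_abs[OF Quotient3_l1_mod_affine, OF u(2)] f(3) by simp
  have uu: "eq_mod_affine u u" using u(2) eq_mod_affine_refl by (blast elim: eq_mod_affineE)
  obtain v where v: "integrable lborel v" "eq_mod_affine v v" "proj v = h"
    using class_representative by blast
  obtain H A B where arr: "arrangement H" and fAB:
    "\<And>x. x \<in> unit_cube \<Longrightarrow> \<forall>p\<in>H. lf p x \<noteq> 0 \<Longrightarrow> f x = A (pos_set H x) \<bullet> x + B (pos_set H x)"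
    using cpwl_arrangement[OF f(1)] by blast
  interpret arrangement H by (rule arr)
  have pu: "AE x in lborel. x \<in> unit_cube \<longrightarrow> u x = A (pos_set H x) \<bullet> x + B (pos_set H x)"
    using u(3) AE_off_arrangement by (elim AE_mp) (use fAB in \<open>auto intro!: AE_I2\<close>)
  have transfer: "\<exists>r>0. \<exists>a b. AE y in lborel. y \<in> ball z r \<longrightarrow> v y = a \<bullet> y + b"
    if "open W" "W \<subseteq> unit_cube" "AE y in lborel. y \<in> W \<longrightarrow> u y = a \<bullet> y + b" "z \<in> W" for W a b z
    using support_affine_transfer[OF u(1) uu v(1,2) _ that] supp ug v(3) by simp
  \<comment> \<open>On the open convex cell \<open>u\<close> is affine, so the support inclusion
    makes \<open>v\<close> locally affine, and convexity makes the coefficients uniform.\<close>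
  have ex: "\<exists>p. AE y in lborel. y \<in> unit_cube \<and> (\<forall>p\<in>H. lf p y \<noteq> 0) \<and> pos_set H y = S \<longrightarrow> v y = fst p \<bullet> y + snd p" for S
  proof -
    let ?C = "{x \<in> unit_cube. (\<forall>p\<in>H. lf p x \<noteq> 0) \<and> pos_set H x = S}"
    note C = cell_convex_open[OF unit_cube_facts(2,1), of S]
    have "AE y in lborel. y \<in> ?C \<longrightarrow> u y = A S \<bullet> y + B S"
      using pu by (elim AE_mp) (auto intro!: AE_I2)
    then have "\<exists>r>0. \<exists>a b. AE y in lborel. y \<in> ball z r \<longrightarrow> v y = a \<bullet> y + b" if "z \<in> ?C" for z
      using that by (intro transfer[OF C(2)]) auto
    from locally_affine_imp_affine[OF C this]
    obtain a b where "AE y in lborel. y \<in> ?C \<longrightarrow> v y = a \<bullet> y + b" by blast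
    then show ?thesis by (intro exI[of _ "(a, b)"]) simp
  qed
  from choice[OF allI[OF ex]] obtain q where q: "\<forall>S. AE y in lborel. y \<in> unit_cube \<and> (\<forall>p\<in>H. lf p y \<noteq> 0) \<and> pos_set H y = S
      \<longrightarrow> v y = fst (q S) \<bullet> y + snd (q S)" ..
  have "AE y in lborel. \<forall>S\<in>Pow H. y \<in> unit_cube \<and> (\<forall>p\<in>H. lf p y \<noteq> 0) \<and> pos_set H y = S
      \<longrightarrow> v y = fst (q S) \<bullet> y + snd (q S)"
    using finite_H by (intro AE_finite_allI q[rule_format]) simp
  then have pv: "AE x in lborel. x \<in> unit_cube \<longrightarrow> v x = (fst \<circ> q) (pos_set H x) \<bullet> x + (snd \<circ> q) (pos_set H x)"
    using AE_off_arrangement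
  proof (elim AE_mp, intro AE_I2 impI)
    fix y
    assume *: "\<forall>S\<in>Pow H. y \<in> unit_cube \<and> (\<forall>p\<in>H. lf p y \<noteq> 0) \<and> pos_set H y = S \<longrightarrow> v y = fst (q S) \<bullet> y + snd (q S)"
      "\<forall>p\<in>H. lf p y \<noteq> 0" "y \<in> unit_cube"
    have "pos_set H y \<in> Pow H" using pos_set_subset by blast
    from bspec[OF *(1) this] show "v y = (fst \<circ> q) (pos_set H y) \<bullet> y + (snd \<circ> q) (pos_set H y)"
      using *(2,3) by simp
  qed
  have var: "hessian_variation w unit_cube \<le> ereal 1"
    if "integrable lborel w" "eq_mod_affine w w" "proj w \<in> hessian_ball" for w :: "real^'n \<Rightarrow> real"
  proof -
    have "w \<in> borel_measurable borel" using that(1) by simp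
    from hessian_variation_eq[OF this] show ?thesis
      using hessian_ball_iff[OF that(1,2)] that(3) by (simp add: SUP_le_iff)
  qed
  interpret P: piecewise_affine_pair H unit_cube u A B 1 v "fst \<circ> q" "snd \<circ> q" 1
  proof
    show "hessian_variation u unit_cube \<le> ereal 1" "hessian_variation v unit_cube \<le> ereal 1"
      using var u(1) uu v(1,2) ug v(3) h sphere_imp_ball[OF g] by blast+
    show "\<exists>r>0. \<exists>a b. AE y in lborel. y \<in> ball z r \<longrightarrow> v y = a \<bullet> y + b"
      if "ball x d \<subseteq> unit_cube" "AE y in lborel. y \<in> ball x d \<longrightarrow> u y = a \<bullet> y + b" "z \<in> ball x d" for x d a b z
      by (rule transfer[OF open_ball that])
  qed (use unit_cube_facts u(1) v(1) pu pv in auto)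
  \<comment> \<open>The reciprocal of the ratio bound keeps the weights of the two test fields
    nonnegative; the bound \<open>1 / 2\<close> keeps both perturbed variations positive, so that
    they can be divided by.\<close>
  define e where "e = min (1 / 2) (1 / (P.ratio_bound + 1))"
  have rb: "P.ratio_bound + 1 > 0" using P.ratio_bound_nonneg by linarith
  have e: "e > 0" "e \<le> 1 / 2" using rb by (auto simp: e_def)
  have er: "e * P.ratio_bound \<le> 1"
  proof -
    have "e * P.ratio_bound \<le> (1 / (P.ratio_bound + 1)) * (P.ratio_bound + 1)"
      using rb P.ratio_bound_nonneg by (intro mult_mono) (auto simp: e_def)
    then show ?thesis using rb by simp
  qed
  let ?T = "test_fields (unit_cube :: (real^'n) set)"
  define wp where "wp x = 1 * u x + e * v x" for x
  define wm where "wm x = 1 * u x + (- e) * v x" for x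
  note lp = hess_pairing_linear[OF u(1) v(1) test_fields_test_matrix, of _ _ 1 e, folded wp_def[abs_def]]
  note lm = hess_pairing_linear[OF u(1) v(1) test_fields_test_matrix, of _ _ 1 "- e", folded wm_def[abs_def]]
  have wp: "integrable lborel wp" "eq_mod_affine wp wp" "proj wp = g + e *\<^sub>R h"
    using proj_linear[OF uu v(2), of 1 e] u(1) v(1) by (simp_all add: wp_def[abs_def] ug v(3))
  have wm: "integrable lborel wm" "eq_mod_affine wm wm" "proj wm = g + (- e) *\<^sub>R h"
    using proj_linear[OF uu v(2), of 1 "- e"] u(1) v(1) by (simp_all add: wm_def[abs_def] ug v(3))
  have sum2: "hess_pairing wp F + hess_pairing wm F' \<le> 2" if "F \<in> ?T" "F' \<in> ?T" for F F'
    using P.perturbed_pairing_le[OF unit_cube_facts(2) less_imp_le[OF e(1)] er that] lp[OF that(1)] lm[OF that(2)]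
    by (simp add: right_diff_distrib)
  have v1: "\<bar>hess_pairing v F\<bar> \<le> 1" if "F \<in> ?T" for F
  proof -
    have "\<forall>F\<in>?T. hess_pairing v F \<le> 1" using hessian_ball_iff[OF v(1,2)] h v(3) by simp
    then have "hess_pairing v F \<le> 1" "hess_pairing v (\<lambda>x. - F x) \<le> 1"
      using that test_fields_uminus[OF that] by blast+
    then show ?thesis using hess_pairing_uminus_field[OF test_fields_test_matrix[OF that], of v] by simp
  qed
  \<comment> \<open>Pairings of \<open>v\<close> are bounded by 1 and \<open>e \<le> 1 / 2\<close>,
    so the value \<open>3 / 4\<close> leaves more than \<open>1 / 4\<close> for either sign.\<close>
  obtain F0 where F0: "F0 \<in> ?T" "hess_pairing u F0 > 3 / 4"
    using sphere_near_optimal[OF u(1) uu, of "3 / 4"] g ug by auto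
  have ev: "\<bar>e * hess_pairing v F0\<bar> \<le> 1 / 2"
    unfolding abs_mult using v1[OF F0(1)] e mult_mono[of "\<bar>e\<bar>" "1 / 2" "\<bar>hess_pairing v F0\<bar>" 1] by simp
  have pos: "hess_pairing wp F0 > 0" "hess_pairing wm F0 > 0"
    using ev F0 lp[OF F0(1)] lm[OF F0(1)] by auto
  \<comment> \<open>Real suprema: fixing \<open>F0\<close> for the other perturbation in
    \<open>sum2\<close> bounds each of the two sets.\<close>
  define a where "a = (SUP F\<in>?T. hess_pairing wp F)"
  define b where "b = (SUP F\<in>?T. hess_pairing wm F)"
  have bdd: "bdd_above (hess_pairing wp ` ?T)" "bdd_above (hess_pairing wm ` ?T)"
  proof -
    show "bdd_above (hess_pairing wp ` ?T)"
      by (intro bdd_aboveI2[of _ _ "2 - hess_pairing wm F0"]) (use sum2[OF _ F0(1)] in \<open>simp add: le_diff_eq\<close>)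
    show "bdd_above (hess_pairing wm ` ?T)"
      by (intro bdd_aboveI2[of _ _ "2 - hess_pairing wp F0"]) (use sum2[OF F0(1)] in \<open>simp add: le_diff_eq add.commute\<close>)
  qed
  have aF: "hess_pairing wp F \<le> a" if "F \<in> ?T" for F unfolding a_def by (rule cSUP_upper[OF that bdd(1)])
  have bF: "hess_pairing wm F \<le> b" if "F \<in> ?T" for F unfolding b_def by (rule cSUP_upper[OF that bdd(2)])
  have ab0: "a > 0" "b > 0" using aF[OF F0(1)] bF[OF F0(1)] pos by auto
  have ne: "?T \<noteq> {}" using F0(1) by blast
  have "a \<le> 2 - hess_pairing wm F'" if "F' \<in> ?T" for F'
    unfolding a_def using sum2 that by (intro cSUP_least[OF ne]) force
  then have "hess_pairing wm F' \<le> 2 - a" if "F' \<in> ?T" for F' using that by force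
  then have "b \<le> 2 - a" unfolding b_def by (intro cSUP_least[OF ne])
  \<comment> \<open>As \<open>g\<close> is the midpoint, every pairing of \<open>u\<close> is at
    most \<open>(a + b) / 2\<close>, while near-optimal fields approach 1.\<close>
  moreover have "\<not> (a + b) / 2 < 1"
  proof
    assume "(a + b) / 2 < 1"
    then obtain F where F: "F \<in> ?T" "hess_pairing u F > (a + b) / 2"
      using sphere_near_optimal[OF u(1) uu, of "(a + b) / 2"] g ug by auto
    then show False using aF[OF F(1)] bF[OF F(1)] lp[OF F(1)] lm[OF F(1)] by auto
  qed
  ultimately have ab: "a + b = 2" by simp
  have inball: "(1 / c) *\<^sub>R proj w \<in> hessian_ball"
    if w: "integrable lborel w" "eq_mod_affine w w" and c: "c > 0" "\<And>F. F \<in> ?T \<Longrightarrow> hess_pairing w F \<le> c"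
    for w :: "real^'n \<Rightarrow> real" and c
  proof -
    have e1: "(1 / c) *\<^sub>R proj w = proj (\<lambda>x. (1 / c) * w x)" by (rule scaleR_l1_mod_affine.abs_eq[OF w(2)])
    have e2: "eq_mod_affine (\<lambda>x. (1 / c) * w x) (\<lambda>x. (1 / c) * w x)"
      using w(2) by (blast intro: eq_mod_affine_refl absolutely_integrable_on_cmult elim: eq_mod_affineE)
    show ?thesis
      unfolding e1 hessian_ball_iff[OF integrable_mult_right[OF w(1)] e2]
      using c by (simp add: hess_pairing_cmult_left[of "1 / c", simplified] hess_pairing_cmult_left)
  qed
  define gp where "gp = (1 / a) *\<^sub>R (g + e *\<^sub>R h)"
  define gm where "gm = (1 / b) *\<^sub>R (g + (- e) *\<^sub>R h)"
  have ball: "gp \<in> hessian_ball" "gm \<in> hessian_ball"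
    using inball[OF wp(1,2) ab0(1) aF] inball[OF wm(1,2) ab0(2) bF] unfolding gp_def gm_def wp(3) wm(3) by blast+
  \<comment> \<open>By \<open>a + b = 2\<close> the weight \<open>1 - b / 2\<close> is
    \<open>a / 2\<close>, so each weight cancels the normalisation up to the factor
    \<open>1 / 2\<close>.\<close>
  have comb: "g = (1 - b / 2) *\<^sub>R gp + (b / 2) *\<^sub>R gm"
  proof -
    have "(1 - b / 2) *\<^sub>R gp = (1 / 2) *\<^sub>R (g + e *\<^sub>R h)"
    proof -
      have "(1 - b / 2) * (1 / a) = 1 / 2" using ab ab0 by (simp add: field_simps)
      then show ?thesis unfolding gp_def scaleR_scaleR by simp
    qed
    moreover have "(b / 2) *\<^sub>R gm = (1 / 2) *\<^sub>R (g + (- e) *\<^sub>R h)"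
      unfolding gm_def scaleR_scaleR using ab0 by simp
    ultimately have "(1 - b / 2) *\<^sub>R gp + (b / 2) *\<^sub>R gm = (1 / 2) *\<^sub>R (g + e *\<^sub>R h) + (1 / 2) *\<^sub>R (g + (- e) *\<^sub>R h)" by simp
    also have "\<dots> = (1 / 2) *\<^sub>R (g + g)" by (simp add: scaleR_add_right[symmetric] del: scaleR_add_right)
    also have "\<dots> = g" by (simp add: scaleR_2[symmetric])
    finally show ?thesis by simp
  qed
  have t: "0 < b / 2" "b / 2 < 1" using ab ab0 by auto
  have "g \<notin> open_segment gp gm" using ext ball by (simp add: extreme_point_of_def)
  then have "gp = gm" using comb t unfolding in_segment by blast
  then have "gp = g" using comb by (simp add: scaleR_add_left[symmetric])
  then have "a *\<^sub>R g = a *\<^sub>R gp" by simp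
  also have "\<dots> = g + e *\<^sub>R h" using ab0 unfolding gp_def scaleR_scaleR by simp
  finally have "a *\<^sub>R g = g + e *\<^sub>R h" .
  then have "e *\<^sub>R h = (a - 1) *\<^sub>R g" by (simp add: scaleR_diff_left)
  then have "(1 / e) *\<^sub>R (e *\<^sub>R h) = ((a - 1) / e) *\<^sub>R g" by simp
  then have "h = ((a - 1) / e) *\<^sub>R g" using e(1) by simp
  then show ?thesis by (auto simp: span_singleton)
qed

theorem proposition23:
  fixes g :: "'n::finite l1_mod_affine"
  assumes "g \<in> cpwl_classes \<inter> hessian_sphere"
  shows "g \<in> cpwl_extreme_points \<longleftrightarrow>
    (\<forall>h\<in>hessian_ball. hessian_support h \<subseteq> hessian_support g \<longrightarrow> h \<in> span {g})"
proof -
  have g: "g \<in> cpwl_classes" "g \<in> hessian_sphere" using assms by auto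
  show ?thesis
    using rigid_of_extreme[OF g] extreme_of_rigid[OF g(2)] g(1)
    unfolding cpwl_extreme_points_def by blast
qed

end
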